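(* Let $k$ be an algebraically closed field of characteristic $2$, let $m=n=2\nu+1$, and let $D$ stand for $D^{(1\cdots n)}=\det[v^{(1)},\dots,v^{(n)}]$. Then the algebra $R_{n\times m}^{O(n)}$ is generated by the $\binom{n+1}{2}+1$ invariants $Q^{(i)}$ ($1\le i\le n$), $B^{(ij)}$ ($1\le i<j\le n$) and $D$, and the ideal of algebraic relations between them is generated by the single element $G$ defined as $$G=D^2-\frac{1}{2}\left|\begin{matrix}2Q^{(1)} & B^{(12)} &\cdots & B^{(1n)}\\ B^{(21)} & 2Q^{(2)} & \cdots & B^{(2n)}\\ \vdots & \vdots & \ddots & \vdots\\ B^{(n1)} & B^{(n2)} & \cdots & 2Q^{(n)}\end{matrix}\right|.$$
   Context: $k$ is an algebraically closed field of characteristic $2$. On $k^n$, $n=2\nu+1$, with coordinates $x_1,\dots,x_\nu,y_1,\dots,y_\nu,z$, the standard quadratic form is $q=\sum_{t=1}^\nu x_ty_t+z^2$ with polar form $\beta(v,w)=q(v+w)-q(v)-q(w)$. $O(n)$ is the group of linear automorphisms of $k^n$ preserving $q$. $R_{n\times m}$ is the algebra of polynomials over $k$ in the coordinates of $m$ indeterminate vectors $v^{(1)},\dots,v^{(m)}$ in $k^n$; $O(n)$ acts diagonally, and $R_{n\times m}^{O(n)}$ is the subalgebra of invariants. $Q^{(i)}=q(v^{(i)})$, $B^{(ij)}=\beta(v^{(i)},v^{(j)})$ (so $B^{(ij)}=B^{(ji)}$). Meaning of $\frac12$: the determinant in the definition of $G$, regarded as a polynomial over $\mathbb{Z}$ in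 independent variables $Q^{(i)}$ ($1\le i\le n$) and $B^{(ij)}=B^{(ji)}$ ($1\le i<j\le n$), has all coefficients even (as $n$ is odd); half of it is a polynomial over $\mathbb{Z}$, which is then viewed over $k$ by reducing coefficients modulo $2$. Thus $G$ is an element of the polynomial ring over $k$ in the $\binom{n+1}{2}+1$ variables $Q^{(i)},B^{(ij)},D$. *)

theory Defs
  imports
    "HOL-Library.Poly_Mapping"
    "HOL-Computational_Algebra.Computational_Algebra"
    "Jordan_Normal_Form.Determinant"
begin

section \<open>Multivariate polynomials\<close>

text \<open>
  A polynomial over \<open>'a\<close> in variables from \<open>'v\<close> is a finitely supported map from monomials
  (finitely supported exponent functions) to coefficients; the ring operations are those of
  \<open>Poly_Mapping\<close>, so multiplication is convolution.
\<close>

type_synonym ('v, 'a) mpoly = "('v \<Rightarrow>\<^sub>0 nat) \<Rightarrow>\<^sub>0 'a"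

definition mconst :: "'a::zero \<Rightarrow> ('v, 'a) mpoly" where
  "mconst c = Poly_Mapping.single 0 c"

definition mvar :: "'v \<Rightarrow> ('v, 'a::zero_neq_one) mpoly" where
  "mvar x = Poly_Mapping.single (Poly_Mapping.single x 1) 1"

text \<open>The polynomial ring in the variables \<open>V\<close>, as a subset of the ring in all variables
  from \<open>'v\<close>.\<close>

definition polys_in :: "'v set \<Rightarrow> ('v, 'a::zero) mpoly set" where
  "polys_in V = {p. \<forall>m \<in> Poly_Mapping.keys p. Poly_Mapping.keys m \<subseteq> V}"

definition msubst ::
    "('v \<Rightarrow> ('w, 'a::comm_ring_1) mpoly) \<Rightarrow> ('v, 'a) mpoly \<Rightarrow> ('w, 'a) mpoly" where
  "msubst \<phi> p = (\<Sum>m \<in> Poly_Mapping.keys p. mconst (Poly_Mapping.lookup p m) *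
     (\<Prod>x \<in> Poly_Mapping.keys m. \<phi> x ^ Poly_Mapping.lookup m x))"

text \<open>With \<open>hull\<close>, the next two predicates give the subalgebra generated by a set of polynomials
  and the ideal of the subring \<open>P\<close> generated by a subset of \<open>P\<close>.\<close>

definition is_subalgebra :: "('v, 'a::comm_ring_1) mpoly set \<Rightarrow> bool" where
  "is_subalgebra A \<longleftrightarrow> (\<forall>c. mconst c \<in> A) \<and>
     (\<forall>f \<in> A. \<forall>g \<in> A. f + g \<in> A) \<and> (\<forall>f \<in> A. \<forall>g \<in> A. f * g \<in> A)"

definition is_ideal_of :: "'r::comm_ring_1 set \<Rightarrow> 'r set \<Rightarrow> bool" where
  "is_ideal_of P I \<longleftrightarrow> I \<subseteq> P \<and> 0 \<in> I \<and>
     (\<forall>f \<in> I. \<forall>g \<in> I. f + g \<in> I) \<and> (\<forall>h \<in> P. \<forall>f \<in> I. h * f \<in> I)"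


section \<open>The quadratic form and its orthogonal group\<close>

text \<open>
  Indices start at 0. Of the \<open>2 * \<nu> + 1\<close> coordinates of a vector, the first \<open>\<nu>\<close> are the
  \<open>x\<^sub>t\<close>, the next \<open>\<nu>\<close> are the \<open>y\<^sub>t\<close> and the last one is \<open>z\<close>. The form is defined over
  every commutative ring, so that it applies to vectors of indeterminates as well.
\<close>

definition qform :: "nat \<Rightarrow> 'a::comm_ring_1 vec \<Rightarrow> 'a" where
  "qform \<nu> v = (\<Sum>t<\<nu>. v $ t * v $ (\<nu> + t)) + (v $ (2 * \<nu>))\<^sup>2"

definition polar :: "nat \<Rightarrow> 'a::comm_ring_1 vec \<Rightarrow> 'a vec \<Rightarrow> 'a" where
  "polar \<nu> v w = qform \<nu> (v + w) - qform \<nu> v - qform \<nu> w"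

definition orthogonal_group :: "nat \<Rightarrow> 'a::comm_ring_1 mat set" where
  "orthogonal_group \<nu> = {g \<in> carrier_mat (2 * \<nu> + 1) (2 * \<nu> + 1). invertible_mat g \<and>
     (\<forall>v \<in> carrier_vec (2 * \<nu> + 1). qform \<nu> (g *\<^sub>v v) = qform \<nu> v)}"


section \<open>Vector invariants\<close>

text \<open>The variable \<open>(c, i)\<close> is the \<open>c\<close>-th coordinate of the \<open>i\<close>-th indeterminate vector.\<close>

definition generic_vec :: "nat \<Rightarrow> nat \<Rightarrow> (nat \<times> nat, 'a::comm_ring_1) mpoly vec" where
  "generic_vec n i = vec n (\<lambda>c. mvar (c, i))"

definition vector_polys :: "nat \<Rightarrow> nat \<Rightarrow> (nat \<times> nat, 'a::comm_ring_1) mpoly set" where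
  "vector_polys n m = polys_in ({..<n} \<times> {..<m})"

text \<open>The polynomial \<open>f(g v\<^sup>(\<^sup>1\<^sup>), g v\<^sup>(\<^sup>2\<^sup>), \<dots>)\<close>. The usual action uses the inverse of \<open>g\<close>,
  which does not change the invariants of a group.\<close>

definition act ::
    "nat \<Rightarrow> 'a::comm_ring_1 mat \<Rightarrow> (nat \<times> nat, 'a) mpoly \<Rightarrow> (nat \<times> nat, 'a) mpoly" where
  "act n g f = msubst (\<lambda>(c, i). (map_mat mconst g *\<^sub>v generic_vec n i) $ c) f"

definition invariants :: "nat \<Rightarrow> nat \<Rightarrow> (nat \<times> nat, 'a::comm_ring_1) mpoly set" where
  "invariants \<nu> m = {f \<in> vector_polys (2 * \<nu> + 1) m.
     \<forall>g \<in> orthogonal_group \<nu>. act (2 * \<nu> + 1) g f = f}"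


section \<open>The generators and their relations\<close>

datatype gen = GenQ nat | GenB nat nat | GenD

definition gens :: "nat \<Rightarrow> gen set" where
  "gens n = {GenQ i | i. i < n} \<union> {GenB i j | i j. i < j \<and> j < n} \<union> {GenD}"

fun gen_invariant :: "nat \<Rightarrow> gen \<Rightarrow> (nat \<times> nat, 'a::comm_ring_1) mpoly" where
  "gen_invariant \<nu> (GenQ i) = qform \<nu> (generic_vec (2 * \<nu> + 1) i)"
| "gen_invariant \<nu> (GenB i j) =
     polar \<nu> (generic_vec (2 * \<nu> + 1) i) (generic_vec (2 * \<nu> + 1) j)"
| "gen_invariant \<nu> GenD =
     det (mat_of_cols (2 * \<nu> + 1) (map (generic_vec (2 * \<nu> + 1)) [0..<2 * \<nu> + 1]))"

definition relation_ideal :: "nat \<Rightarrow> (gen, 'a::comm_ring_1) mpoly set" where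
  "relation_ideal \<nu> = {p \<in> polys_in (gens (2 * \<nu> + 1)). msubst (gen_invariant \<nu>) p = 0}"

definition gram_det :: "nat \<Rightarrow> (gen, int) mpoly" where
  "gram_det n = det (mat n n (\<lambda>(i, j).
     if i = j then 2 * mvar (GenQ i) else mvar (GenB (min i j) (max i j))))"

text \<open>Halving is done over the integers; the division is exact for odd \<open>n\<close>, see
  \<open>two_times_half_gram_det\<close> below.\<close>

definition half_gram_det :: "nat \<Rightarrow> (gen, int) mpoly" where
  "half_gram_det n = Poly_Mapping.map (\<lambda>c. c div 2) (gram_det n)"

definition G_rel :: "nat \<Rightarrow> (gen, 'a::comm_ring_1) mpoly" where
  "G_rel n = (mvar GenD)\<^sup>2 - Poly_Mapping.map of_int (half_gram_det n)"


section \<open>Well-definedness of the half determinant, and the number of generators\<close>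

lemma two_dvd_sum_involution:
  fixes f :: "'b \<Rightarrow> 'a::comm_ring_1"
  assumes "finite S"
    and "\<And>x. x \<in> S \<Longrightarrow> s x \<in> S" "\<And>x. x \<in> S \<Longrightarrow> s (s x) = x"
    and "\<And>x. x \<in> S \<Longrightarrow> s x \<noteq> x" "\<And>x. x \<in> S \<Longrightarrow> f (s x) = f x"
  shows "2 dvd sum f S"
  using assms
proof (induction S rule: finite_psubset_induct)
  case (psubset S)
  show ?case
  proof (cases "S = {}")
    case False
    then obtain x where x: "x \<in> S" by blast
    let ?T = "S - {x, s x}"
    have sx: "s x \<in> S" "s x \<noteq> x" "f (s x) = f x" using psubset.prems x by auto
    have "s y \<in> ?T" if "y \<in> ?T" for y
      using that psubset.prems(1,2) x by (metis Diff_iff insert_iff singletonD empty_iff)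
    moreover have "?T \<subset> S" using x by blast
    ultimately have "2 dvd sum f ?T"
      using psubset.prems by (intro psubset.IH) auto
    moreover have "sum f S = f x + (f (s x) + sum f ?T)"
    proof -
      have "sum f S = f x + sum f (S - {x})"
        by (rule sum.remove) (use psubset.hyps x in auto)
      also have "sum f (S - {x}) = f (s x) + sum f (S - {x} - {s x})"
        by (rule sum.remove) (use psubset.hyps sx in auto)
      also have "S - {x} - {s x} = ?T" by blast
      finally show ?thesis .
    qed
    then have "sum f S = 2 * f x + sum f ?T" using sx by (simp add: algebra_simps)
    ultimately show ?thesis by simp
  qed simp
qed

lemma two_dvd_det_symmetric:
  fixes A :: "'a::comm_ring_1 mat"
  assumes A: "A \<in> carrier_mat n n" and "odd n"
    and sym: "\<And>i j. i < n \<Longrightarrow> j < n \<Longrightarrow> A $$ (i, j) = A $$ (j, i)"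
    and diag: "\<And>i. i < n \<Longrightarrow> 2 dvd A $$ (i, i)"
  shows "2 dvd det A"
proof -
  define f where "f p = signof p * (\<Prod>i = 0..<n. A $$ (i, p i))" for p
  let ?P = "{p. p permutes {0..<n}}"
  let ?I = "{p \<in> ?P. inv_into UNIV p = p}"
  have fin: "finite ?P" by (rule finite_permutations) simp
  have "2 dvd sum f (?P - ?I)"
  proof (rule two_dvd_sum_involution[where s = "inv_into UNIV"])
    fix p assume "p \<in> ?P - ?I"
    then have p: "p permutes {0..<n}" "inv_into UNIV p \<noteq> p" by auto
    show "inv_into UNIV (inv_into UNIV p) = p" using p(1) by (rule permutes_inv_inv)
    then show "inv_into UNIV p \<in> ?P - ?I" using p permutes_inv[OF p(1)] by auto
    show "inv_into UNIV p \<noteq> p" by fact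
    have "(\<Prod>i = 0..<n. A $$ (i, inv_into UNIV p i)) =
        (\<Prod>i = 0..<n. A $$ (p i, inv_into UNIV p (p i)))"
      using prod.permute[OF p(1), of "\<lambda>i. A $$ (i, inv_into UNIV p i)"] by (simp add: comp_def)
    also have "\<dots> = (\<Prod>i = 0..<n. A $$ (i, p i))"
    proof (rule prod.cong)
      fix i assume "i \<in> {0..<n}"
      then have "i < n" "p i < n" using permutes_in_image[OF p(1), of i] by auto
      then show "A $$ (p i, inv_into UNIV p (p i)) = A $$ (i, p i)"
        using sym permutes_inverses[OF p(1)] by simp
    qed simp
    finally have "(\<Prod>i = 0..<n. A $$ (i, inv_into UNIV p i)) = (\<Prod>i = 0..<n. A $$ (i, p i))" .
    moreover have "sign (inv_into UNIV p) = sign p"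
      using permutation_permutes p(1) by (intro sign_inverse) blast
    ultimately show "f (inv_into UNIV p) = f p" by (simp only: f_def)
  qed (use fin in simp)
  moreover have "2 dvd sum f ?I"
  proof (rule dvd_sum)
    fix p assume "p \<in> ?I"
    then have p: "p permutes {0..<n}" "inv_into UNIV p = p" by auto
    have pp: "p (p i) = i" for i using permutes_inverses(1)[OF p(1)] p(2) by simp
    have "\<exists>i<n. p i = i"
    proof (rule ccontr)
      assume no: "\<not> (\<exists>i<n. p i = i)"
      have "(2::int) dvd (\<Sum>i \<in> {0..<n}. 1)"
        by (rule two_dvd_sum_involution[where s = p])
          (use no pp permutes_in_image[OF p(1)] in auto)
      with \<open>odd n\<close> show False by simp
    qed
    then obtain i where i: "i < n" "p i = i" by blast
    then have "2 dvd A $$ (i, p i)" using diag by simp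
    also have "A $$ (i, p i) dvd (\<Prod>i = 0..<n. A $$ (i, p i))"
      by (rule dvd_prodI) (use i in auto)
    finally show "2 dvd f p" by (simp add: f_def)
  qed
  moreover have "det A = sum f (?P - ?I) + sum f ?I"
    using sum.subset_diff[of ?I ?P f] fin A by (auto simp: det_def f_def)
  ultimately show ?thesis by simp
qed

lemma two_times_half_gram_det:
  assumes "odd n"
  shows "2 * half_gram_det n = gram_det n"
proof -
  have "2 dvd gram_det n"
    unfolding gram_det_def
    by (rule two_dvd_det_symmetric[OF _ assms]) (auto simp: min.commute max.commute)
  then obtain H where "gram_det n = 2 * H" by (rule dvdE)
  then have H: "gram_det n = H + H" by (simp only: mult_2)
  have "Poly_Mapping.lookup (gram_det n) m = 2 * Poly_Mapping.lookup H m" for m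
    by (simp only: H lookup_add mult_2)
  then have "half_gram_det n = H"
    by (intro poly_mapping_eqI)
      (simp add: half_gram_det_def Poly_Mapping.map.rep_eq when_def)
  with H show ?thesis by (simp only: mult_2)
qed

lemma card_gens: "finite (gens n)" "card (gens n) = (n + 1 choose 2) + 1"
proof -
  let ?B = "\<lambda>n. {(i, j). i < j \<and> j < (n::nat)}"
  have B: "finite (?B n) \<and> card (?B n) = n choose 2" for n
  proof (induction n)
    case (Suc n)
    have "?B (Suc n) = ?B n \<union> (\<lambda>i. (i, n)) ` {..<n}" by (auto simp: less_Suc_eq)
    moreover have "card ((\<lambda>i. (i, n)) ` {..<n}) = n" by (simp add: card_image inj_on_def)
    moreover have "?B n \<inter> (\<lambda>i. (i, n)) ` {..<n} = {}" by auto
    ultimately show ?case using Suc by (simp add: card_Un_disjoint numeral_2_eq_2)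
  qed simp
  have eq: "gens n = insert GenD (GenQ ` {..<n} \<union> (\<lambda>(i, j). GenB i j) ` ?B n)"
    by (auto simp: gens_def)
  show "finite (gens n)" unfolding eq using B[of n] by simp
  have "card ((\<lambda>(i, j). GenB i j) ` ?B n) = n choose 2"
    using B[of n] by (subst card_image) (auto simp: inj_on_def)
  moreover have "card (GenQ ` {..<n}) = n" by (simp add: card_image inj_on_def)
  moreover have "card (GenQ ` {..<n} \<union> (\<lambda>(i, j). GenB i j) ` ?B n) =
      card (GenQ ` {..<n}) + card ((\<lambda>(i, j). GenB i j) ` ?B n)"
    by (rule card_Un_disjoint) (use B[of n] in auto)
  moreover have "GenD \<notin> GenQ ` {..<n} \<union> (\<lambda>(i, j). GenB i j) ` ?B n" by auto
  ultimately show "card (gens n) = (n + 1 choose 2) + 1"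
    unfolding eq using B[of n] by (simp add: numeral_2_eq_2)
qed

end

theory Submission
  imports Defs
begin

text \<open>
  The field is infinite, so polynomials are treated as functions on tuples of vectors. Invariance
  is used only in the form that \<open>f M = f M'\<close> whenever \<open>M\<close> and \<open>M'\<close> have the same \<open>Q\<close>, \<open>B\<close>
  and \<open>D \<noteq> 0\<close>; since \<open>k\<close> is algebraically closed, every choice of values for the \<open>Q\<close> and \<open>B\<close>
  is attained, and \<open>D\<close> is determined by them because \<open>D\<^sup>2\<close> is the half determinant.

  Generation is proved by induction on \<open>\<nu>\<close>. If \<open>B\<^sub>0\<^sub>1 \<noteq> 0\<close>, the first two vectors can be moved
  into a hyperbolic plane, the others become \<open>\<tau>\<^sub>0\<^sub>i v\<^sub>0 + \<tau>\<^sub>1\<^sub>i v\<^sub>1 + w\<^sub>i\<close> with \<open>w\<^sub>i\<close>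
  orthogonal to that plane, and the restriction of an invariant to this slice is, by the induction
  hypothesis for the \<open>w\<^sub>i\<close> and by the case of two vectors in a plane, a polynomial in
  quantities that are rational in \<open>Q, B, D\<close> with powers of \<open>B\<^sub>0\<^sub>1\<close> as denominators. So
  \<open>B\<^sub>0\<^sub>1\<^sup>N f\<close> is a polynomial \<open>P\<^sub>0(Q, B) + P\<^sub>1(Q, B) D\<close>, and \<open>B\<^sub>0\<^sub>1\<close> can be divided out because 1 and
  \<open>D\<close> stay linearly independent over the polynomials in \<open>Q, B\<close> on the locus \<open>B\<^sub>0\<^sub>1 = 0\<close>:
  adding \<open>r e\<close> to \<open>v\<^sub>0\<close>, where \<open>e\<close> spans the radical of the polar form, changes \<open>Q\<^sub>0\<close> by
  \<open>r\<^sup>2\<close> and \<open>D\<close> by a multiple of \<open>r\<close>, and fixes everything else. The same independence without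
  the restriction to that locus shows that all relations are multiples of \<open>G\<close>.
\<close>

section \<open>Algebras of functions\<close>

text \<open>Characteristic 2 shapes the argument twice. The polar form is alternating, so a
  hyperbolic plane splits off only where some B is nonzero; the induction works on the open set B_01
  \<noteq> 0 and pays with a denominator. And since square roots are unique, D is a function of Q
  and B, yet not a polynomial in them: it is a purely inseparable quadratic element, which is why it
  is a generator and enters the relations through its square. Removing a plane and two vectors keeps
  their number equal to the dimension, so the induction stays within m = n and ends with one vector
  on a line. The restriction to the slice has three groups of variables: the pair \<open>V\<close>
  in the plane, the coefficients \<tau> and the vectors \<open>W\<close>. The induction hypothesis
  concerns functions of \<open>W\<close> alone. It reaches the joint function by a tensor argument:
  an element of A \<otimes> B all of whose slices lie in a subspace S of B lies in A \<otimes> S.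
  The same argument is then applied to \<open>V\<close>, while \<tau> can stay as it is because its
  entries are quotients of values of B.\<close>

inductive_set falg :: "('x \<Rightarrow> 'k::comm_ring_1) set \<Rightarrow> ('x \<Rightarrow> 'k) set" for G where
  const: "(\<lambda>_. c) \<in> falg G"
| gen: "g \<in> G \<Longrightarrow> g \<in> falg G"
| add: "f \<in> falg G \<Longrightarrow> g \<in> falg G \<Longrightarrow> (\<lambda>x. f x + g x) \<in> falg G"
| mult: "f \<in> falg G \<Longrightarrow> g \<in> falg G \<Longrightarrow> (\<lambda>x. f x * g x) \<in> falg G"

lemma falg_uminus: "f \<in> falg G \<Longrightarrow> (\<lambda>x. - f x) \<in> falg G"
  using falg.mult[OF falg.const[of "-1"], of f] by simp

lemma falg_diff: "f \<in> falg G \<Longrightarrow> g \<in> falg G \<Longrightarrow> (\<lambda>x. f x - g x) \<in> falg G"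
  using falg.add[OF _ falg_uminus, of f G g] by simp

lemma falg_power: "f \<in> falg G \<Longrightarrow> (\<lambda>x. f x ^ N) \<in> falg G"
  by (induction N) (auto intro: falg.const falg.mult)

lemma falg_sum: "(\<And>i. i \<in> I \<Longrightarrow> f i \<in> falg G) \<Longrightarrow> (\<lambda>x. \<Sum>i\<in>I. f i x) \<in> falg G"
  by (induction I rule: infinite_finite_induct) (auto intro: falg.const falg.add)

lemma falg_prod: "(\<And>i. i \<in> I \<Longrightarrow> f i \<in> falg G) \<Longrightarrow> (\<lambda>x. \<Prod>i\<in>I. f i x) \<in> falg G"
  by (induction I rule: infinite_finite_induct) (auto intro: falg.const falg.mult)

lemma falg_det:
  assumes "\<And>i j. i < n \<Longrightarrow> j < n \<Longrightarrow> (\<lambda>x. F x i j) \<in> falg G"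
  shows "(\<lambda>x. det (mat n n (\<lambda>(i, j). F x i j))) \<in> falg G"
proof -
  have "(\<lambda>x. det (mat n n (\<lambda>(i, j). F x i j))) =
      (\<lambda>x. \<Sum>p | p permutes {0..<n}. signof p * (\<Prod>i = 0..<n. F x i (p i)))"
  proof
    fix x
    show "det (mat n n (\<lambda>(i, j). F x i j)) =
      (\<Sum>p | p permutes {0..<n}. signof p * (\<Prod>i = 0..<n. F x i (p i)))"
      unfolding det_def
      by (auto intro!: sum.cong prod.cong simp: permutes_in_image)
  qed
  also have "\<dots> \<in> falg G"
    by (intro falg_sum falg.mult falg_prod falg.const assms)
      (auto dest: permutes_in_image)
  finally show ?thesis .
qed

lemma falg_pullback:
  assumes "f \<in> falg G" "\<And>g. g \<in> G \<Longrightarrow> (\<lambda>y. g (\<phi> y)) \<in> falg H"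
  shows "(\<lambda>y. f (\<phi> y)) \<in> falg H"
  using assms(1) by induction (auto intro: falg.intros assms(2))

lemma falg_mono: "G \<subseteq> H \<Longrightarrow> f \<in> falg G \<Longrightarrow> f \<in> falg H"
  using falg_pullback[of f G "\<lambda>x. x" H] falg.gen by blast

text \<open>The density arguments below run along a line or a single coordinate; this is what turns
  them into statements on univariate polynomials.\<close>

lemma falg_poly_curve:
  assumes "f \<in> falg G" "\<And>g. g \<in> G \<Longrightarrow> \<exists>p. \<forall>t. g (\<phi> t) = poly p t"
  shows "\<exists>p. \<forall>t. f (\<phi> t) = poly p t"
  using assms(1)
proof induction
  case (const c)
  show ?case by (rule exI[of _ "[:c:]"]) simp
next
  case (gen g)
  then show ?case by (rule assms(2))
next
  case (add f g)
  then obtain p r where "\<forall>t. f (\<phi> t) = poly p t" "\<forall>t. g (\<phi> t) = poly r t" by blast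
  then show ?case by (intro exI[of _ "p + r"]) simp
next
  case (mult f g)
  then obtain p r where "\<forall>t. f (\<phi> t) = poly p t" "\<forall>t. g (\<phi> t) = poly r t" by blast
  then show ?case by (intro exI[of _ "p * r"]) simp
qed

text \<open>The functions take assignments of all variables of the type, and \<open>V\<close> only
  restricts which ones may occur; by \<open>pfun_cong\<close> the values outside \<open>V\<close>
  can be changed freely.\<close>

definition pfun :: "'v set \<Rightarrow> (('v \<Rightarrow> 'k::comm_ring_1) \<Rightarrow> 'k) set" where
  "pfun V = falg ((\<lambda>v \<sigma>. \<sigma> v) ` V)"

lemma pfun_var: "v \<in> V \<Longrightarrow> (\<lambda>\<sigma>. \<sigma> v) \<in> pfun V"
  unfolding pfun_def by (rule falg.gen) auto

lemma pfun_mono: "V \<subseteq> W \<Longrightarrow> f \<in> pfun V \<Longrightarrow> f \<in> pfun W"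
  unfolding pfun_def by (rule falg_mono[OF image_mono])

lemma pfun_pullback:
  assumes "f \<in> pfun V" "\<And>v. v \<in> V \<Longrightarrow> (\<lambda>x. \<phi> x v) \<in> falg H"
  shows "(\<lambda>x. f (\<phi> x)) \<in> falg H"
  by (rule falg_pullback[OF assms(1)[unfolded pfun_def]]) (use assms(2) in auto)

lemma pfun_cong: "f \<in> pfun V \<Longrightarrow> (\<And>v. v \<in> V \<Longrightarrow> \<sigma> v = \<tau> v) \<Longrightarrow> f \<sigma> = f \<tau>"
  unfolding pfun_def by (induction rule: falg.induct) auto

text \<open>Passes from a function of x to a polynomial in the values of the generators.
  \<open>P\<close> is not unique when these satisfy relations, and it is this representative that
  gets reduced later.\<close>

lemma falg_factor:
  assumes "f \<in> falg ((\<lambda>v x. \<gamma> x v) ` V)"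
  shows "\<exists>P\<in>pfun V. f = (\<lambda>x. P (\<gamma> x))"
  using assms
proof induction
  case (const c)
  show ?case by (rule bexI[of _ "\<lambda>_. c"]) (auto simp: pfun_def intro: falg.const)
next
  case (gen g)
  then show ?case using pfun_var by fastforce
next
  case (add f g)
  then obtain P R where "P \<in> pfun V" "R \<in> pfun V" "f = (\<lambda>x. P (\<gamma> x))" "g = (\<lambda>x. R (\<gamma> x))" by blast
  then show ?case by (intro bexI[of _ "\<lambda>\<sigma>. P \<sigma> + R \<sigma>"]) (auto simp: pfun_def intro: falg.add)
next
  case (mult f g)
  then obtain P R where "P \<in> pfun V" "R \<in> pfun V" "f = (\<lambda>x. P (\<gamma> x))" "g = (\<lambda>x. R (\<gamma> x))" by blast
  then show ?case by (intro bexI[of _ "\<lambda>\<sigma>. P \<sigma> * R \<sigma>"]) (auto simp: pfun_def intro: falg.mult)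
qed

lemma pfun_line: "f \<in> pfun V \<Longrightarrow> \<exists>p. \<forall>t. f (\<lambda>v. x v + t * (y v - x v)) = poly p t"
  unfolding pfun_def
proof (erule falg_poly_curve)
  fix g :: "('a \<Rightarrow> 'b) \<Rightarrow> 'b" assume "g \<in> (\<lambda>v \<sigma>. \<sigma> v) ` V"
  then obtain v where "g = (\<lambda>\<sigma>. \<sigma> v)" by auto
  then show "\<exists>p. \<forall>t. g (\<lambda>v. x v + t * (y v - x v)) = poly p t"
    by (intro exI[of _ "[:x v, y v - x v:]"]) (simp add: algebra_simps)
qed

lemma pfun_one_var: "f \<in> pfun V \<Longrightarrow> \<exists>p. \<forall>t. f (\<sigma>(v := t)) = poly p t"
  unfolding pfun_def
proof (erule falg_poly_curve)
  fix g :: "('a \<Rightarrow> 'b) \<Rightarrow> 'b" assume "g \<in> (\<lambda>v \<sigma>. \<sigma> v) ` V"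
  then obtain w where "g = (\<lambda>\<sigma>. \<sigma> w)" by auto
  then show "\<exists>p. \<forall>t. g (\<sigma>(v := t)) = poly p t"
    by (intro exI[of _ "if w = v then [:0, 1:] else [:\<sigma> w:]"]) simp
qed

lemma pfun_subst_zero: "f \<in> pfun V \<Longrightarrow> (\<lambda>\<sigma>. f (\<sigma>(v := 0))) \<in> pfun (V - {v})"
  unfolding pfun_def[of "V - {v}"]
proof (erule pfun_pullback)
  fix w assume "w \<in> V"
  then show "(\<lambda>\<sigma>. (\<sigma>(v := 0)) w) \<in> falg ((\<lambda>v \<sigma>. \<sigma> v) ` (V - {v}))"
    by (cases "w = v") (auto intro: falg.const falg.gen)
qed

text \<open>Division by the variable \<open>v\<close> with remainder. For a product the quotient is
  f0 * g' + f' * g, where f0 is f at v = 0.\<close>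

lemma pfun_split_var:
  fixes f :: "('v \<Rightarrow> 'k::comm_ring_1) \<Rightarrow> 'k"
  assumes "f \<in> pfun V"
  shows "\<exists>f'\<in>pfun V. \<forall>\<sigma>. f \<sigma> = f (\<sigma>(v := 0)) + \<sigma> v * f' \<sigma>"
  using assms unfolding pfun_def
proof induction
  case (const c)
  show ?case by (rule bexI[of _ "\<lambda>_. 0"]) (auto intro: falg.const)
next
  case (gen g)
  then obtain w where w: "w \<in> V" "g = (\<lambda>\<sigma>. \<sigma> w)" by auto
  show ?case
    by (rule bexI[of _ "\<lambda>_. if w = v then 1 else 0"]) (auto simp: w intro: falg.const)
next
  case (add f g)
  then obtain f' g' where "f' \<in> pfun V" "g' \<in> pfun V"
    "\<forall>\<sigma>. f \<sigma> = f (\<sigma>(v := 0)) + \<sigma> v * f' \<sigma>" "\<forall>\<sigma>. g \<sigma> = g (\<sigma>(v := 0)) + \<sigma> v * g' \<sigma>"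
    unfolding pfun_def[symmetric] by blast
  note * = this
  have "f \<sigma> + g \<sigma> = f (\<sigma>(v := 0)) + g (\<sigma>(v := 0)) + \<sigma> v * (f' \<sigma> + g' \<sigma>)" for \<sigma>
    using *(3)[rule_format, of \<sigma>] *(4)[rule_format, of \<sigma>] by (simp add: distrib_left)
  moreover have "(\<lambda>\<sigma>. f' \<sigma> + g' \<sigma>) \<in> falg ((\<lambda>v \<sigma>. \<sigma> v) ` V)"
    using *(1,2) unfolding pfun_def by (rule falg.add)
  ultimately show ?case
    by (intro bexI[of _ "\<lambda>\<sigma>. f' \<sigma> + g' \<sigma>"] allI)
next
  case (mult f g)
  then obtain f' g' where *: "f' \<in> pfun V" "g' \<in> pfun V"
    and f: "\<And>\<sigma>. f \<sigma> = f (\<sigma>(v := 0)) + \<sigma> v * f' \<sigma>"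
    and g: "\<And>\<sigma>. g \<sigma> = g (\<sigma>(v := 0)) + \<sigma> v * g' \<sigma>"
    unfolding pfun_def[symmetric] by metis
  have "(\<lambda>\<sigma>. f (\<sigma>(v := 0))) \<in> pfun V"
    using pfun_mono[OF _ pfun_subst_zero, of V v V f] mult.hyps(1) by (auto simp: pfun_def)
  with * mult.hyps have "(\<lambda>\<sigma>. f (\<sigma>(v := 0)) * g' \<sigma> + f' \<sigma> * g \<sigma>) \<in> pfun V"
    unfolding pfun_def by (intro falg.add falg.mult) auto
  moreover have "f \<sigma> * g \<sigma> = f (\<sigma>(v := 0)) * g (\<sigma>(v := 0)) +
      \<sigma> v * (f (\<sigma>(v := 0)) * g' \<sigma> + f' \<sigma> * g \<sigma>)" for \<sigma>
  proof -
    have "f \<sigma> * g \<sigma> = f (\<sigma>(v := 0)) * g \<sigma> + \<sigma> v * (f' \<sigma> * g \<sigma>)"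
      by (subst f) (simp add: algebra_simps)
    also have "f (\<sigma>(v := 0)) * g \<sigma> =
      f (\<sigma>(v := 0)) * g (\<sigma>(v := 0)) + \<sigma> v * (f (\<sigma>(v := 0)) * g' \<sigma>)"
      by (subst g) (simp add: algebra_simps)
    finally show ?thesis by (simp add: algebra_simps)
  qed
  ultimately show ?case unfolding pfun_def
    by (intro bexI[of _ "\<lambda>\<sigma>. f (\<sigma>(v := 0)) * g' \<sigma> + f' \<sigma> * g \<sigma>"] allI)
qed

text \<open>Reduction modulo the monic quadratic d^2 - K d - H. It serves twice: for the
  determinant, with the half determinant as \<open>H\<close> and K = 0, and for the root u in the
  plane, with K = B_01 and H = - Q_0 Q_1.\<close>

lemma pfun_quadratic_normal_form:
  assumes "P \<in> pfun (insert d V)" "H \<in> pfun V" "K \<in> pfun V"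
  shows "\<exists>P0\<in>pfun V. \<exists>P1\<in>pfun V. \<forall>\<sigma>. (\<sigma> d)\<^sup>2 = H \<sigma> + K \<sigma> * \<sigma> d \<longrightarrow> P \<sigma> = P0 \<sigma> + P1 \<sigma> * \<sigma> d"
  using assms(1) unfolding pfun_def[of "insert d V"]
proof induction
  case (const c)
  show ?case
    by (rule bexI[of _ "\<lambda>_. c"], rule bexI[of _ "\<lambda>_. 0"]) (auto simp: pfun_def intro: falg.const)
next
  case (gen g)
  then consider "g = (\<lambda>\<sigma>. \<sigma> d)" | v where "v \<in> V" "g = (\<lambda>\<sigma>. \<sigma> v)" by auto
  then show ?case
  proof cases
    case 1
    then show ?thesis
      by (intro bexI[of _ "\<lambda>_. 0"] bexI[of _ "\<lambda>_. 1"]) (auto simp: pfun_def intro: falg.const)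
  next
    case 2
    then show ?thesis
      by (intro bexI[of _ "\<lambda>\<sigma>. \<sigma> v"] bexI[of _ "\<lambda>_. 0"]) (auto simp: pfun_def intro: falg.const falg.gen)
  qed
next
  case (add f g)
  then obtain f0 f1 g0 g1 where *: "f0 \<in> pfun V" "f1 \<in> pfun V" "g0 \<in> pfun V" "g1 \<in> pfun V"
    "\<forall>\<sigma>. (\<sigma> d)\<^sup>2 = H \<sigma> + K \<sigma> * \<sigma> d \<longrightarrow> f \<sigma> = f0 \<sigma> + f1 \<sigma> * \<sigma> d"
    "\<forall>\<sigma>. (\<sigma> d)\<^sup>2 = H \<sigma> + K \<sigma> * \<sigma> d \<longrightarrow> g \<sigma> = g0 \<sigma> + g1 \<sigma> * \<sigma> d" by blast
  then show ?case
    by (intro bexI[of _ "\<lambda>\<sigma>. f0 \<sigma> + g0 \<sigma>"] bexI[of _ "\<lambda>\<sigma>. f1 \<sigma> + g1 \<sigma>"])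
      (auto simp: pfun_def algebra_simps intro: falg.add)
next
  case (mult f g)
  then obtain f0 f1 g0 g1 where *: "f0 \<in> pfun V" "f1 \<in> pfun V" "g0 \<in> pfun V" "g1 \<in> pfun V"
    "\<forall>\<sigma>. (\<sigma> d)\<^sup>2 = H \<sigma> + K \<sigma> * \<sigma> d \<longrightarrow> f \<sigma> = f0 \<sigma> + f1 \<sigma> * \<sigma> d"
    "\<forall>\<sigma>. (\<sigma> d)\<^sup>2 = H \<sigma> + K \<sigma> * \<sigma> d \<longrightarrow> g \<sigma> = g0 \<sigma> + g1 \<sigma> * \<sigma> d" by blast
  have "f \<sigma> * g \<sigma> = (f0 \<sigma> * g0 \<sigma> + f1 \<sigma> * g1 \<sigma> * H \<sigma>) +
      (f0 \<sigma> * g1 \<sigma> + f1 \<sigma> * g0 \<sigma> + f1 \<sigma> * g1 \<sigma> * K \<sigma>) * \<sigma> d"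
    if "(\<sigma> d)\<^sup>2 = H \<sigma> + K \<sigma> * \<sigma> d" for \<sigma>
  proof -
    have "f \<sigma> * g \<sigma> = (f0 \<sigma> + f1 \<sigma> * \<sigma> d) * (g0 \<sigma> + g1 \<sigma> * \<sigma> d)" using *(5,6) that by simp
    also have "\<dots> = f0 \<sigma> * g0 \<sigma> + f1 \<sigma> * g1 \<sigma> * (\<sigma> d)\<^sup>2 + (f0 \<sigma> * g1 \<sigma> + f1 \<sigma> * g0 \<sigma>) * \<sigma> d"
      by (simp add: algebra_simps power2_eq_square)
    finally show ?thesis unfolding that by (simp add: algebra_simps)
  qed
  moreover have "(\<lambda>\<sigma>. f0 \<sigma> * g0 \<sigma> + f1 \<sigma> * g1 \<sigma> * H \<sigma>) \<in> pfun V"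
    using *(1-4) assms(2) unfolding pfun_def by (intro falg.add falg.mult)
  moreover have "(\<lambda>\<sigma>. f0 \<sigma> * g1 \<sigma> + f1 \<sigma> * g0 \<sigma> + f1 \<sigma> * g1 \<sigma> * K \<sigma>) \<in> pfun V"
    using *(1-4) assms(3) unfolding pfun_def by (intro falg.add falg.mult)
  ultimately show ?case
    by (intro bexI[of _ "\<lambda>\<sigma>. f0 \<sigma> * g0 \<sigma> + f1 \<sigma> * g1 \<sigma> * H \<sigma>"]
        bexI[of _ "\<lambda>\<sigma>. f0 \<sigma> * g1 \<sigma> + f1 \<sigma> * g0 \<sigma> + f1 \<sigma> * g1 \<sigma> * K \<sigma>"] allI impI)
qed

text \<open>\<open>R x y\<close> is to be read as: the generators at \<open>x\<close> are rational
  in those at \<open>y\<close>, with powers of \<open>e\<close> as denominators. It is a relation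
  because one tuple \<open>y\<close> may have many parameters \<open>x\<close>.\<close>

lemma falg_clear_denominators:
  assumes "f \<in> falg G" and e: "e \<in> falg H"
    and G: "\<And>g. g \<in> G \<Longrightarrow> \<exists>N. \<exists>g'\<in>falg H. \<forall>x y. R x y \<longrightarrow> e y ^ N * g x = g' y"
  shows "\<exists>N. \<exists>f'\<in>falg H. \<forall>x y. R x y \<longrightarrow> e y ^ N * f x = f' y"
  using assms(1)
proof induction
  case (const c)
  show ?case by (rule exI[of _ 0], rule bexI[of _ "\<lambda>_. c"]) (auto intro: falg.const)
next
  case (gen g)
  then show ?case by (rule G)
next
  case (add f g)
  then obtain N f' N' g' where *: "f' \<in> falg H" "g' \<in> falg H"
    "\<forall>x y. R x y \<longrightarrow> e y ^ N * f x = f' y" "\<forall>x y. R x y \<longrightarrow> e y ^ N' * g x = g' y" by blast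
  have "e y ^ (N + N') * (f x + g x) = e y ^ N' * f' y + e y ^ N * g' y" if "R x y" for x y
    by (simp add: power_add algebra_simps flip: *(3)[rule_format, OF that] *(4)[rule_format, OF that])
  moreover have "(\<lambda>y. e y ^ N' * f' y + e y ^ N * g' y) \<in> falg H"
    using *(1,2) e by (intro falg.add falg.mult falg_power)
  ultimately show ?case
    by (intro exI[of _ "N + N'"] bexI[of _ "\<lambda>y. e y ^ N' * f' y + e y ^ N * g' y"] allI impI)
next
  case (mult f g)
  then obtain N f' N' g' where *: "f' \<in> falg H" "g' \<in> falg H"
    "\<forall>x y. R x y \<longrightarrow> e y ^ N * f x = f' y" "\<forall>x y. R x y \<longrightarrow> e y ^ N' * g x = g' y" by blast
  have "e y ^ (N + N') * (f x * g x) = f' y * g' y" if "R x y" for x y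
    by (simp add: power_add algebra_simps flip: *(3)[rule_format, OF that] *(4)[rule_format, OF that])
  moreover have "(\<lambda>y. f' y * g' y) \<in> falg H"
    using *(1,2) by (rule falg.mult)
  ultimately show ?case
    by (intro exI[of _ "N + N'"] bexI[of _ "\<lambda>y. f' y * g' y"] allI impI)
qed

section \<open>Density arguments over an infinite field\<close>

lemma poly_zero_infinite:
  fixes p :: "'k::field poly"
  assumes "infinite (UNIV :: 'k set)" "\<And>t. poly p t = 0"
  shows "p = 0"
proof (rule ccontr)
  assume "p \<noteq> 0"
  then have "finite {t. poly p t = 0}" by (rule poly_roots_finite)
  with assms show False by simp
qed

text \<open>On the line from \<open>x\<close> to a point \<open>y\<close> with g y \<noteq> 0 both
  functions are univariate polynomials; \<open>g\<close> restricts to a nonzero one, so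
  \<open>f\<close> restricts to zero. This is the means of extending an identity from the locus
  where \<open>g\<close> does not vanish to all points.\<close>

lemma pfun_no_zero_divisors:
  fixes f g :: "('v \<Rightarrow> 'k::field) \<Rightarrow> 'k"
  assumes inf: "infinite (UNIV :: 'k set)" and f: "f \<in> pfun V" and g: "g \<in> pfun V"
    and 0: "\<And>\<sigma>. g \<sigma> * f \<sigma> = 0" and y: "g y \<noteq> 0"
  shows "f x = 0"
proof -
  obtain p where p: "\<And>t. f (\<lambda>v. x v + t * (y v - x v)) = poly p t" using pfun_line[OF f] by blast
  obtain r where r: "\<And>t. g (\<lambda>v. x v + t * (y v - x v)) = poly r t" using pfun_line[OF g] by blast
  have "r * p = 0"
    by (rule poly_zero_infinite[OF inf]) (simp add: 0 flip: p r)
  moreover have "r \<noteq> 0" using r[of 1] y by auto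
  ultimately have "p = 0" by simp
  then show ?thesis using p[of 0] by simp
qed

text \<open>Over a finite field, 1 plus the product of all X - a would have positive degree and take
  only the value 1.\<close>

lemma infinite_alg_closed: "infinite (UNIV :: 'k::alg_closed_field set)"
proof
  assume fin: "finite (UNIV :: 'k set)"
  let ?p = "(\<Prod>a\<in>(UNIV :: 'k set). [:- a, 1:]) + 1"
  have "poly ?p x = 1" for x
    using fin by (simp add: poly_prod)
  moreover have "degree (\<Prod>a\<in>(UNIV :: 'k set). [:- a, 1:]) = card (UNIV :: 'k set)"
    by (subst degree_prod_eq_sum_degree) auto
  then have "degree ?p > 0" using fin by (subst degree_add_eq_left) (auto simp: card_gt_0_iff)
  ultimately show False using alg_closed_imp_poly_has_root[of ?p] by auto
qed

section \<open>Functions on a product and their slices\<close>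

definition tsum :: "(('x \<Rightarrow> 'k::comm_ring_1) \<times> ('y \<Rightarrow> 'k)) list \<Rightarrow> 'x \<Rightarrow> 'y \<Rightarrow> 'k" where
  "tsum L x y = (\<Sum>(a, b)\<leftarrow>L. a x * b y)"

lemma tsum_simps [simp]:
  "tsum [] x y = 0" "tsum (ab # L) x y = fst ab x * snd ab y + tsum L x y"
  "tsum (L @ L') x y = tsum L x y + tsum L' x y"
  by (auto simp: tsum_def split: prod.split)

lemma tsum_mult:
  "tsum L x y * tsum L' x y =
    tsum (concat (map (\<lambda>(a, b). map (\<lambda>(a', b'). (\<lambda>x. a x * a' x, \<lambda>y. b y * b' y)) L') L)) x y"
proof (induction L)
  case (Cons ab L)
  have "tsum (map (\<lambda>(a', b'). (\<lambda>x. a x * a' x, \<lambda>y. b y * b' y)) L') x y = a x * b y * tsum L' x y"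
    for a b by (induction L') (auto simp: algebra_simps)
  with Cons show ?case by (auto simp: algebra_simps split: prod.split)
qed simp

text \<open>\<xi> and \<eta> play the two projections of a product. Each generator factors through
  one of them, so every product of generators can be sorted into two factors.\<close>

lemma falg_tsum:
  assumes "f \<in> falg K"
    and "\<And>g. g \<in> K \<Longrightarrow> (\<exists>a\<in>G. \<forall>p. g p = a (\<xi> p)) \<or> (\<exists>b\<in>H. \<forall>p. g p = b (\<eta> p))"
  shows "\<exists>L. (\<forall>p. f p = tsum L (\<xi> p) (\<eta> p)) \<and> set L \<subseteq> falg G \<times> falg H"
  using assms(1)
proof induction
  case (const c)
  show ?case by (rule exI[of _ "[(\<lambda>_. c, \<lambda>_. 1)]"]) (auto intro: falg.const)
next
  case (gen g)
  from assms(2)[OF this] show ?case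
  proof
    assume "\<exists>a\<in>G. \<forall>p. g p = a (\<xi> p)"
    then obtain a where "a \<in> G" "\<forall>p. g p = a (\<xi> p)" by blast
    then show ?case by (intro exI[of _ "[(a, \<lambda>_. 1)]"]) (auto intro: falg.const falg.gen)
  next
    assume "\<exists>b\<in>H. \<forall>p. g p = b (\<eta> p)"
    then obtain b where "b \<in> H" "\<forall>p. g p = b (\<eta> p)" by blast
    then show ?case by (intro exI[of _ "[(\<lambda>_. 1, b)]"]) (auto intro: falg.const falg.gen)
  qed
next
  case (add f g)
  then obtain L L' where "\<forall>p. f p = tsum L (\<xi> p) (\<eta> p)" "set L \<subseteq> falg G \<times> falg H"
    "\<forall>p. g p = tsum L' (\<xi> p) (\<eta> p)" "set L' \<subseteq> falg G \<times> falg H" by blast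
  then show ?case by (intro exI[of _ "L @ L'"]) auto
next
  case (mult f g)
  then obtain L L' where "\<forall>p. f p = tsum L (\<xi> p) (\<eta> p)" "set L \<subseteq> falg G \<times> falg H"
    "\<forall>p. g p = tsum L' (\<xi> p) (\<eta> p)" "set L' \<subseteq> falg G \<times> falg H" by blast
  note * = this
  show ?case
  proof (intro exI conjI allI)
    show "f p * g p = tsum (concat (map (\<lambda>(a, b). map (\<lambda>(a', b').
        (\<lambda>x. a x * a' x, \<lambda>y. b y * b' y)) L') L)) (\<xi> p) (\<eta> p)" for p
      using * by (simp flip: tsum_mult)
  qed (use * in \<open>fastforce intro!: falg.mult\<close>)
qed

text \<open>The function-space form of the fact that a tensor in \<open>A \<otimes> B\<close> all of whose slices lie in a
  subspace \<open>S\<close> lies in \<open>A \<otimes> S\<close>.\<close>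

lemma tsum_slices:
  fixes L :: "(('x \<Rightarrow> 'k::field) \<times> ('y \<Rightarrow> 'k)) list"
  assumes "fst ` set L \<subseteq> falg G"
    and add: "\<And>s s'. s \<in> S \<Longrightarrow> s' \<in> S \<Longrightarrow> (\<lambda>y. s y + s' y) \<in> S"
    and scale: "\<And>c s. s \<in> S \<Longrightarrow> (\<lambda>y. c * s y) \<in> S"
    and "\<And>x. tsum L x \<in> S"
  shows "\<exists>L'. (\<forall>x y. tsum L' x y = tsum L x y) \<and> set L' \<subseteq> falg G \<times> S"
  using assms(1,4)
proof (induction "length L" arbitrary: L)
  case 0
  then show ?case by (intro exI[of _ "[]"]) auto
next
  case (Suc N)
  then obtain a b L1 where L: "L = (a, b) # L1" by (cases L) auto
  show ?case
  proof (cases "\<forall>x. a x = 0")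
    case True
    then have "tsum L x = tsum L1 x" for x by (auto simp: L)
    then show ?thesis using Suc.hyps(1)[of L1] Suc.hyps(2) Suc.prems by (auto simp: L)
  next
    case False
    then obtain x0 where x0: "a x0 \<noteq> 0" by blast
    \<comment> \<open>Gaussian elimination at \<open>x0\<close>: subtracting a(x) / a(x0) times the
      slice at \<open>x0\<close> cancels the first summand. What remains is shorter and has its
      slices in \<open>S\<close>, and the subtracted part is a single product with second factor in
      \<open>S\<close>.\<close>
    define L2 where "L2 = map (\<lambda>(a1, b1). (\<lambda>x. a1 x - a x * (a1 x0 / a x0), b1)) L1"
    have t2: "tsum L2 x y = tsum L1 x y - (a x / a x0) * tsum L1 x0 y" for x y
      unfolding L2_def using x0
      by (induction L1) (auto simp: divide_simps left_diff_distrib right_diff_distrib distrib_left mult_ac)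
    have t2': "tsum L2 x y = tsum L x y + (- (a x / a x0)) * tsum L x0 y" for x y
      unfolding t2 by (simp add: L x0 field_simps)
    have "tsum L2 x \<in> S" for x
      using add[OF Suc.prems(2)[of x] scale[OF Suc.prems(2)[of x0], of "- (a x / a x0)"]]
      by (simp add: t2'[abs_def])
    moreover have "fst ` set L2 \<subseteq> falg G"
    proof -
      have "a \<in> falg G" and 1: "\<And>a1 b1. (a1, b1) \<in> set L1 \<Longrightarrow> a1 \<in> falg G"
        using Suc.prems(1) by (force simp: L)+
      then have "(\<lambda>x. a1 x - a x * (a1 x0 / a x0)) \<in> falg G" if "(a1, b1) \<in> set L1" for a1 b1
        using that by (intro falg_diff falg.mult falg.const)
      then show ?thesis by (auto simp: L2_def)
    qed
    moreover have "N = length L2" using Suc.hyps(2) by (simp add: L2_def L)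
    ultimately obtain L' where L': "\<forall>x y. tsum L' x y = tsum L2 x y" "set L' \<subseteq> falg G \<times> S"
      using Suc.hyps(1)[of L2] by blast
    have "(\<lambda>x. a x * (1 / a x0)) \<in> falg G"
      using Suc.prems(1) by (intro falg.mult falg.const) (auto simp: L)
    then show ?thesis using L' Suc.prems(2)[of x0]
      by (intro exI[of _ "((\<lambda>x. a x * (1 / a x0)), tsum L x0) # L'"]) (auto simp: t2')
  qed
qed

text \<open>Transports a statement on functions of the second variable alone (those of
  \<open>falg H\<close> that lie in \<open>S\<close> are in \<open>falg H'\<close>) to functions of
  both variables; \<open>\<pi>\<close> supplies a point with prescribed projections.\<close>

lemma falg_slices:
  fixes f :: "'p \<Rightarrow> 'k::field"
  assumes f: "f \<in> falg K"
    and K: "\<And>g. g \<in> K \<Longrightarrow> (\<exists>a\<in>G. \<forall>p. g p = a (\<xi> p)) \<or> (\<exists>b\<in>H. \<forall>p. g p = b (\<eta> p))"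
    and surj: "\<And>x y. \<xi> (\<pi> x y) = x \<and> \<eta> (\<pi> x y) = y"
    and add: "\<And>s s'. s \<in> S \<Longrightarrow> s' \<in> S \<Longrightarrow> (\<lambda>y. s y + s' y) \<in> S"
    and scale: "\<And>c s. s \<in> S \<Longrightarrow> (\<lambda>y. c * s y) \<in> S"
    and slice: "\<And>x. (\<lambda>y. f (\<pi> x y)) \<in> S"
    and S: "\<And>s. s \<in> falg H \<Longrightarrow> s \<in> S \<Longrightarrow> s \<in> falg H'"
  shows "f \<in> falg ((\<lambda>a p. a (\<xi> p)) ` G \<union> (\<lambda>b p. b (\<eta> p)) ` H')"
    (is "_ \<in> falg ?K'")
proof -
  obtain L where L: "\<And>p. f p = tsum L (\<xi> p) (\<eta> p)" "set L \<subseteq> falg G \<times> falg H"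
    using falg_tsum[OF f K] by blast
  have eq: "tsum L x = (\<lambda>y. f (\<pi> x y))" for x using L(1) surj by auto
  have H: "tsum L x \<in> falg H" for x
    using L(2) by (induction L) (auto simp: tsum_simps[abs_def] intro!: falg.add falg.mult falg.const)
  obtain L' where L': "\<forall>x y. tsum L' x y = tsum L x y" "set L' \<subseteq> falg G \<times> (S \<inter> falg H)"
  proof (atomize_elim, rule tsum_slices)
    show "fst ` set L \<subseteq> falg G" using L(2) by auto
    show "tsum L x \<in> S \<inter> falg H" for x using slice H by (simp add: eq)
  qed (auto intro: add scale falg.add falg.mult falg.const)
  have "(\<lambda>p. tsum L' (\<xi> p) (\<eta> p)) \<in> falg ?K'"
    using L'(2)
  proof (induction L')
    case (Cons ab L')
    obtain a b where ab: "ab = (a, b)" by force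
    have "(\<lambda>p. a (\<xi> p)) \<in> falg ?K'"
      by (rule falg_pullback[of a G]) (use Cons.prems in \<open>auto simp: ab intro: falg.gen\<close>)
    moreover have "(\<lambda>p. b (\<eta> p)) \<in> falg ?K'"
      by (rule falg_pullback[of b H']) (use Cons.prems S in \<open>auto simp: ab intro: falg.gen\<close>)
    ultimately show ?case using Cons by (auto simp: ab intro!: falg.add falg.mult)
  qed (auto intro: falg.const)
  also have "(\<lambda>p. tsum L' (\<xi> p) (\<eta> p)) = f" using L(1) L'(1) by auto
  finally show ?thesis .
qed

section \<open>Evaluation of polynomials\<close>

definition eval_monom :: "('v \<Rightarrow> 'b::comm_monoid_mult) \<Rightarrow> ('v \<Rightarrow>\<^sub>0 nat) \<Rightarrow> 'b" where
  "eval_monom \<phi> m = (\<Prod>x\<in>Poly_Mapping.keys m. \<phi> x ^ Poly_Mapping.lookup m x)"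

text \<open>The map \<open>h\<close> on coefficients is a parameter so that one notion covers
  substitution (\<open>mconst\<close>), evaluation at a point (the identity) and evaluation of
  integer polynomials in another ring (\<open>of_int\<close>).\<close>

definition eval_mpoly :: "('a \<Rightarrow> 'b) \<Rightarrow> ('v \<Rightarrow> 'b) \<Rightarrow> ('v, 'a::zero) mpoly \<Rightarrow> 'b::comm_ring_1" where
  "eval_mpoly h \<phi> p =
     (\<Sum>m\<in>Poly_Mapping.keys p. h (Poly_Mapping.lookup p m) * eval_monom \<phi> m)"

abbreviation peval :: "('v \<Rightarrow> 'a) \<Rightarrow> ('v, 'a) mpoly \<Rightarrow> 'a::comm_ring_1" where
  "peval \<equiv> eval_mpoly (\<lambda>c. c)"

lemma msubst_eq_eval: "msubst \<phi> = eval_mpoly mconst \<phi>"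
  by (simp add: msubst_def eval_mpoly_def eval_monom_def fun_eq_iff)

lemma eval_monom_superset:
  "finite S \<Longrightarrow> Poly_Mapping.keys m \<subseteq> S \<Longrightarrow>
    eval_monom \<phi> m = (\<Prod>x\<in>S. \<phi> x ^ Poly_Mapping.lookup m x)"
  unfolding eval_monom_def by (rule prod.mono_neutral_left) (auto simp: in_keys_iff)

lemma eval_monom_add: "eval_monom \<phi> (m + m') = eval_monom \<phi> m * eval_monom \<phi> m'"
proof -
  let ?S = "Poly_Mapping.keys m \<union> Poly_Mapping.keys m'"
  have "Poly_Mapping.keys (m + m') \<subseteq> ?S" by (rule keys_add)
  then show ?thesis
    by (simp add: eval_monom_superset[of ?S] lookup_add power_add prod.distrib)
qed

lemma eval_mpoly_superset:
  assumes "h 0 = 0" "finite S" "Poly_Mapping.keys p \<subseteq> S"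
  shows "eval_mpoly h \<phi> p = (\<Sum>m\<in>S. h (Poly_Mapping.lookup p m) * eval_monom \<phi> m)"
  unfolding eval_mpoly_def
  by (rule sum.mono_neutral_left) (use assms in \<open>auto simp: in_keys_iff\<close>)

lemma mpoly_sum_single:
  fixes p :: "('v, 'a::comm_monoid_add) mpoly"
  shows "p = (\<Sum>m\<in>Poly_Mapping.keys p. Poly_Mapping.single m (Poly_Mapping.lookup p m))"
proof (rule poly_mapping_eqI)
  fix m
  show "Poly_Mapping.lookup p m = Poly_Mapping.lookup
      (\<Sum>m\<in>Poly_Mapping.keys p. Poly_Mapping.single m (Poly_Mapping.lookup p m)) m"
    by (cases "m \<in> Poly_Mapping.keys p")
      (auto simp: lookup_sum lookup_single when_def in_keys_iff)
qed

context
  fixes h :: "'a::comm_ring_1 \<Rightarrow> 'b::comm_ring_1"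
  assumes h: "comm_ring_hom h"
begin

interpretation comm_ring_hom h by (rule h)

lemma eval_mpoly_single: "eval_mpoly h \<phi> (Poly_Mapping.single m c) = h c * eval_monom \<phi> m"
  by (subst eval_mpoly_superset[of h "{m}"]) (auto split: if_splits)

lemma eval_mpoly_add: "eval_mpoly h \<phi> (p + q) = eval_mpoly h \<phi> p + eval_mpoly h \<phi> q"
proof -
  let ?S = "Poly_Mapping.keys p \<union> Poly_Mapping.keys q"
  have "Poly_Mapping.keys (p + q) \<subseteq> ?S" by (rule keys_add)
  then show ?thesis
    by (simp add: eval_mpoly_superset[of h ?S] lookup_add hom_add distrib_right sum.distrib)
qed

lemma eval_mpoly_zero: "eval_mpoly h \<phi> 0 = 0"
  by (simp add: eval_mpoly_def)

lemma eval_mpoly_sum: "eval_mpoly h \<phi> (\<Sum>i\<in>I. f i) = (\<Sum>i\<in>I. eval_mpoly h \<phi> (f i))"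
  by (induction I rule: infinite_finite_induct) (auto simp: eval_mpoly_zero eval_mpoly_add)

lemma eval_mpoly_mult: "eval_mpoly h \<phi> (p * q) = eval_mpoly h \<phi> p * eval_mpoly h \<phi> q"
proof -
  let ?l = Poly_Mapping.lookup and ?k = Poly_Mapping.keys
  have "p * q = (\<Sum>m\<in>?k p. Poly_Mapping.single m (?l p m)) *
      (\<Sum>m\<in>?k q. Poly_Mapping.single m (?l q m))"
    by (simp flip: mpoly_sum_single)
  also have "\<dots> = (\<Sum>m\<in>?k p. \<Sum>m'\<in>?k q. Poly_Mapping.single (m + m') (?l p m * ?l q m'))"
    by (simp add: sum_product mult_single)
  also have "eval_mpoly h \<phi> \<dots> = eval_mpoly h \<phi> p * eval_mpoly h \<phi> q"
    by (simp add: eval_mpoly_sum eval_mpoly_single eval_monom_add hom_mult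
        eval_mpoly_def[of h \<phi> p] eval_mpoly_def[of h \<phi> q] sum_product mult_ac)
  finally show ?thesis .
qed

lemma eval_mpoly_const: "eval_mpoly h \<phi> (mconst c) = h c"
  by (simp add: mconst_def eval_mpoly_single eval_monom_def)

lemma eval_mpoly_var: "eval_mpoly h \<phi> (mvar x) = \<phi> x"
  by (simp add: mvar_def eval_mpoly_single eval_monom_def)

lemma comm_ring_hom_eval_mpoly: "comm_ring_hom (eval_mpoly h \<phi>)"
proof unfold_locales
  have "eval_mpoly h \<phi> (Poly_Mapping.single 0 1) = 1"
    unfolding eval_mpoly_single by (simp add: eval_monom_def)
  then show "eval_mpoly h \<phi> 1 = 1" by simp
qed (simp_all add: eval_mpoly_add eval_mpoly_mult eval_mpoly_zero)

end

lemma comm_ring_hom_id: "comm_ring_hom (\<lambda>c. c)"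
  by unfold_locales auto

lemmas comm_ring_hom_peval = comm_ring_hom_eval_mpoly[OF comm_ring_hom_id]

lemmas peval_simps = eval_mpoly_const[OF comm_ring_hom_id] eval_mpoly_var[OF comm_ring_hom_id]
  eval_mpoly_add[OF comm_ring_hom_id] eval_mpoly_mult[OF comm_ring_hom_id]
  eval_mpoly_zero[OF comm_ring_hom_id]

lemma hom_eval_mpoly:
  assumes "comm_ring_hom H"
  shows "H (eval_mpoly h \<phi> p) = eval_mpoly (\<lambda>c. H (h c)) (\<lambda>x. H (\<phi> x)) p"
proof -
  interpret comm_ring_hom H by fact
  show ?thesis by (simp add: eval_mpoly_def eval_monom_def hom_sum hom_mult hom_prod hom_power)
qed

lemma peval_msubst: "peval \<sigma> (msubst \<phi> p) = peval (\<lambda>x. peval \<sigma> (\<phi> x)) p"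
  unfolding msubst_eq_eval by (simp add: hom_eval_mpoly[OF comm_ring_hom_peval]
      eval_mpoly_const[OF comm_ring_hom_id])

lemma peval_cong:
  assumes "p \<in> polys_in V" "\<And>v. v \<in> V \<Longrightarrow> \<sigma> v = \<tau> v"
  shows "peval \<sigma> p = peval \<tau> p"
  using assms unfolding eval_mpoly_def eval_monom_def polys_in_def
  by (intro sum.cong prod.cong arg_cong2[of _ _ _ _ "(*)"] arg_cong2[of _ _ _ _ "(^)"] refl) blast

text \<open>The variables are eliminated one at a time.\<close>

lemma monomials_independent:
  fixes c :: "('v \<Rightarrow> nat) \<Rightarrow> 'k::field"
  assumes inf: "infinite (UNIV :: 'k set)" and "finite V" "finite K"
    and "\<And>e e'. e \<in> K \<Longrightarrow> e' \<in> K \<Longrightarrow> (\<And>x. x \<in> V \<Longrightarrow> e x = e' x) \<Longrightarrow> e = e'"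
    and "\<And>\<sigma>. (\<Sum>e\<in>K. c e * (\<Prod>x\<in>V. \<sigma> x ^ e x)) = 0" and "e \<in> K"
  shows "c e = 0"
  using assms(2-)
proof (induction V arbitrary: K e rule: finite_induct)
  case empty
  then have "K = {e}" by blast
  then show ?case using empty.prems(3) by simp
next
  case (insert y V)
  define Kj where "Kj j = {e \<in> K. e y = j}" for j
  have fin: "finite (Kj j)" for j using insert.prems(1) by (simp add: Kj_def)
  have zero: "(\<Sum>e\<in>Kj j. c e * (\<Prod>x\<in>V. \<sigma> x ^ e x)) = 0" for j \<sigma>
  proof -
    \<comment> \<open>The sum as a polynomial in the value of \<open>y\<close>; its coefficient of
      degree j is the part of the sum over \<open>Kj j\<close>.\<close>
    define p where "p = (\<Sum>e\<in>K. monom (c e * (\<Prod>x\<in>V. \<sigma> x ^ e x)) (e y))"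
    have "poly p t = 0" for t
    proof -
      have "(\<Prod>x\<in>insert y V. (\<sigma>(y := t)) x ^ e x) = t ^ e y * (\<Prod>x\<in>V. \<sigma> x ^ e x)" for e
      proof -
        have "(\<Prod>x\<in>V. (\<sigma>(y := t)) x ^ e x) = (\<Prod>x\<in>V. \<sigma> x ^ e x)"
          by (rule prod.cong) (use insert.hyps in auto)
        then show ?thesis using insert.hyps by simp
      qed
      then show ?thesis
        using insert.prems(3)[of "\<sigma>(y := t)"] by (simp add: p_def poly_sum poly_monom mult_ac)
    qed
    then have "p = 0" by (rule poly_zero_infinite[OF inf])
    then have "0 = coeff p j" by simp
    also have "\<dots> = (\<Sum>e\<in>K. if e y = j then c e * (\<Prod>x\<in>V. \<sigma> x ^ e x) else 0)"
      by (simp add: p_def coeff_sum)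
    also have "\<dots> = (\<Sum>e\<in>Kj j. c e * (\<Prod>x\<in>V. \<sigma> x ^ e x))"
      using insert.prems(1) by (simp add: Kj_def sum.If_cases Int_def)
    finally show ?thesis by simp
  qed
  have "e1 = e2" if "e1 \<in> Kj (e y)" "e2 \<in> Kj (e y)" "\<And>x. x \<in> V \<Longrightarrow> e1 x = e2 x" for e1 e2
    using that by (intro insert.prems(2)) (auto simp: Kj_def)
  moreover have "e \<in> Kj (e y)" using insert.prems(4) by (simp add: Kj_def)
  ultimately show ?case using insert.IH[of "Kj (e y)" e] fin zero by blast
qed

lemma peval_zero_imp_zero:
  fixes p :: "('v, 'k::field) mpoly"
  assumes inf: "infinite (UNIV :: 'k set)" and 0: "\<And>\<sigma>. peval \<sigma> p = 0"
  shows "p = 0"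
proof -
  define V where "V = (\<Union>m\<in>Poly_Mapping.keys p. Poly_Mapping.keys m)"
  define K where "K = Poly_Mapping.lookup ` Poly_Mapping.keys p"
  \<comment> \<open>The members of \<open>K\<close> are lookups of monomials, and there
    \<open>Abs_poly_mapping\<close> recovers the monomial.\<close>
  define c where "c = (\<lambda>e. Poly_Mapping.lookup p (Abs_poly_mapping e))"
  have c: "c (Poly_Mapping.lookup m) = Poly_Mapping.lookup p m" for m
    unfolding c_def by (simp only: Poly_Mapping.lookup_inverse)
  have "(\<Sum>e\<in>K. c e * (\<Prod>x\<in>V. \<sigma> x ^ e x)) = 0" for \<sigma>
  proof -
    have "(\<Sum>e\<in>K. c e * (\<Prod>x\<in>V. \<sigma> x ^ e x)) = (\<Sum>m\<in>Poly_Mapping.keys p.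
        Poly_Mapping.lookup p m * (\<Prod>x\<in>V. \<sigma> x ^ Poly_Mapping.lookup m x))"
      unfolding K_def
    proof (subst sum.reindex)
      show "inj_on Poly_Mapping.lookup (Poly_Mapping.keys p)"
        by (rule inj_onI) (simp only: poly_mapping_eq_iff)
    qed (simp only: comp_def c)
    also have "\<dots> = peval \<sigma> p"
      unfolding eval_mpoly_def
      by (intro sum.cong refl arg_cong2[of _ _ _ _ "(*)"] eval_monom_superset[symmetric])
        (auto simp: V_def)
    finally show ?thesis by (simp add: 0)
  qed
  moreover have "e = e'" if K: "e \<in> K" "e' \<in> K" and eq: "\<And>x. x \<in> V \<Longrightarrow> e x = e' x" for e e'
  proof
    obtain m m' where *: "e = Poly_Mapping.lookup m" "e' = Poly_Mapping.lookup m'"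
      "m \<in> Poly_Mapping.keys p" "m' \<in> Poly_Mapping.keys p" using K by (auto simp: K_def)
    fix x show "e x = e' x"
      using * eq[of x] by (cases "x \<in> V") (auto simp: in_keys_iff V_def)
  qed
  moreover have "finite V" "finite K" by (simp_all add: V_def K_def)
  ultimately have ce: "c e = 0" if "e \<in> K" for e
    using monomials_independent[OF inf, of V K c e] that by blast
  show ?thesis
  proof (rule poly_mapping_eqI)
    fix m
    have "Poly_Mapping.lookup p m = 0" if "m \<in> Poly_Mapping.keys p"
      using ce[of "Poly_Mapping.lookup m"] that by (simp add: c K_def)
    then show "Poly_Mapping.lookup p m = Poly_Mapping.lookup 0 m" by (auto simp: in_keys_iff)
  qed
qed

lemma peval_inject:
  fixes p q :: "('v, 'k::field) mpoly"
  assumes "infinite (UNIV :: 'k set)" "\<And>\<sigma>. peval \<sigma> p = peval \<sigma> q"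
  shows "p = q"
proof -
  interpret comm_ring_hom "peval \<sigma>" for \<sigma> :: "'v \<Rightarrow> 'k" by (rule comm_ring_hom_peval)
  show ?thesis using peval_zero_imp_zero[of "p - q"] assms by (simp add: hom_minus)
qed

section \<open>Polynomial rings in prescribed variables\<close>

lemma polys_in_const: "mconst c \<in> polys_in V"
  by (auto simp: polys_in_def mconst_def split: if_splits)

lemma polys_in_var: "x \<in> V \<Longrightarrow> mvar x \<in> polys_in V"
  by (auto simp: polys_in_def mvar_def)

lemma polys_in_add: "p \<in> polys_in V \<Longrightarrow> q \<in> polys_in V \<Longrightarrow> p + q \<in> polys_in V"
  using keys_add[of p q] by (auto simp: polys_in_def)

lemma polys_in_mult:
  assumes "p \<in> polys_in V" "q \<in> polys_in V"
  shows "p * q \<in> polys_in V"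
  unfolding polys_in_def
proof safe
  fix m x assume "m \<in> Poly_Mapping.keys (p * q)" and x: "x \<in> Poly_Mapping.keys m"
  then obtain a b where ab: "m = a + b" "a \<in> Poly_Mapping.keys p" "b \<in> Poly_Mapping.keys q"
    using keys_mult[of p q] by blast
  then have "Poly_Mapping.keys a \<subseteq> V" "Poly_Mapping.keys b \<subseteq> V"
    using assms by (auto simp: polys_in_def)
  then show "x \<in> V" using x keys_add[of a b] by (auto simp: ab(1))
qed

lemma polys_in_0: "0 \<in> polys_in V"
  by (simp add: polys_in_def)

lemma polys_in_1: "1 \<in> polys_in V"
  by (simp add: polys_in_def)

lemma polys_in_uminus: "(p :: ('v, 'a::comm_ring_1) mpoly) \<in> polys_in V \<Longrightarrow> - p \<in> polys_in V"
  by (simp add: polys_in_def)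

lemma polys_in_diff:
  "(p :: ('v, 'a::comm_ring_1) mpoly) \<in> polys_in V \<Longrightarrow> q \<in> polys_in V \<Longrightarrow> p - q \<in> polys_in V"
  using polys_in_add[OF _ polys_in_uminus, of p V q] by simp

lemma polys_in_sum: "(\<And>i. i \<in> I \<Longrightarrow> f i \<in> polys_in V) \<Longrightarrow> sum f I \<in> polys_in V"
  by (induction I rule: infinite_finite_induct) (auto intro: polys_in_0 polys_in_add)

lemma polys_in_prod:
  fixes f :: "'i \<Rightarrow> ('v, 'a::comm_ring_1) mpoly"
  shows "(\<And>i. i \<in> I \<Longrightarrow> f i \<in> polys_in V) \<Longrightarrow> prod f I \<in> polys_in V"
  by (induction I rule: infinite_finite_induct) (auto intro: polys_in_1 polys_in_mult)

lemma polys_in_power: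
  "(p :: ('v, 'a::comm_ring_1) mpoly) \<in> polys_in V \<Longrightarrow> p ^ N \<in> polys_in V"
  by (induction N) (auto intro: polys_in_1 polys_in_mult)

lemma polys_in_mono: "V \<subseteq> W \<Longrightarrow> polys_in V \<subseteq> polys_in W"
  by (auto simp: polys_in_def)

lemma polys_in_det:
  fixes A :: "('v, 'a::comm_ring_1) mpoly mat"
  assumes "A \<in> carrier_mat n n" "\<And>i j. i < n \<Longrightarrow> j < n \<Longrightarrow> A $$ (i, j) \<in> polys_in V"
  shows "det A \<in> polys_in V"
  unfolding det_def'[OF assms(1)]
proof (intro polys_in_sum polys_in_mult polys_in_prod assms(2))
  fix p :: "nat \<Rightarrow> nat"
  have "(- 1 :: ('v, 'a) mpoly) \<in> polys_in V" by (rule polys_in_uminus[OF polys_in_1])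
  then show "(signof p :: ('v, 'a) mpoly) \<in> polys_in V" by (cases p rule: sign_cases) (simp_all add: polys_in_1)
qed (auto dest: permutes_in_image)

lemma polys_in_induct [consumes 1, case_names const var add mult]:
  fixes p :: "('v, 'a::comm_ring_1) mpoly"
  assumes "p \<in> polys_in V"
    and const: "\<And>c. P (mconst c)" and var: "\<And>x. x \<in> V \<Longrightarrow> P (mvar x)"
    and add: "\<And>p q. P p \<Longrightarrow> P q \<Longrightarrow> P (p + q)" and mult: "\<And>p q. P p \<Longrightarrow> P q \<Longrightarrow> P (p * q)"
  shows "P p"
proof -
  have P01: "P 0" "P 1" using const[of 0] const[of 1] by (simp_all add: mconst_def)
  have psum: "P (sum f I)" if "\<And>i. i \<in> I \<Longrightarrow> P (f i)" for f :: "('v \<Rightarrow>\<^sub>0 nat) \<Rightarrow> _" and I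
    using that by (induction I rule: infinite_finite_induct) (auto intro: P01 add)
  have pprod: "P (prod f I)" if "\<And>i. i \<in> I \<Longrightarrow> P (f i)" for f :: "'v \<Rightarrow> _" and I
    using that by (induction I rule: infinite_finite_induct) (auto intro: P01 mult)
  have ppow: "P (q ^ N)" if "P q" for q N
    using that by (induction N) (auto intro: P01 mult)
  have mono: "P (eval_monom mvar m)" if "Poly_Mapping.keys m \<subseteq> V" for m
    unfolding eval_monom_def by (intro pprod ppow var) (use that in auto)
  have pw: "mvar x ^ N = (Poly_Mapping.single (Poly_Mapping.single x N) 1 :: ('v, 'a) mpoly)" for x N
    by (induction N) (auto simp: mvar_def mult_single simp flip: single_add)
  have pr: "(\<Prod>x\<in>S. mvar x ^ f x) =
      (Poly_Mapping.single (\<Sum>x\<in>S. Poly_Mapping.single x (f x)) 1 :: ('v, 'a) mpoly)" for S f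
    by (induction S rule: infinite_finite_induct) (auto simp: pw mult_single)
  have "m = (\<Sum>x\<in>Poly_Mapping.keys m. Poly_Mapping.single x (Poly_Mapping.lookup m x))"
    for m :: "'v \<Rightarrow>\<^sub>0 nat"
    by (rule poly_mapping_eqI) (auto simp: lookup_sum lookup_single when_def in_keys_iff)
  then have em: "eval_monom mvar m = (Poly_Mapping.single m 1 :: ('v, 'a) mpoly)" for m
    unfolding eval_monom_def pr by simp
  have "p = (\<Sum>m\<in>Poly_Mapping.keys p. mconst (Poly_Mapping.lookup p m) * eval_monom mvar m)"
    by (subst mpoly_sum_single) (simp add: em mconst_def mult_single)
  moreover have "P \<dots>"
    using assms(1) by (intro psum mult const mono) (auto simp: polys_in_def)
  ultimately show ?thesis by simp
qed

lemma peval_pfun: "p \<in> polys_in V \<Longrightarrow> (\<lambda>\<sigma>. peval \<sigma> p) \<in> pfun V"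
proof (induction rule: polys_in_induct)
  case (const c)
  show ?case by (simp add: peval_simps pfun_def falg.const)
next
  case (var x)
  then show ?case by (simp add: peval_simps pfun_var)
next
  case (add p q)
  then show ?case by (simp add: peval_simps pfun_def falg.add)
next
  case (mult p q)
  then show ?case by (simp add: peval_simps pfun_def falg.mult)
qed

text \<open>The way back from functions to polynomials: the construction of \<open>f\<close> by sums
  and products is repeated inside the generated subalgebra. Together with
  \<open>peval_inject\<close> it turns a representation as a function into membership.\<close>

lemma falg_peval_hull:
  assumes "f \<in> falg ((\<lambda>s \<sigma>. peval \<sigma> (\<gamma> s)) ` S)"
  shows "\<exists>p\<in>is_subalgebra hull (\<gamma> ` S). \<forall>\<sigma>. peval \<sigma> p = f \<sigma>"
proof -
  let ?A = "is_subalgebra hull (\<gamma> ` S)"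
  have A: "mconst c \<in> ?A" "p \<in> ?A \<Longrightarrow> q \<in> ?A \<Longrightarrow> p + q \<in> ?A"
    "p \<in> ?A \<Longrightarrow> q \<in> ?A \<Longrightarrow> p * q \<in> ?A" "s \<in> S \<Longrightarrow> \<gamma> s \<in> ?A" for c p q s
    by (auto simp: hull_def is_subalgebra_def)
  show ?thesis using assms
  proof induction
    case (const c)
    show ?case by (rule bexI[of _ "mconst c"]) (simp_all add: peval_simps A)
  next
    case (gen g)
    then show ?case using A(4) by auto
  next
    case (add f g)
    then obtain p q where "p \<in> ?A" "q \<in> ?A" "\<forall>\<sigma>. peval \<sigma> p = f \<sigma>" "\<forall>\<sigma>. peval \<sigma> q = g \<sigma>" by blast
    then show ?case by (intro bexI[of _ "p + q"]) (simp_all add: peval_simps A)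
  next
    case (mult f g)
    then obtain p q where "p \<in> ?A" "q \<in> ?A" "\<forall>\<sigma>. peval \<sigma> p = f \<sigma>" "\<forall>\<sigma>. peval \<sigma> q = g \<sigma>" by blast
    then show ?case by (intro bexI[of _ "p * q"]) (simp_all add: peval_simps A)
  qed
qed

section \<open>Quadratic forms in hyperbolic coordinates\<close>

text \<open>Coordinates \<open>2t\<close> and \<open>2t + 1\<close> span the \<open>t\<close>-th hyperbolic plane, so that splitting off
  a plane is a shift of the index by 2. The entry \<open>M (c, i)\<close> is the \<open>c\<close>-th coordinate of the
  \<open>i\<close>-th vector of the tuple \<open>M\<close>.\<close>

definition hquad :: "nat \<Rightarrow> (nat \<Rightarrow> 'a::comm_ring_1) \<Rightarrow> 'a" where
  "hquad \<nu> v = (\<Sum>t<\<nu>. v (2 * t) * v (2 * t + 1)) + (v (2 * \<nu>))\<^sup>2"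

text \<open>The last summand vanishes in characteristic 2. It is kept because
  \<open>hpolar_same\<close> is also used over the integers, to match the diagonal entries 2 Q of
  the Gram determinant.\<close>

definition hpolar :: "nat \<Rightarrow> (nat \<Rightarrow> 'a::comm_ring_1) \<Rightarrow> (nat \<Rightarrow> 'a) \<Rightarrow> 'a" where
  "hpolar \<nu> v w = (\<Sum>t<\<nu>. v (2 * t) * w (2 * t + 1) + v (2 * t + 1) * w (2 * t)) +
     2 * (v (2 * \<nu>) * w (2 * \<nu>))"

text \<open>Counterpart of \<open>gen_invariant\<close> at a point and in the hyperbolic order of
  coordinates; the reordering changes the determinant at most by a sign.\<close>

fun gval :: "nat \<Rightarrow> (nat \<times> nat \<Rightarrow> 'a::comm_ring_1) \<Rightarrow> gen \<Rightarrow> 'a" where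
  "gval \<nu> M (GenQ i) = hquad \<nu> (\<lambda>c. M (c, i))"
| "gval \<nu> M (GenB i j) = hpolar \<nu> (\<lambda>c. M (c, i)) (\<lambda>c. M (c, j))"
| "gval \<nu> M GenD = det (mat (2 * \<nu> + 1) (2 * \<nu> + 1) M)"

lemma hpolar_same: "hpolar \<nu> v v = 2 * hquad \<nu> v"
  by (simp add: hpolar_def hquad_def sum_distrib_left power2_eq_square algebra_simps
      flip: mult_2)

lemma hpolar_commute: "hpolar \<nu> v w = hpolar \<nu> w v"
  by (simp add: hpolar_def mult_ac add_ac)

lemma hquad_add: "hquad \<nu> (\<lambda>c. v c + w c) = hquad \<nu> v + hquad \<nu> w + hpolar \<nu> v w"
  by (simp add: hpolar_def hquad_def power2_eq_square algebra_simps sum.distrib flip: mult_2)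

lemma hom_gval:
  assumes "comm_ring_hom h"
  shows "h (gval \<nu> M g) = gval \<nu> (\<lambda>x. h (M x)) g"
proof -
  interpret comm_ring_hom h by fact
  have "map_mat h (mat n n M) = mat n n (\<lambda>x. h (M x))" for n
    by (rule eq_matI) auto
  then have "h (det (mat n n M)) = det (mat n n (\<lambda>x. h (M x)))" for n
    by (simp flip: hom_det)
  then show ?thesis
    by (cases g) (simp_all add: hquad_def hpolar_def hom_add hom_mult hom_sum hom_power hom_numeral)
qed

definition qbgens :: "nat \<Rightarrow> gen set" where
  "qbgens n = {GenQ i | i. i < n} \<union> {GenB i j | i j. i < j \<and> j < n}"

lemma gens_eq: "gens n = insert GenD (qbgens n)"
  by (auto simp: gens_def qbgens_def)

lemma qbgens_simps [simp]:
  "GenQ i \<in> qbgens n \<longleftrightarrow> i < n" "GenB i j \<in> qbgens n \<longleftrightarrow> i < j \<and> j < n" "GenD \<notin> qbgens n"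
  by (auto simp: qbgens_def)

subsection \<open>The half determinant\<close>

text \<open>The index of the coordinate that the polar form pairs with coordinate \<open>c\<close>,
  for \<open>c\<close> below 2 \<nu>.\<close>

definition mate :: "nat \<Rightarrow> nat" where
  "mate c = (if even c then c + 1 else c - 1)"

lemma mate_mate [simp]: "mate (mate c) = c"
  by (auto simp: mate_def elim: oddE)

lemma mate_less: "c < 2 * \<nu> \<Longrightarrow> mate c < 2 * \<nu>"
  by (auto simp: mate_def elim!: evenE)

lemma mate_simps [simp]: "mate (2 * t) = 2 * t + 1" "mate (Suc (2 * t)) = 2 * t"
  by (simp_all add: mate_def)

lemma sum_pairs: "(\<Sum>c<2 * \<nu>. f c) = (\<Sum>t<\<nu>. f (2 * t) + f (2 * t + 1))"
  for f :: "nat \<Rightarrow> 'a::comm_monoid_add"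
  by (induction \<nu>) (simp_all add: add_ac)

definition polar_mat :: "nat \<Rightarrow> 'a::comm_ring_1 mat" where
  "polar_mat \<nu> = mat (2 * \<nu> + 1) (2 * \<nu> + 1) (\<lambda>(c, d).
     if c < 2 * \<nu> then (if d = mate c then 1 else 0) else if d = c then 2 else 0)"

lemma polar_mat_mult:
  "polar_mat \<nu> * mat (2 * \<nu> + 1) m N = mat (2 * \<nu> + 1) m (\<lambda>(c, i).
     if c < 2 * \<nu> then N (mate c, i) else 2 * N (c, i))"
proof (rule eq_matI)
  fix c i assume *: "c < dim_row (mat (2 * \<nu> + 1) m (\<lambda>(c, i).
     if c < 2 * \<nu> then N (mate c, i) else 2 * N (c, i)))"
    "i < dim_col (mat (2 * \<nu> + 1) m (\<lambda>(c, i).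
     if c < 2 * \<nu> then N (mate c, i) else 2 * N (c, i)))"
  have "mate c < 2 * \<nu> + 1" if "c < 2 * \<nu>" using mate_less[OF that] by simp
  with * show "(polar_mat \<nu> * mat (2 * \<nu> + 1) m N) $$ (c, i) = mat (2 * \<nu> + 1) m (\<lambda>(c, i).
     if c < 2 * \<nu> then N (mate c, i) else 2 * N (c, i)) $$ (c, i)"
    by (auto simp: polar_mat_def scalar_prod_def if_distrib[of "\<lambda>x. x * _"] cong: if_cong)
qed (simp_all add: polar_mat_def)

text \<open>The square of this matrix is diagonal with entries 1, ..., 1, 4, which gives the
  determinant up to a sign, and the sign disappears modulo 2.\<close>

lemma det_polar_mat_int: "det (polar_mat \<nu> :: int mat) = 2 \<or> det (polar_mat \<nu> :: int mat) = - 2"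
proof -
  let ?n = "2 * \<nu> + 1" and ?J = "polar_mat \<nu> :: int mat"
  let ?E = "mat ?n ?n (\<lambda>(c, d). if c = d then if c < 2 * \<nu> then 1 else 4 else (0::int))"
  have J: "?J \<in> carrier_mat ?n ?n" by (simp add: polar_mat_def)
  have "?J * ?J = ?E"
    by (subst (2) polar_mat_def, subst polar_mat_mult)
      (auto intro!: eq_matI dest: mate_less)
  moreover have "det ?E = prod_list (diag_mat ?E)"
    by (rule det_upper_triangular[of _ ?n]) (auto simp: upper_triangular_def)
  moreover have "diag_mat ?E = map (\<lambda>c. if c < 2 * \<nu> then 1 else 4) [0..<2 * \<nu>] @ [4]"
    by (simp add: diag_mat_def)
  moreover have "map (\<lambda>c. if c < 2 * \<nu> then 1 else (4::int)) [0..<2 * \<nu>] = map (\<lambda>c. 1) [0..<2 * \<nu>]"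
    by simp
  moreover have "prod_list (map (\<lambda>c. 1) xs) = (1::int)" for xs :: "nat list"
    by (induction xs) auto
  ultimately have "det ?J * det ?J = 4"
    by (simp flip: det_mult[OF J J])
  then have "(det ?J - 2) * (det ?J + 2) = 0" by (simp add: algebra_simps)
  then show ?thesis by (simp add: eq_neg_iff_add_eq_0)
qed

lemma gram_mat_eq:
  fixes M :: "nat \<times> nat \<Rightarrow> 'a::comm_ring_1"
  shows "transpose_mat (mat (2 * \<nu> + 1) m M) * (polar_mat \<nu> * mat (2 * \<nu> + 1) m M) =
    mat m m (\<lambda>(i, j). hpolar \<nu> (\<lambda>c. M (c, i)) (\<lambda>c. M (c, j)))"
  unfolding polar_mat_mult
  by (rule eq_matI)
    (auto simp: scalar_prod_def hpolar_def sum_pairs atLeast0LessThan mult.left_commute)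

text \<open>The Gram matrix is the product of the transpose of A, of \<open>polar_mat\<close> and of
  A. The determinant of \<open>polar_mat\<close> is taken over the integers, so that its factor 2
  can be cancelled there.\<close>

lemma det_gram:
  fixes M :: "nat \<times> nat \<Rightarrow> 'a::comm_ring_1"
  shows "det (mat (2 * \<nu> + 1) (2 * \<nu> + 1) (\<lambda>(i, j). hpolar \<nu> (\<lambda>c. M (c, i)) (\<lambda>c. M (c, j)))) =
    of_int (det (polar_mat \<nu>)) * (gval \<nu> M GenD)\<^sup>2"
proof -
  let ?n = "2 * \<nu> + 1" and ?A = "mat (2 * \<nu> + 1) (2 * \<nu> + 1) M"
  have J: "(polar_mat \<nu> :: 'a mat) \<in> carrier_mat ?n ?n" and A: "?A \<in> carrier_mat ?n ?n"
    by (simp_all add: polar_mat_def)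
  have "polar_mat \<nu> = map_mat of_int (polar_mat \<nu>)"
    by (rule eq_matI) (auto simp: polar_mat_def)
  then have "det (polar_mat \<nu> :: 'a mat) = of_int (det (polar_mat \<nu>))"
    by (metis of_int_hom.hom_det)
  moreover have "det (transpose_mat ?A * (polar_mat \<nu> * ?A)) =
      det (transpose_mat ?A) * (det (polar_mat \<nu>) * det ?A)"
    by (subst det_mult[OF transpose_carrier_mat[THEN iffD2, OF A] mult_carrier_mat[OF J A]],
        subst det_mult[OF J A], rule refl)
  moreover have "det (transpose_mat ?A) = det ?A" by (rule det_transpose[of _ ?n]) simp
  ultimately show ?thesis unfolding gram_mat_eq by (simp add: power2_eq_square mult_ac)
qed

definition hdisc :: "nat \<Rightarrow> (gen, 'a::comm_ring_1) mpoly" where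
  "hdisc n = Poly_Mapping.map of_int (half_gram_det n)"

lemma G_rel_eq: "G_rel n = (mvar GenD)\<^sup>2 - hdisc n"
  by (simp add: G_rel_def hdisc_def)

lemma peval_map_of_int:
  fixes \<sigma> :: "'v \<Rightarrow> 'a::comm_ring_1"
  shows "peval \<sigma> (Poly_Mapping.map of_int p) = eval_mpoly of_int \<sigma> p"
proof -
  have l: "Poly_Mapping.lookup (Poly_Mapping.map of_int p) m = (of_int (Poly_Mapping.lookup p m) :: 'a)" for m
    by (simp add: Poly_Mapping.map.rep_eq when_def)
  then have "Poly_Mapping.keys (Poly_Mapping.map (of_int :: int \<Rightarrow> 'a) p) \<subseteq> Poly_Mapping.keys p"
    by (auto simp: in_keys_iff)
  then have "peval \<sigma> (Poly_Mapping.map of_int p) = (\<Sum>m\<in>Poly_Mapping.keys p.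
      Poly_Mapping.lookup (Poly_Mapping.map of_int p) m * eval_monom \<sigma> m)"
    by (intro eval_mpoly_superset) auto
  then show ?thesis by (simp add: l eval_mpoly_def)
qed

lemma hdisc_in: "hdisc n \<in> polys_in (qbgens n)"
proof -
  have "gram_det n \<in> polys_in (qbgens n)"
    unfolding gram_det_def
  proof (rule polys_in_det[of _ n])
    show "mat n n (\<lambda>(i, j). if i = j then 2 * (mvar (GenQ i) :: (gen, int) mpoly)
        else mvar (GenB (min i j) (max i j))) \<in> carrier_mat n n" by simp
    fix i j assume ij: "i < n" "j < n"
    have "2 * (mvar (GenQ i) :: (gen, int) mpoly) \<in> polys_in (qbgens n)"
      unfolding mult_2 by (intro polys_in_add polys_in_var) (use ij in auto)
    then show "mat n n (\<lambda>(i, j). if i = j then 2 * (mvar (GenQ i) :: (gen, int) mpoly)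
        else mvar (GenB (min i j) (max i j))) $$ (i, j) \<in> polys_in (qbgens n)"
      using ij by (auto intro!: polys_in_var)
  qed
  moreover have "Poly_Mapping.keys (hdisc n) \<subseteq> Poly_Mapping.keys (gram_det n)"
    by (auto simp: hdisc_def half_gram_det_def in_keys_iff Poly_Mapping.map.rep_eq when_def
        split: if_splits)
  ultimately show ?thesis by (auto simp: polys_in_def)
qed

lemma mpoly_int_cancel_2:
  fixes p q :: "('v, int) mpoly"
  assumes "2 * p = 2 * q"
  shows "p = q"
proof (rule poly_mapping_eqI)
  fix m
  have "Poly_Mapping.lookup (p + p) m = Poly_Mapping.lookup (q + q) m"
    using assms by (simp only: mult_2)
  then show "Poly_Mapping.lookup p m = Poly_Mapping.lookup q m" unfolding lookup_add by simp
qed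

text \<open>The identity \<open>G = 0\<close> is proved for indeterminate vectors over \<open>\<int>\<close>, where 2 can be
  cancelled, and then specialised.\<close>

lemma hdisc_gval:
  fixes M :: "nat \<times> nat \<Rightarrow> 'a::comm_ring_1"
  assumes c2: "(2::'a) = 0"
  shows "peval (gval \<nu> M) (hdisc (2 * \<nu> + 1)) = (gval \<nu> M GenD)\<^sup>2"
proof -
  let ?n = "2 * \<nu> + 1"
  define X :: "nat \<times> nat \<Rightarrow> (nat \<times> nat, int) mpoly" where "X = mvar"
  define E where "E = eval_mpoly of_int (gval \<nu> X) (half_gram_det ?n)"
  interpret X: comm_ring_hom "eval_mpoly of_int (gval \<nu> X)"
    by (rule comm_ring_hom_eval_mpoly) (rule of_int_hom.comm_ring_hom_axioms)
  interpret M: comm_ring_hom "eval_mpoly of_int M :: _ \<Rightarrow> 'a"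
    by (rule comm_ring_hom_eval_mpoly) (rule of_int_hom.comm_ring_hom_axioms)
  \<comment> \<open>Half the Gram determinant will be \<open>e\<close> times the square of D, and
    the sign \<open>e\<close> becomes 1 in a ring with 2 = 0.\<close>
  obtain e :: int where e: "det (polar_mat \<nu>) = 2 * e" "e = 1 \<or> e = - 1"
    using det_polar_mat_int[of \<nu>] by force
  have "2 * E = eval_mpoly of_int (gval \<nu> X) (2 * half_gram_det ?n)"
    by (simp add: E_def X.hom_mult X.hom_numeral)
  also have "\<dots> = eval_mpoly of_int (gval \<nu> X) (gram_det ?n)"
    by (subst two_times_half_gram_det) auto
  also have "\<dots> = det (map_mat (eval_mpoly of_int (gval \<nu> X)) (mat ?n ?n (\<lambda>(i, j).
     if i = j then 2 * mvar (GenQ i) else mvar (GenB (min i j) (max i j)))))"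
    by (simp add: gram_det_def)
  also have "map_mat (eval_mpoly of_int (gval \<nu> X)) (mat ?n ?n (\<lambda>(i, j).
     if i = j then 2 * mvar (GenQ i) else mvar (GenB (min i j) (max i j)))) =
     mat ?n ?n (\<lambda>(i, j). hpolar \<nu> (\<lambda>c. X (c, i)) (\<lambda>c. X (c, j)))"
    by (rule eq_matI) (auto simp: X.hom_mult X.hom_numeral eval_mpoly_var[OF of_int_hom.comm_ring_hom_axioms]
        hpolar_same min_def max_def intro: hpolar_commute)
  also have "det \<dots> = 2 * (of_int e * (gval \<nu> X GenD)\<^sup>2)"
    by (simp only: det_gram e of_int_mult of_int_numeral mult.assoc)
  finally have "E = of_int e * (gval \<nu> X GenD)\<^sup>2" by (rule mpoly_int_cancel_2)
  then have "eval_mpoly of_int M E = of_int e * (eval_mpoly of_int M (gval \<nu> X GenD))\<^sup>2"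
    by (simp only: M.hom_mult M.hom_power M.hom_of_int)
  moreover have "eval_mpoly of_int M (gval \<nu> X g) = gval \<nu> M g" for g
    by (simp add: hom_gval[OF M.comm_ring_hom_axioms] X_def
        eval_mpoly_var[OF of_int_hom.comm_ring_hom_axioms])
  moreover have "eval_mpoly of_int M E = eval_mpoly of_int (gval \<nu> M) (half_gram_det ?n)"
    unfolding E_def hom_eval_mpoly[OF M.comm_ring_hom_axioms]
    by (simp only: M.hom_of_int calculation(2))
  moreover have "(of_int e :: 'a) = 1"
    using e(2)
  proof
    assume "e = - 1"
    then show ?thesis using c2 by (simp add: neg_eq_iff_add_eq_0)
  qed simp
  ultimately show ?thesis by (simp only: hdisc_def peval_map_of_int mult_1_left)
qed

section \<open>Algebraically closed fields of characteristic 2\<close>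

lemma char2_simps:
  assumes c2: "(2::'k::field) = 0"
  shows "x + x = (0::'k)" "- x = x" "x - y = x + y" "(x + y)\<^sup>2 = x\<^sup>2 + y\<^sup>2"
proof -
  show 1: "x + x = 0" for x :: 'k using c2 by (simp flip: mult_2)
  show 2: "- x = x" for x :: 'k using 1[of x] by (simp add: neg_eq_iff_add_eq_0)
  show "x - y = x + y" using 2[of y] by (simp add: diff_conv_add_uminus del: add_uminus_conv_diff)
  show "(x + y)\<^sup>2 = x\<^sup>2 + y\<^sup>2" using c2 by (simp add: power2_sum)
qed

lemma char2_square_inject:
  assumes c2: "(2::'k::field) = 0" and "x\<^sup>2 = (y::'k)\<^sup>2"
  shows "x = y"
proof -
  have "(x - y)\<^sup>2 = 0" using assms char2_simps(3,4)[OF c2] char2_simps(1)[OF c2] by metis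
  then show ?thesis by simp
qed

lemma square_root_exists: "\<exists>r. r\<^sup>2 = (x::'k::alg_closed_field)"
  using nth_root_exists[of 2 x] by auto

subsection \<open>Every quadratic form is a pullback of the standard one\<close>

definition glue :: "(nat \<Rightarrow> 'a) \<Rightarrow> (nat \<Rightarrow> 'a) \<Rightarrow> nat \<Rightarrow> 'a" where
  "glue p w c = (if c < 2 then p c else w (c - 2))"

lemma hquad_glue: "hquad (Suc \<nu>) (glue p w) = p 0 * p 1 + hquad \<nu> w"
  by (simp add: hquad_def glue_def sum.lessThan_Suc_shift del: sum.lessThan_Suc)

lemma hpolar_glue: "hpolar (Suc \<nu>) (glue p w) (glue p' w') = p 0 * p' 1 + p 1 * p' 0 + hpolar \<nu> w w'"
  by (simp add: hpolar_def glue_def sum.lessThan_Suc_shift add_ac del: sum.lessThan_Suc)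

text \<open>For the vectors (1, q0) and (c, d) of a hyperbolic plane the equations prescribe Q of
  the second one and their polar value. Eliminating d leaves q0 c^2 - b c + q1 = 0, which is not
  constant even for q0 = 0 because b \<noteq> 0.\<close>

lemma plane_realize:
  fixes b :: "'k::alg_closed_field"
  assumes "b \<noteq> 0"
  shows "\<exists>c d. c * d = q1 \<and> d + q0 * c = b"
proof -
  have "degree [:q1, - b, q0:] > 0" using assms by simp
  then obtain c where "poly [:q1, - b, q0:] c = 0" using alg_closed_imp_poly_has_root by blast
  then show ?thesis by (intro exI[of _ c] exI[of _ "b - q0 * c"]) (simp add: algebra_simps)
qed

text \<open>If some off-diagonal value is nonzero, its two vectors are put into a hyperbolic plane
  and the others are completed in the orthogonal complement, with two vectors fewer. If all are
  zero, multiples of the radical vector do, scaled by square roots of the \<open>Q i\<close>. For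
  \<nu> = 0 the bound on \<open>card I\<close> leaves at most one vector, hence no off-diagonal
  condition.\<close>

lemma realize_form:
  fixes B :: "'i \<Rightarrow> 'i \<Rightarrow> 'k::alg_closed_field"
  assumes c2: "(2::'k) = 0" and "finite I" "card I \<le> 2 * \<nu> + 1" "\<And>i j. B i j = B j i"
  shows "\<exists>v. \<forall>i\<in>I. hquad \<nu> (v i) = Q i \<and> (\<forall>j\<in>I. j \<noteq> i \<longrightarrow> hpolar \<nu> (v i) (v j) = B i j)"
  using assms(2-)
proof (induction \<nu> arbitrary: I Q B)
  case (Suc \<nu>)
  note ch2 = char2_simps[OF c2]
  show ?case
  proof (cases "\<exists>i\<in>I. \<exists>j\<in>I. i \<noteq> j \<and> B i j \<noteq> 0")
    case True
    then obtain i0 j0 where ij: "i0 \<in> I" "j0 \<in> I" "i0 \<noteq> j0" and b: "B i0 j0 \<noteq> 0" by blast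
    define b where "b = B i0 j0"
    obtain c d where cd: "c * d = Q j0" "d + Q i0 * c = b"
      using plane_realize[OF b] b_def by metis
    \<comment> \<open>\<alpha> and \<beta> are the coefficients of the plane component of the i-th
      vector in the basis formed by the vectors \<open>i0\<close> and \<open>j0\<close>: pairing
      with one of these reads off the coefficient of the other, times \<open>b\<close>.\<close>
    define \<alpha> where "\<alpha> i = (if i = i0 then 1 else if i = j0 then 0 else B i j0 / b)" for i
    define \<beta> where "\<beta> i = (if i = i0 then 0 else if i = j0 then 1 else B i i0 / b)" for i
    define J where "J = I - {i0, j0}"
    have J: "finite J" "card J \<le> 2 * \<nu> + 1" using Suc.prems ij by (auto simp: J_def card_Diff_subset)
    \<comment> \<open>The quadratic and polar values of the plane components; the complement has to
      supply the difference to \<open>Q\<close> and \<open>B\<close>.\<close>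
    define q where "q i = (\<alpha> i)\<^sup>2 * Q i0 + (\<beta> i)\<^sup>2 * Q j0 + \<alpha> i * \<beta> i * b" for i
    define p where "p i j = (\<alpha> i * \<beta> j + \<beta> i * \<alpha> j) * b" for i j
    have "B i j - p i j = B j i - p j i" for i j
      using Suc.prems(3)[of i j] by (simp add: p_def algebra_simps)
    then have "\<exists>w. \<forall>i\<in>J. hquad \<nu> (w i) = Q i - q i \<and>
        (\<forall>j\<in>J. j \<noteq> i \<longrightarrow> hpolar \<nu> (w i) (w j) = B i j - p i j)"
      by (rule Suc.IH[OF J])
    then obtain w where
      w: "\<forall>i\<in>J. hquad \<nu> (w i) = Q i - q i \<and> (\<forall>j\<in>J. j \<noteq> i \<longrightarrow> hpolar \<nu> (w i) (w j) = B i j - p i j)"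
      by blast
    define w' where "w' i = (if i \<in> J then w i else (\<lambda>_. 0))" for i
    \<comment> \<open>Plane coordinates of \<alpha> (1, Q i0) + \<beta> (c, d), with the pair from
      \<open>plane_realize\<close> as basis.\<close>
    define u where "u i = (\<lambda>k::nat. if k = 0 then \<alpha> i + \<beta> i * c else \<alpha> i * Q i0 + \<beta> i * d)" for i
    have uq: "u i 0 * u i 1 = q i" for i
    proof -
      have "u i 0 * u i 1 = (\<alpha> i)\<^sup>2 * Q i0 + (\<beta> i)\<^sup>2 * (c * d) + \<alpha> i * \<beta> i * (d + Q i0 * c)"
        by (simp add: u_def algebra_simps power2_eq_square)
      then show ?thesis by (simp only: cd q_def)
    qed
    have up: "u i 0 * u j 1 + u i 1 * u j 0 = p i j" for i j
    proof -
      have "u i 0 * u j 1 + u i 1 * u j 0 = (\<alpha> i * \<beta> j + \<beta> i * \<alpha> j) * (d + Q i0 * c) +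
          2 * (\<alpha> i * \<alpha> j * Q i0 + \<beta> i * \<beta> j * c * d)"
        by (simp add: u_def algebra_simps)
      then show ?thesis by (simp only: cd p_def c2) simp
    qed
    have z: "hquad \<nu> (\<lambda>_. 0) = (0::'k)" "hpolar \<nu> (\<lambda>_. 0) v = (0::'k)" "hpolar \<nu> v (\<lambda>_. 0) = (0::'k)" for v
      by (simp_all add: hquad_def hpolar_def)
    have q0: "q i0 = Q i0" "q j0 = Q j0" using ij by (simp_all add: q_def \<alpha>_def \<beta>_def)
    \<comment> \<open>A pair that involves a basis vector gets nothing from the complement, so the
      plane must already give the full value.\<close>
    have p0: "p i j = B i j" if "i \<in> I" "j \<in> I" "i \<noteq> j" "i \<notin> J \<or> j \<notin> J" for i j
    proof -
      have "b \<noteq> 0" using b by (simp add: b_def)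
      have 1: "p i0 j = B i0 j" if "j \<noteq> i0" for j
        using that ij \<open>b \<noteq> 0\<close> Suc.prems(3)[of j i0] by (simp add: p_def \<alpha>_def \<beta>_def b_def)
      have 2: "p j0 j = B j0 j" if "j \<noteq> j0" for j
        using that ij \<open>b \<noteq> 0\<close> Suc.prems(3)[of j j0] Suc.prems(3)[of i0 j0] by (simp add: p_def \<alpha>_def \<beta>_def b_def)
      have 3: "p i j = p j i" for i j by (simp add: p_def add.commute mult.commute)
      have "i = i0 \<or> i = j0 \<or> j = i0 \<or> j = j0" using that by (auto simp: J_def)
      then show ?thesis using that(3) 1 2 3 Suc.prems(3) by metis
    qed
    show ?thesis
    proof (intro exI[of _ "\<lambda>i. glue (u i) (w' i)"] ballI conjI impI)
      fix i assume i: "i \<in> I"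
      then show "hquad (Suc \<nu>) (glue (u i) (w' i)) = Q i"
        using w q0 by (auto simp: hquad_glue uq[simplified] w'_def z J_def)
      fix j assume j: "j \<in> I" "j \<noteq> i"
      show "hpolar (Suc \<nu>) (glue (u i) (w' i)) (glue (u j) (w' j)) = B i j"
        using w i j p0[of i j] by (auto simp: hpolar_glue up[simplified] w'_def z)
    qed
  next
    case False
    obtain r where r: "\<forall>i. (r i)\<^sup>2 = Q i"
      by atomize_elim (intro choice allI square_root_exists)
    show ?thesis
      using False by (intro exI[of _ "\<lambda>i k. if k = 2 * Suc \<nu> then r i else 0"])
        (auto simp: hquad_def hpolar_def r c2 simp del: sum.lessThan_Suc intro!: sum.neutral)
  qed
next
  case 0
  obtain r where r: "\<forall>i. (r i)\<^sup>2 = Q i"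
    by atomize_elim (intro choice allI square_root_exists)
  have "i = j" if "i \<in> I" "j \<in> I" for i j
    using that 0 card_le_Suc0_iff_eq[of I] by simp
  then show ?case by (intro exI[of _ "\<lambda>i k. r i"]) (auto simp: hquad_def r)
qed

text \<open>Makes the variables in \<open>qbgens\<close> free parameters: an identity in Q and B
  that holds at all tuples holds for arbitrary values.\<close>

lemma realize_gval:
  fixes \<sigma> :: "gen \<Rightarrow> 'k::alg_closed_field"
  assumes c2: "(2::'k) = 0"
  shows "\<exists>M. \<forall>g\<in>qbgens (2 * \<nu> + 1). gval \<nu> M g = \<sigma> g"
proof -
  let ?B = "\<lambda>i j. \<sigma> (GenB (min i j) (max i j))"
  have "\<exists>v. \<forall>i\<in>{..<2 * \<nu> + 1}. hquad \<nu> (v i) = \<sigma> (GenQ i) \<and>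
      (\<forall>j\<in>{..<2 * \<nu> + 1}. j \<noteq> i \<longrightarrow> hpolar \<nu> (v i) (v j) = ?B i j)"
    by (rule realize_form[OF c2]) (simp_all add: min.commute max.commute)
  then obtain v where v: "\<And>i j. i < 2 * \<nu> + 1 \<Longrightarrow> hquad \<nu> (v i) = \<sigma> (GenQ i)"
    "\<And>i j. i < 2 * \<nu> + 1 \<Longrightarrow> j < 2 * \<nu> + 1 \<Longrightarrow> j \<noteq> i \<Longrightarrow> hpolar \<nu> (v i) (v j) = ?B i j"
    unfolding Ball_def lessThan_iff by blast
  show ?thesis
    using v by (intro exI[of _ "\<lambda>(c, i). v i c"]) (auto simp: qbgens_def)
qed

lemma gval_GenD_cong:
  fixes M M' :: "nat \<times> nat \<Rightarrow> 'k::field"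
  assumes c2: "(2::'k) = 0" and eq: "\<And>g. g \<in> qbgens (2 * \<nu> + 1) \<Longrightarrow> gval \<nu> M g = gval \<nu> M' g"
  shows "gval \<nu> M GenD = gval \<nu> M' GenD"
proof (rule char2_square_inject[OF c2])
  show "(gval \<nu> M GenD)\<^sup>2 = (gval \<nu> M' GenD)\<^sup>2"
    unfolding hdisc_gval[OF c2, symmetric] by (rule peval_cong[OF hdisc_in eq])
qed

subsection \<open>Independence of 1 and the determinant over the quadratic invariants\<close>

lemma gval_pfun:
  assumes "g \<in> gens (2 * \<nu> + 1)"
  shows "(\<lambda>M. gval \<nu> M g) \<in> pfun ({..<2 * \<nu> + 1} \<times> {..<2 * \<nu> + 1})"
proof -
  have v: "(\<lambda>M. M (c, i)) \<in> falg ((\<lambda>v \<sigma>. \<sigma> v) ` ({..<2 * \<nu> + 1} \<times> {..<2 * \<nu> + 1}))"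
    if "c < 2 * \<nu> + 1" "i < 2 * \<nu> + 1" for c i
    using that by (intro falg.gen) auto
  show ?thesis
  proof (cases g)
    case GenD
    have "(\<lambda>M. det (mat (2 * \<nu> + 1) (2 * \<nu> + 1) (\<lambda>(i, j). M (i, j)))) \<in>
        falg ((\<lambda>v \<sigma>. \<sigma> v) ` ({..<2 * \<nu> + 1} \<times> {..<2 * \<nu> + 1}))"
      by (rule falg_det) (rule v)
    then show ?thesis using GenD by (simp add: pfun_def)
  qed (use assms in \<open>auto simp: gens_def pfun_def hquad_def hpolar_def
      intro!: falg.add falg.mult falg_sum falg_power v[simplified] falg.const\<close>)
qed

text \<open>Its nonvanishing guarantees that the determinant depends on the last coordinate of the
  vector with index 0.\<close>

definition cdet :: "nat \<Rightarrow> (gen \<Rightarrow> 'a::comm_ring_1) \<Rightarrow> 'a" where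
  "cdet \<nu> \<sigma> = det (mat (2 * \<nu>) (2 * \<nu>) (\<lambda>(i, j).
     if i = j then 0 else \<sigma> (GenB (Suc (min i j)) (Suc (max i j)))))"

lemma cdet_pfun: "cdet \<nu> \<in> pfun (qbgens (2 * \<nu> + 1))"
  unfolding cdet_def[abs_def] pfun_def
proof (rule falg_det)
  fix i j assume "i < 2 * \<nu>" "j < 2 * \<nu>"
  then show "(\<lambda>\<sigma>. if i = j then 0 else \<sigma> (GenB (Suc (min i j)) (Suc (max i j)))) \<in>
      falg ((\<lambda>v \<sigma>. \<sigma> v) ` qbgens (2 * \<nu> + 1))"
    by (cases "i = j") (auto intro!: falg.const falg.gen)
qed

lemma cdet_nonzero: "\<exists>\<sigma> :: gen \<Rightarrow> 'k::field. cdet \<nu> \<sigma> \<noteq> 0 \<and> (\<forall>j. \<sigma> (GenB 0 j) = 0)"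
proof -
  \<comment> \<open>Vectors 2t + 1 and 2t + 2 are paired, so after the shift of indices by one the
    Gram matrix is the permutation matrix of the involution \<open>mate\<close>. Vector 0 stays
    orthogonal to all others, as the locus in \<open>one_GenD_independent\<close> may
    demand.\<close>
  define \<sigma> :: "gen \<Rightarrow> 'k" where "\<sigma> g = (case g of GenB i j \<Rightarrow> if odd i \<and> j = Suc i then 1 else 0 | _ \<Rightarrow> 0)" for g
  define C where "C = mat (2 * \<nu>) (2 * \<nu>) (\<lambda>(i, j). if j = mate i then 1 else (0::'k))"
  have "(if i = j then 0 else \<sigma> (GenB (Suc (min i j)) (Suc (max i j)))) =
      (if j = mate i then 1 else 0)" for i j
    by (cases i j rule: linorder_cases) (simp_all add: \<sigma>_def mate_def, presburger+)
  then have c: "cdet \<nu> \<sigma> = det C" unfolding cdet_def C_def by simp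
  have C: "C \<in> carrier_mat (2 * \<nu>) (2 * \<nu>)" by (simp add: C_def)
  have "C * C = 1\<^sub>m (2 * \<nu>)"
    by (rule eq_matI) (auto simp: C_def scalar_prod_def if_distrib[of "\<lambda>x. x * _"] mate_less cong: if_cong)
  then have "det C * det C = 1" using det_mult[OF C C] by simp
  then show ?thesis using c by (intro exI[of _ \<sigma>]) (auto simp: \<sigma>_def)
qed

text \<open>In characteristic 2 the polar form ignores the last coordinate, so the Gram matrix of
  the vectors 1, ..., 2 \<nu> is a product of two matrices built from their first 2 \<nu>
  coordinates, one of them the transpose of the matrix in question.\<close>

lemma minor_nonzero:
  fixes M :: "nat \<times> nat \<Rightarrow> 'k::field"
  assumes c2: "(2::'k) = 0" and c: "cdet \<nu> (gval \<nu> M) \<noteq> 0"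
  shows "det (mat (2 * \<nu>) (2 * \<nu>) (\<lambda>(c, j). M (c, Suc j))) \<noteq> 0"
proof -
  let ?n = "2 * \<nu>"
  define N where "N = mat ?n ?n (\<lambda>(c, j). M (c, Suc j))"
  define K where "K = mat ?n ?n (\<lambda>(c, j). M (mate c, Suc j))"
  have *: "hpolar \<nu> v w = (\<Sum>c<?n. v c * w (mate c))" for v w :: "nat \<Rightarrow> 'k"
    by (simp add: hpolar_def sum_pairs c2)
  have "transpose_mat N * K = mat ?n ?n (\<lambda>(i, j).
      if i = j then 0 else gval \<nu> M (GenB (Suc (min i j)) (Suc (max i j))))"
  proof (rule eq_matI, goal_cases)
    case (1 i j)
    then have "(transpose_mat N * K) $$ (i, j) = hpolar \<nu> (\<lambda>c. M (c, Suc i)) (\<lambda>c. M (c, Suc j))"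
      by (simp add: N_def K_def * scalar_prod_def atLeast0LessThan)
    also have "\<dots> = (if i = j then 0 else gval \<nu> M (GenB (Suc (min i j)) (Suc (max i j))))"
      by (auto simp: hpolar_same c2 min_def max_def intro: hpolar_commute)
    finally show ?case using 1 by simp
  qed (simp_all add: N_def K_def)
  then have "cdet \<nu> (gval \<nu> M) = det (transpose_mat N * K)" by (simp add: cdet_def)
  also have "\<dots> = det (transpose_mat N) * det K"
    by (rule det_mult) (auto simp: N_def K_def)
  also have "det (transpose_mat N) = det N" by (rule det_transpose) (auto simp: N_def)
  finally show ?thesis using c by (auto simp: N_def)
qed

text \<open>The last basis vector spans the radical of the polar form. The slope \<open>d\<close> of
  the determinant in r is the cofactor of the shifted entry, whose minor is that of
  \<open>minor_nonzero\<close>.\<close>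

lemma gval_shift:
  fixes M :: "nat \<times> nat \<Rightarrow> 'k::field" and \<nu> :: nat
  assumes c2: "(2::'k) = 0"
  defines M'_def: "M' \<equiv> \<lambda>r. M((2 * \<nu>, 0) := M (2 * \<nu>, 0) + r)"
  shows "g \<in> qbgens (2 * \<nu> + 1) \<Longrightarrow>
      gval \<nu> (M' r) g = ((gval \<nu> M)(GenQ 0 := gval \<nu> M (GenQ 0) + r\<^sup>2)) g"
    and "cdet \<nu> (gval \<nu> M) \<noteq> 0 \<Longrightarrow>
      \<exists>d. d \<noteq> 0 \<and> (\<forall>r. gval \<nu> (M' r) GenD = gval \<nu> M GenD + r * d)"
proof -
  show "gval \<nu> (M' r) g = ((gval \<nu> M)(GenQ 0 := gval \<nu> M (GenQ 0) + r\<^sup>2)) g"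
    if "g \<in> qbgens (2 * \<nu> + 1)"
    using that by (auto simp: qbgens_def M'_def hquad_def hpolar_def c2 char2_simps(4)[OF c2]
        split: if_splits)
next
  assume c: "cdet \<nu> (gval \<nu> M) \<noteq> 0"
  let ?n = "2 * \<nu> + 1"
  define A where "A r = mat ?n ?n (M' r)" for r
  have A: "A r \<in> carrier_mat ?n ?n" for r by (simp add: A_def)
  have M0: "M' 0 = M" by (simp add: M'_def)
  \<comment> \<open>Column 0 contains the only entry that depends on r.\<close>
  have del: "mat_delete (A r) c 0 = mat_delete (A 0) c 0" for r c
    by (rule eq_matI) (auto simp: mat_delete_def A_def M'_def)
  have "det (A r) = det (A 0) + r * cofactor (A 0) (2 * \<nu>) 0" for r
  proof -
    have "det (A r) = (\<Sum>c<?n. A r $$ (c, 0) * cofactor (A r) c 0)"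
      by (rule laplace_expansion_column[OF A]) simp
    also have "\<dots> = (\<Sum>c<?n. A 0 $$ (c, 0) * cofactor (A 0) c 0 +
        (if c = 2 * \<nu> then r * cofactor (A 0) c 0 else 0))"
    proof (rule sum.cong)
      fix c assume "c \<in> {..<?n}"
      then have "A r $$ (c, 0) = A 0 $$ (c, 0) + (if c = 2 * \<nu> then r else 0)"
        by (simp add: A_def M'_def)
      then show "A r $$ (c, 0) * cofactor (A r) c 0 = A 0 $$ (c, 0) * cofactor (A 0) c 0 +
          (if c = 2 * \<nu> then r * cofactor (A 0) c 0 else 0)"
        by (simp add: cofactor_def del[of r] distrib_right)
    qed simp
    also have "\<dots> = (\<Sum>c<?n. A 0 $$ (c, 0) * cofactor (A 0) c 0) + r * cofactor (A 0) (2 * \<nu>) 0"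
      by (simp add: sum.distrib)
    also have "(\<Sum>c<?n. A 0 $$ (c, 0) * cofactor (A 0) c 0) = det (A 0)"
      by (rule laplace_expansion_column[OF A, symmetric]) simp
    finally show ?thesis .
  qed
  moreover have "mat_delete (A 0) (2 * \<nu>) 0 = mat (2 * \<nu>) (2 * \<nu>) (\<lambda>(c, j). M (c, Suc j))"
    by (rule eq_matI) (auto simp: mat_delete_def A_def M0)
  then have "cofactor (A 0) (2 * \<nu>) 0 \<noteq> 0"
    using minor_nonzero[OF c2 c] by (simp add: cofactor_def)
  ultimately show "\<exists>d. d \<noteq> 0 \<and> (\<forall>r. gval \<nu> (M' r) GenD = gval \<nu> M GenD + r * d)"
    by (intro exI[of _ "cofactor (A 0) (2 * \<nu>) 0"]) (auto simp: A_def M0)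
qed

text \<open>The left-hand side below has even degree and the right-hand side odd degree.\<close>

lemma square_eq_linear_times_square:
  fixes u w :: "'k::field poly"
  assumes "u\<^sup>2 = [:a, 1:] * w\<^sup>2"
  shows "w = 0" "u = 0"
proof -
  show w: "w = 0"
  proof (rule ccontr)
    assume "w \<noteq> 0"
    then have "[:a, 1:] * w\<^sup>2 \<noteq> 0" by (simp only: mult_eq_0_iff power_eq_0_iff pCons_eq_0_iff) simp
    then have "u\<^sup>2 \<noteq> 0" by (simp only: assms not_False_eq_True)
    then have "u \<noteq> 0" by auto
    have "degree (u\<^sup>2) = Suc (degree (w\<^sup>2))"
      unfolding assms using \<open>w \<noteq> 0\<close> by (subst degree_mult_eq) auto
    then have "2 * degree u = Suc (2 * degree w)"
      using \<open>w \<noteq> 0\<close> \<open>u \<noteq> 0\<close> by (simp add: degree_power_eq)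
    then show False by presburger
  qed
  show "u = 0" using assms by (simp add: w)
qed

text \<open>The vanishing of \<open>E\<close> survives both moves of the proof: the radical shift of
  vector 0 fixes every B, and the auxiliary point from \<open>cdet_nonzero\<close> has all B_0j =
  0.\<close>

lemma one_GenD_independent:
  fixes P0 P1 :: "(gen \<Rightarrow> 'k::alg_closed_field) \<Rightarrow> 'k"
  assumes c2: "(2::'k) = 0"
    and P: "P0 \<in> pfun (qbgens (2 * \<nu> + 1))" "P1 \<in> pfun (qbgens (2 * \<nu> + 1))"
    and E: "E \<subseteq> {GenB 0 j | j. 0 < j \<and> j < 2 * \<nu> + 1}"
    and 0: "\<And>M. (\<And>g. g \<in> E \<Longrightarrow> gval \<nu> M g = 0) \<Longrightarrow>
      P0 (gval \<nu> M) + P1 (gval \<nu> M) * gval \<nu> M GenD = 0"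
    and \<sigma>: "\<And>g. g \<in> E \<Longrightarrow> \<sigma> g = 0"
  shows "P0 \<sigma> = 0 \<and> P1 \<sigma> = 0"
proof -
  note inf = infinite_alg_closed[where 'k = 'k]
  have EQ: "E \<subseteq> qbgens (2 * \<nu> + 1)" using E by auto
  have generic: "P0 \<sigma> = 0 \<and> P1 \<sigma> = 0"
    if c: "cdet \<nu> \<sigma> \<noteq> 0" and \<sigma>: "\<And>g. g \<in> E \<Longrightarrow> \<sigma> g = 0" for \<sigma>
  proof -
    obtain M where M: "\<And>g. g \<in> qbgens (2 * \<nu> + 1) \<Longrightarrow> gval \<nu> M g = \<sigma> g"
      using realize_gval[OF c2] by blast
    define q where "q = \<sigma> (GenQ 0)"
    define M' where "M' r = M((2 * \<nu>, 0) := M (2 * \<nu>, 0) + r)" for r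
    have M': "gval \<nu> (M' r) g = (\<sigma>(GenQ 0 := q + r\<^sup>2)) g" if "g \<in> qbgens (2 * \<nu> + 1)" for r g
      using gval_shift(1)[OF c2 that, of M r] M[OF that] M[of "GenQ 0"]
      by (auto simp: M'_def q_def)
    have "cdet \<nu> (gval \<nu> M) \<noteq> 0" using c pfun_cong[OF cdet_pfun M] by simp
    then obtain d D where d: "d \<noteq> 0" "\<And>r. gval \<nu> (M' r) GenD = D + r * d"
      using gval_shift(2)[OF c2, of \<nu> M] unfolding M'_def by blast
    obtain p0 where p0: "\<And>s. P0 (\<sigma>(GenQ 0 := s)) = poly p0 s" using pfun_one_var[OF P(1)] by blast
    obtain p1 where p1: "\<And>s. P1 (\<sigma>(GenQ 0 := s)) = poly p1 s" using pfun_one_var[OF P(2)] by blast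
    have eq: "poly p0 (q + r\<^sup>2) + poly p1 (q + r\<^sup>2) * (D + r * d) = 0" for r
    proof -
      have "gval \<nu> (M' r) g = 0" if "g \<in> E" for g
        using that E EQ \<sigma>[OF that] M'[of g r] by auto
      from 0[OF this] have "P0 (gval \<nu> (M' r)) + P1 (gval \<nu> (M' r)) * (D + r * d) = 0"
        by (simp only: d(2))
      moreover have "P0 (gval \<nu> (M' r)) = P0 (\<sigma>(GenQ 0 := q + r\<^sup>2))"
        by (rule pfun_cong[OF P(1)]) (rule M')
      moreover have "P1 (gval \<nu> (M' r)) = P1 (\<sigma>(GenQ 0 := q + r\<^sup>2))"
        by (rule pfun_cong[OF P(2)]) (rule M')
      ultimately show ?thesis by (simp only: p0 p1)
    qed
    \<comment> \<open>With s = q + r^2 the identity says p0(s) + D p1(s) = - r d p1(s). Squaring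
      turns r into r^2 = s - q, and every s occurs because square roots exist.\<close>
    have "(p0 + Polynomial.smult D p1)\<^sup>2 = [:- q, 1:] * (Polynomial.smult d p1)\<^sup>2" (is "?l = ?r")
    proof -
      have "poly (?l - ?r) s = 0" for s
      proof -
        obtain r where r: "r\<^sup>2 = s - q" using square_root_exists by blast
        have "poly p0 s + D * poly p1 s = - (r * (d * poly p1 s))"
          using eq[of r] unfolding eq_neg_iff_add_eq_0 by (simp add: r algebra_simps)
        then have "(poly p0 s + D * poly p1 s)\<^sup>2 = r\<^sup>2 * (d * poly p1 s)\<^sup>2"
          by (simp add: power_mult_distrib)
        then show ?thesis by (simp add: r algebra_simps)
      qed
      then show ?thesis using poly_zero_infinite[OF inf, of "?l - ?r"] by simp
    qed
    from square_eq_linear_times_square[OF this] d(1) have "p1 = 0" "p0 = 0" by auto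
    then show ?thesis using p0[of q] p1[of q] by (simp add: q_def)
  qed
  obtain \<tau> :: "gen \<Rightarrow> 'k" where \<tau>: "cdet \<nu> \<tau> \<noteq> 0" "\<And>j. \<tau> (GenB 0 j) = 0"
    using cdet_nonzero by blast
  \<comment> \<open>The line from \<sigma> to \<tau> stays in the locus given by \<open>E\<close>
    and meets the zero set of \<open>cdet\<close> in finitely many points only, so the generic case
    determines the value at \<sigma>.\<close>
  define l where "l t = (\<lambda>g. \<sigma> g + t * (\<tau> g - \<sigma> g))" for t
  have lE: "l t g = 0" if "g \<in> E" for t g using that E \<tau>(2) \<sigma>[OF that] by (auto simp: l_def)
  obtain pc where pc: "\<And>t. cdet \<nu> (l t) = poly pc t" using pfun_line[OF cdet_pfun] unfolding l_def by blast
  have "l 1 = \<tau>" "l 0 = \<sigma>" by (simp_all add: l_def)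
  then have "pc \<noteq> 0" using pc[of 1] \<tau>(1) by auto
  have "P \<sigma> = 0" if P: "P \<in> pfun (qbgens (2 * \<nu> + 1))"
    and gen: "\<And>\<sigma>. cdet \<nu> \<sigma> \<noteq> 0 \<Longrightarrow> (\<And>g. g \<in> E \<Longrightarrow> \<sigma> g = 0) \<Longrightarrow> P \<sigma> = 0" for P
  proof -
    obtain p where p: "\<And>t. P (l t) = poly p t" using pfun_line[OF P] unfolding l_def by blast
    have "poly (pc * p) t = 0" for t using gen[of "l t"] lE by (auto simp flip: pc p)
    then have "p = 0" using poly_zero_infinite[OF inf, of "pc * p"] \<open>pc \<noteq> 0\<close> by auto
    then show ?thesis using p[of 0] \<open>l 0 = \<sigma>\<close> by simp
  qed
  then show ?thesis using P generic by blast
qed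

subsection \<open>Two vectors in a hyperbolic plane\<close>

definition pgens :: "gen set" where
  "pgens = {GenQ 0, GenQ 1, GenB 0 1}"

text \<open>The value at \<open>GenD\<close> is a root of \<open>u\<^sup>2 - B u + Q\<^sub>0 Q\<^sub>1\<close>, the other root being its image
  under the swap of the two isotropic lines.\<close>

fun pval :: "(nat \<times> nat \<Rightarrow> 'a::comm_ring_1) \<Rightarrow> gen \<Rightarrow> 'a" where
  "pval V (GenQ i) = V (0, i) * V (1, i)"
| "pval V (GenB i j) = V (0, i) * V (1, j) + V (1, i) * V (0, j)"
| "pval V GenD = V (0, 0) * V (1, 1)"

definition pmk :: "'a \<Rightarrow> 'a \<Rightarrow> 'a \<Rightarrow> 'a \<Rightarrow> nat \<times> nat \<Rightarrow> 'a" where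
  "pmk a b c d = (\<lambda>(k, i). if i = 0 then if k = 0 then a else b else if k = 0 then c else d)"

lemma pmk_simps [simp]:
  "pmk a b c d (0, 0) = a" "pmk a b c d (Suc 0, 0) = b"
  "pmk a b c d (0, Suc 0) = c" "pmk a b c d (Suc 0, Suc 0) = d"
  by (simp_all add: pmk_def)

lemma plane_coords: "{..<2} \<times> {..<2} = {(0, 0), (1, 0), (0, 1), (1, 1) :: nat \<times> nat}"
  by (auto simp: less_2_cases_iff)

lemma pval_pfun: "g \<in> insert GenD pgens \<Longrightarrow> (\<lambda>V. pval V g) \<in> pfun ({..<2} \<times> {..<2})"
  unfolding pfun_def plane_coords
  by (auto simp: pgens_def intro!: falg.add falg.mult intro: falg.gen)

text \<open>Divides by Q_0. The remainder of \<open>P\<close> at Q_0 = 0 vanishes because pairs with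
  isotropic first vector realise all values of Q_1 and B_01 as long as B_01 \<noteq> 0.\<close>

lemma plane_strip:
  fixes \<psi> :: "(nat \<times> nat \<Rightarrow> 'k::field) \<Rightarrow> 'k"
  assumes inf: "infinite (UNIV :: 'k set)" and \<psi>: "\<psi> \<in> pfun ({..<2} \<times> {..<2})"
    and "P \<in> pfun pgens" "\<And>V. pval V (GenQ 0) ^ N * \<psi> V = P (pval V)"
  shows "\<exists>P\<in>pfun pgens. \<forall>V. \<psi> V = P (pval V)"
  using assms(3,4)
proof (induction N arbitrary: P)
  case 0
  then show ?case by auto
next
  case (Suc N)
  obtain P' where P': "P' \<in> pfun pgens" "\<And>\<sigma>. P \<sigma> = P (\<sigma>(GenQ 0 := 0)) + \<sigma> (GenQ 0) * P' \<sigma>"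
    using pfun_split_var[OF Suc.prems(1)] by blast
  define R where "R \<sigma> = P (\<sigma>(GenQ 0 := 0))" for \<sigma>
  have R: "R \<in> pfun pgens"
    unfolding R_def[abs_def] using pfun_mono[OF _ pfun_subst_zero[OF Suc.prems(1)]] by blast
  have "\<sigma> (GenB 0 1) * R \<sigma> = 0" for \<sigma>
  proof (cases "\<sigma> (GenB 0 1) = 0")
    case False
    let ?B = "\<sigma> (GenB 0 1)"
    \<comment> \<open>The vectors (0, 1) and (B, Q_1 / B): the first is isotropic, and Q_1 and B_01
      take the values given by \<sigma>.\<close>
    let ?V = "pmk 0 1 ?B (\<sigma> (GenQ 1) / ?B)"
    have "P (pval ?V) = P (\<sigma>(GenQ 0 := 0))"
      by (rule pfun_cong[OF Suc.prems(1)]) (use False in \<open>auto simp: pgens_def\<close>)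
    moreover have "P (pval ?V) = 0" by (subst Suc.prems(2)[symmetric]) simp
    ultimately show ?thesis by (simp add: R_def)
  qed simp
  from pfun_no_zero_divisors[OF inf R pfun_var this, of "\<lambda>_. 1"]
  have R0: "R \<sigma> = 0" for \<sigma> by (simp add: pgens_def)
  have "pval V (GenQ 0) * (pval V (GenQ 0) ^ N * \<psi> V - P' (pval V)) = 0" for V
    using Suc.prems(2)[of V] P'(2)[of "pval V"] R0[of "pval V"]
    by (simp add: R_def algebra_simps del: pval.simps)
  moreover have "(\<lambda>V. pval V (GenQ 0) ^ N * \<psi> V - P' (pval V)) \<in> pfun ({..<2} \<times> {..<2})"
    using \<psi> unfolding pfun_def[of "{..<2} \<times> {..<2}"]
    by (intro falg_diff falg.mult falg_power pfun_pullback[OF P'(1)] pval_pfun[unfolded pfun_def])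
      (simp_all add: pgens_def)
  moreover have "(\<lambda>V. pval V (GenQ 0)) \<in> pfun ({..<2} \<times> {..<2})"
    by (rule pval_pfun) (simp add: pgens_def)
  ultimately have "pval V (GenQ 0) ^ N * \<psi> V - P' (pval V) = 0" for V
    using pfun_no_zero_divisors[OF inf, of "\<lambda>V. pval V (GenQ 0) ^ N * \<psi> V - P' (pval V)" _
        "\<lambda>V. pval V (GenQ 0)" "\<lambda>_. 1" V] by simp
  then show ?case by (intro Suc.IH[OF P'(1)]) simp
qed

text \<open>Scaling the two isotropic lines inversely brings a generic pair to \<open>rep V\<close>,
  which expresses \<psi> by Q_0, Q_1, B_01 and the root u = \<open>pval V GenD\<close>, with powers
  of Q_0 as denominators. In the reduced form P0 + P1 u the swap of the two lines sends u to B_01 -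
  u, and this forces P1 to vanish.\<close>

lemma plane_invariants:
  fixes \<psi> :: "(nat \<times> nat \<Rightarrow> 'k::field) \<Rightarrow> 'k"
  assumes c2: "(2::'k) = 0" and inf: "infinite (UNIV :: 'k set)"
    and \<psi>: "\<psi> \<in> pfun ({..<2} \<times> {..<2})"
    and inv: "\<And>V V'. (\<And>g. g \<in> pgens \<Longrightarrow> pval V g = pval V' g) \<Longrightarrow> pval V (GenB 0 1) \<noteq> 0 \<Longrightarrow> \<psi> V = \<psi> V'"
  shows "\<psi> \<in> falg ((\<lambda>g V. pval V g) ` pgens)"
proof -
  let ?C = "{..<2} \<times> {..<2} :: (nat \<times> nat) set"
  let ?G = "(\<lambda>g V. pval V g) ` insert GenD pgens :: ((nat \<times> nat \<Rightarrow> 'k) \<Rightarrow> 'k) set"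
  define good where "good V \<longleftrightarrow> V (0, 0) \<noteq> 0 \<and> V (1, 0) \<noteq> 0 \<and> pval V (GenB 0 1) \<noteq> 0" for V :: "nat \<times> nat \<Rightarrow> 'k"
  \<comment> \<open>For vectors (x0, y0) and (x1, y1) the scaling by 1 / x0 and x0 gives (1, Q_0)
    and (x1 / x0, u) with u = x0 y1.\<close>
  define rep where "rep V = pmk 1 (pval V (GenQ 0)) (V (0, 1) / V (0, 0)) (pval V GenD)" for V :: "nat \<times> nat \<Rightarrow> 'k"
  have G: "(\<lambda>V. pval V g) \<in> falg ?G" if "g \<in> insert GenD pgens" for g
    using that by (intro falg.gen) auto
  have "\<exists>N. \<exists>f'\<in>falg ?G. \<forall>X V. good V \<and> X = rep V \<longrightarrow> pval V (GenQ 0) ^ N * \<psi> X = f' V"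
  proof (rule falg_clear_denominators[OF \<psi>[unfolded pfun_def] G])
    fix g :: "(nat \<times> nat \<Rightarrow> 'k) \<Rightarrow> 'k" assume "g \<in> (\<lambda>v \<sigma>. \<sigma> v) ` ?C"
    then consider "g = (\<lambda>\<sigma>. \<sigma> (0, 0))" | "g = (\<lambda>\<sigma>. \<sigma> (1, 0))" | "g = (\<lambda>\<sigma>. \<sigma> (0, 1))" | "g = (\<lambda>\<sigma>. \<sigma> (1, 1))"
      unfolding plane_coords by auto
    then show "\<exists>N. \<exists>g'\<in>falg ?G. \<forall>X V. good V \<and> X = rep V \<longrightarrow> pval V (GenQ 0) ^ N * g X = g' V"
    proof cases
      case 1
      then show ?thesis
        by (intro exI[of _ 0] bexI[of _ "\<lambda>_. 1"]) (auto simp: rep_def intro: falg.const)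
    next
      case 2
      then show ?thesis
        by (intro exI[of _ 0] bexI[of _ "\<lambda>V. pval V (GenQ 0)"] G) (auto simp: rep_def pgens_def)
    next
      case 3
      \<comment> \<open>The only entry with a denominator: Q_0 (x1 / x0) = y0 x1 = B_01 - u.\<close>
      have "(\<lambda>V. pval V (GenB 0 1) - pval V GenD) \<in> falg ?G"
        by (intro falg_diff G) (auto simp: pgens_def)
      then show ?thesis using 3
        by (intro exI[of _ 1] bexI[of _ "\<lambda>V. pval V (GenB 0 1) - pval V GenD"])
          (auto simp: rep_def good_def)
    next
      case 4
      then show ?thesis
        by (intro exI[of _ 0] bexI[of _ "\<lambda>V. pval V GenD"] G) (auto simp: rep_def pgens_def)
    qed
  qed (simp add: pgens_def)
  then obtain N f' where f': "f' \<in> falg ?G" "\<And>V. good V \<Longrightarrow> pval V (GenQ 0) ^ N * \<psi> (rep V) = f' V"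
    by blast
  have rep: "\<psi> (rep V) = \<psi> V" if "good V" for V
    by (rule inv) (use that in \<open>auto simp: rep_def pgens_def good_def field_simps\<close>)
  obtain P where P: "P \<in> pfun (insert GenD pgens)" "f' = (\<lambda>V. P (pval V))"
    using falg_factor[OF f'(1)] by blast
  have "\<exists>P0\<in>pfun pgens. \<exists>P1\<in>pfun pgens. \<forall>\<sigma>.
      (\<sigma> GenD)\<^sup>2 = - (\<sigma> (GenQ 0) * \<sigma> (GenQ 1)) + \<sigma> (GenB 0 1) * \<sigma> GenD \<longrightarrow> P \<sigma> = P0 \<sigma> + P1 \<sigma> * \<sigma> GenD"
    by (rule pfun_quadratic_normal_form[OF P(1)])
      (auto simp: pfun_def pgens_def intro!: falg_uminus falg.mult intro: falg.gen)
  then obtain P0 P1 where P01: "P0 \<in> pfun pgens" "P1 \<in> pfun pgens"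
    and "\<And>\<sigma>. (\<sigma> GenD)\<^sup>2 = - (\<sigma> (GenQ 0) * \<sigma> (GenQ 1)) + \<sigma> (GenB 0 1) * \<sigma> GenD
      \<Longrightarrow> P \<sigma> = P0 \<sigma> + P1 \<sigma> * \<sigma> GenD" by blast
  from this(3)[of "pval _"] have P': "P (pval V) = P0 (pval V) + P1 (pval V) * pval V GenD" for V
    by (simp add: algebra_simps power2_eq_square)
  have eq: "pval V (GenQ 0) ^ N * \<psi> V = P0 (pval V)" if V: "good V" for V
  proof -
    \<comment> \<open>The same pair with its two isotropic lines exchanged.\<close>
    let ?V' = "pmk (V (1, 0)) (V (0, 0)) (V (1, 1)) (V (0, 1))"
    have same: "pval V g = pval ?V' g" if "g \<in> pgens" for g
      using that by (auto simp: pgens_def)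
    have "good ?V'" using V by (auto simp: good_def add.commute)
    have e: "pval W (GenQ 0) ^ N * \<psi> W = P0 (pval W) + P1 (pval W) * pval W GenD" if "good W" for W
      using f'(2)[OF that] rep[OF that] P' P(2) by simp
    have "P0 (pval V) + P1 (pval V) * pval V GenD = P0 (pval V) + P1 (pval V) * pval ?V' GenD"
    proof -
      have "P0 (pval V) = P0 (pval ?V')" "P1 (pval V) = P1 (pval ?V')"
        by (rule pfun_cong[OF P01(1) same] pfun_cong[OF P01(2) same], assumption)+
      moreover have "\<psi> V = \<psi> ?V'" by (rule inv[OF same]) (use V in \<open>auto simp: good_def\<close>)
      moreover have "pval V (GenQ 0) = pval ?V' (GenQ 0)" by (rule same) (simp add: pgens_def)
      ultimately show ?thesis using e[OF V] e[OF \<open>good ?V'\<close>] by (simp del: pval.simps)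
    qed
    then have "P1 (pval V) * (pval V GenD - pval ?V' GenD) = 0" by (simp add: algebra_simps)
    \<comment> \<open>The two roots add up to B_01, so in characteristic 2 they also differ by
      it.\<close>
    moreover have "pval V GenD - pval ?V' GenD = pval V (GenB 0 1)"
      unfolding char2_simps(3)[OF c2, of "pval V GenD"] by simp
    ultimately have "P1 (pval V) * pval V (GenB 0 1) = 0" by (simp only:)
    then have "P1 (pval V) = 0" using V by (simp add: good_def del: pval.simps)
    then show ?thesis using e[OF V] by simp
  qed
  have "pval V (GenQ 0) ^ N * \<psi> V = P0 (pval V)" for V
  proof -
    have "(\<lambda>V. pval V (GenQ 0) ^ N * \<psi> V - P0 (pval V)) \<in> pfun ?C"
      using \<psi> unfolding pfun_def[of ?C]
      by (intro falg_diff falg.mult falg_power pfun_pullback[OF P01(1)] pval_pfun[unfolded pfun_def])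
        (simp_all add: pgens_def)
    moreover have "(\<lambda>V. pval V (GenQ 0) * pval V (GenB 0 1)) \<in> pfun ?C"
      unfolding pfun_def
      by (intro falg.mult pval_pfun[unfolded pfun_def]) (simp_all add: pgens_def)
    moreover have "(pval V (GenQ 0) * pval V (GenB 0 1)) *
        (pval V (GenQ 0) ^ N * \<psi> V - P0 (pval V)) = 0" for V
      using eq[of V] by (auto simp: good_def)
    moreover have "pval (pmk 1 1 0 1) (GenQ 0) * pval (pmk 1 1 0 1) (GenB 0 1) \<noteq> (0::'k)" by simp
    ultimately have "pval V (GenQ 0) ^ N * \<psi> V - P0 (pval V) = 0"
      by (rule pfun_no_zero_divisors[OF inf, of "\<lambda>V. pval V (GenQ 0) ^ N * \<psi> V - P0 (pval V)" ?C
            "\<lambda>V. pval V (GenQ 0) * pval V (GenB 0 1)" "pmk 1 1 0 1" V])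
    then show ?thesis by simp
  qed
  from plane_strip[OF inf \<psi> P01(1) this]
  obtain P where "P \<in> pfun pgens" "\<psi> = (\<lambda>V. P (pval V))" by auto
  then show ?thesis by (simp only:) (rule pfun_pullback[of P pgens], auto intro: falg.gen)
qed

subsection \<open>Division by the first polar invariant\<close>

text \<open>On the locus B_01 = 0 the normal form P0 + P1 D vanishes, and independence with B_01 as
  the only member of \<open>E\<close> makes both remainders vanish, not just their combination.
  \<nu> > 0 provides the vector with index 1.\<close>

lemma polar_strip:
  fixes f :: "(nat \<times> nat \<Rightarrow> 'k::alg_closed_field) \<Rightarrow> 'k"
  assumes c2: "(2::'k) = 0" and \<nu>: "\<nu> > 0"
    and f: "f \<in> pfun ({..<2 * \<nu> + 1} \<times> {..<2 * \<nu> + 1})"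
    and "P \<in> pfun (gens (2 * \<nu> + 1))" "\<And>M. gval \<nu> M (GenB 0 1) ^ N * f M = P (gval \<nu> M)"
  shows "\<exists>P\<in>pfun (gens (2 * \<nu> + 1)). \<forall>M. f M = P (gval \<nu> M)"
  using assms(4,5)
proof (induction N arbitrary: P)
  case 0
  then show ?case by auto
next
  case (Suc N)
  let ?n = "2 * \<nu> + 1"
  let ?C = "{..<?n} \<times> {..<?n}"
  note inf = infinite_alg_closed[where 'k = 'k]
  have b: "GenB 0 1 \<in> qbgens ?n" using \<nu> by simp
  have H: "(\<lambda>\<sigma>. peval \<sigma> (hdisc ?n)) \<in> pfun (qbgens ?n)" by (rule peval_pfun[OF hdisc_in])
  have "\<exists>P0\<in>pfun (qbgens ?n). \<exists>P1\<in>pfun (qbgens ?n). \<forall>\<sigma>.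
      (\<sigma> GenD)\<^sup>2 = peval \<sigma> (hdisc ?n) + 0 * \<sigma> GenD \<longrightarrow> P \<sigma> = P0 \<sigma> + P1 \<sigma> * \<sigma> GenD"
    using Suc.prems(1) unfolding gens_eq
    by (rule pfun_quadratic_normal_form[OF _ H]) (simp add: pfun_def falg.const)
  then obtain P0 P1 where P01: "P0 \<in> pfun (qbgens ?n)" "P1 \<in> pfun (qbgens ?n)"
    and P: "\<And>M. P (gval \<nu> M) = P0 (gval \<nu> M) + P1 (gval \<nu> M) * gval \<nu> M GenD"
    using hdisc_gval[OF c2, of \<nu>] by (auto simp del: gval.simps)
  obtain P0' where P0': "P0' \<in> pfun (qbgens ?n)"
      "\<And>\<sigma>. P0 \<sigma> = P0 (\<sigma>(GenB 0 1 := 0)) + \<sigma> (GenB 0 1) * P0' \<sigma>"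
    using pfun_split_var[OF P01(1)] by blast
  obtain P1' where P1': "P1' \<in> pfun (qbgens ?n)"
      "\<And>\<sigma>. P1 \<sigma> = P1 (\<sigma>(GenB 0 1 := 0)) + \<sigma> (GenB 0 1) * P1' \<sigma>"
    using pfun_split_var[OF P01(2)] by blast
  have z: "P0 (\<sigma>(GenB 0 1 := 0)) = 0 \<and> P1 (\<sigma>(GenB 0 1 := 0)) = 0" for \<sigma>
  proof (rule one_GenD_independent[OF c2 P01, of "{GenB 0 1}"])
    fix M :: "nat \<times> nat \<Rightarrow> 'k" assume "\<And>g. g \<in> {GenB 0 1} \<Longrightarrow> gval \<nu> M g = 0"
    then have "gval \<nu> M (GenB 0 1) = 0" by blast
    then have "P (gval \<nu> M) = 0" by (subst Suc.prems(2)[symmetric]) (simp del: gval.simps)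
    then show "P0 (gval \<nu> M) + P1 (gval \<nu> M) * gval \<nu> M GenD = 0" by (simp only: P)
  qed (use \<nu> in auto)
  define P' where "P' \<sigma> = P0' \<sigma> + P1' \<sigma> * \<sigma> GenD" for \<sigma>
  have P': "P' \<in> pfun (gens ?n)"
  proof -
    have "P0' \<in> pfun (gens ?n)" "P1' \<in> pfun (gens ?n)" "(\<lambda>\<sigma>. \<sigma> GenD) \<in> (pfun (gens ?n) :: ((gen \<Rightarrow> 'k) \<Rightarrow> 'k) set)"
      using P0'(1) P1'(1) pfun_mono[of "qbgens ?n" "gens ?n"] pfun_var[of GenD "gens ?n"]
      by (auto simp: gens_eq)
    then show ?thesis unfolding P'_def[abs_def] pfun_def by (intro falg.add falg.mult)
  qed
  have "gval \<nu> M (GenB 0 1) * (gval \<nu> M (GenB 0 1) ^ N * f M - P' (gval \<nu> M)) = 0" for M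
    using Suc.prems(2)[of M] P[of M] P0'(2)[of "gval \<nu> M"] P1'(2)[of "gval \<nu> M"] z[of "gval \<nu> M"]
    by (simp add: P'_def algebra_simps del: gval.simps)
  moreover have "(\<lambda>M. gval \<nu> M (GenB 0 1) ^ N * f M - P' (gval \<nu> M)) \<in> pfun ?C"
    using f b unfolding pfun_def[of ?C]
    by (intro falg_diff falg.mult falg_power pfun_pullback[OF P'] gval_pfun[unfolded pfun_def])
      (simp_all add: gens_eq)
  moreover have "(\<lambda>M. gval \<nu> M (GenB 0 1)) \<in> pfun ?C"
    by (rule gval_pfun) (use b in \<open>simp add: gens_eq\<close>)
  moreover obtain M1 :: "nat \<times> nat \<Rightarrow> 'k" where "gval \<nu> M1 (GenB 0 1) = 1"
    using realize_gval[OF c2, of \<nu> "\<lambda>_. 1"] b by blast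
  ultimately have "gval \<nu> M (GenB 0 1) ^ N * f M - P' (gval \<nu> M) = 0" for M
    using pfun_no_zero_divisors[OF inf, of "\<lambda>M. gval \<nu> M (GenB 0 1) ^ N * f M - P' (gval \<nu> M)" ?C
        "\<lambda>M. gval \<nu> M (GenB 0 1)" M1 M] by (simp del: gval.simps)
  then show ?case by (intro Suc.IH[OF P']) simp
qed

section \<open>The invariants as functions\<close>

text \<open>This stands in for invariance under the orthogonal group, see \<open>orthogonal_transitive\<close>
  below.\<close>

definition gram_invariant :: "nat \<Rightarrow> ((nat \<times> nat \<Rightarrow> 'a::comm_ring_1) \<Rightarrow> 'a) \<Rightarrow> bool" where
  "gram_invariant \<nu> f \<longleftrightarrow> (\<forall>M M'. (\<forall>g\<in>gens (2 * \<nu> + 1). gval \<nu> M g = gval \<nu> M' g) \<longrightarrow>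
     gval \<nu> M GenD \<noteq> 0 \<longrightarrow> f M = f M')"

text \<open>The tuple with vectors \<open>v\<^sub>0, v\<^sub>1\<close> in the first hyperbolic plane, given by \<open>V\<close>, and
  vectors \<open>v\<^sub>i = \<tau>\<^sub>0\<^sub>i v\<^sub>0 + \<tau>\<^sub>1\<^sub>i v\<^sub>1 + w\<^sub>i\<close> with \<open>w\<^sub>i\<close> in its orthogonal complement,
  given by \<open>W\<close>.\<close>

definition coef :: "(nat \<times> nat \<Rightarrow> 'a::comm_ring_1) \<Rightarrow> nat \<Rightarrow> nat \<Rightarrow> 'a" where
  "coef \<tau> k i = (if i < 2 then if i = k then 1 else 0 else \<tau> (k, i))"

definition slice :: "(nat \<times> nat \<Rightarrow> 'a::comm_ring_1) \<Rightarrow> (nat \<times> nat \<Rightarrow> 'a) \<Rightarrow> (nat \<times> nat \<Rightarrow> 'a) \<Rightarrow>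
    nat \<times> nat \<Rightarrow> 'a" where
  "slice V \<tau> W = (\<lambda>(c, i). glue (\<lambda>c. coef \<tau> 0 i * V (c, 0) + coef \<tau> 1 i * V (c, 1))
     (\<lambda>c. if i < 2 then 0 else W (c, i - 2)) c)"

section \<open>Invariants of tuples in slice form\<close>

lemma hquad_slice:
  fixes V :: "nat \<times> nat \<Rightarrow> 'a::comm_ring_1"
  shows "hquad (Suc \<nu>) (\<lambda>c. slice V \<tau> W (c, i)) =
    (coef \<tau> 0 i)\<^sup>2 * pval V (GenQ 0) + (coef \<tau> 1 i)\<^sup>2 * pval V (GenQ 1) +
    coef \<tau> 0 i * coef \<tau> 1 i * pval V (GenB 0 1) + (if i < 2 then 0 else gval \<nu> W (GenQ (i - 2)))"
proof -
  have "hquad \<nu> (\<lambda>_. 0) = (0::'a)" by (simp add: hquad_def)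
  then show ?thesis
    by (simp add: slice_def hquad_glue algebra_simps power2_eq_square)
qed

lemma hpolar_slice:
  fixes V :: "nat \<times> nat \<Rightarrow> 'k::comm_ring_1"
  assumes c2: "(2::'k) = 0"
  shows "hpolar (Suc \<nu>) (\<lambda>c. slice V \<tau> W (c, i)) (\<lambda>c. slice V \<tau> W (c, j)) =
    (coef \<tau> 0 i * coef \<tau> 1 j + coef \<tau> 1 i * coef \<tau> 0 j) * pval V (GenB 0 1) +
    (if i < 2 \<or> j < 2 then 0 else gval \<nu> W (GenB (i - 2) (j - 2)))"
proof -
  have z: "hpolar \<nu> (\<lambda>_. 0) v = 0" "hpolar \<nu> v (\<lambda>_. 0) = 0" for v :: "nat \<Rightarrow> 'k"
    by (simp_all add: hpolar_def)
  let ?x = "coef \<tau> 0 i * coef \<tau> 0 j * V (0, 0) * V (1, 0) + coef \<tau> 1 i * coef \<tau> 1 j * V (0, 1) * V (1, 1)"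
  have "(coef \<tau> 0 i * V (0, 0) + coef \<tau> 1 i * V (0, 1)) * (coef \<tau> 0 j * V (1, 0) + coef \<tau> 1 j * V (1, 1)) +
      (coef \<tau> 0 i * V (1, 0) + coef \<tau> 1 i * V (1, 1)) * (coef \<tau> 0 j * V (0, 0) + coef \<tau> 1 j * V (0, 1)) =
      (coef \<tau> 0 i * coef \<tau> 1 j + coef \<tau> 1 i * coef \<tau> 0 j) * pval V (GenB 0 1) + 2 * ?x"
    by (simp add: algebra_simps)
  also have "2 * ?x = 0" unfolding c2 by simp
  finally show ?thesis by (simp add: slice_def hpolar_glue z del: pval.simps)
qed

text \<open>The first two vectors have no coordinates outside the plane, so the matrix is block
  upper triangular and \<tau> enters only the off-diagonal block. The block of \<open>V\<close> has
  determinant B_01 because signs disappear.\<close>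

lemma GenD_slice:
  fixes V :: "nat \<times> nat \<Rightarrow> 'k::field"
  assumes c2: "(2::'k) = 0"
  shows "gval (Suc \<nu>) (slice V \<tau> W) GenD = pval V (GenB 0 1) * gval \<nu> W GenD"
proof -
  let ?n = "2 * \<nu> + 1"
  let ?P = "mat 2 ?n (\<lambda>(c, i). slice V \<tau> W (c, i + 2))"
  have "mat (2 * Suc \<nu> + 1) (2 * Suc \<nu> + 1) (slice V \<tau> W) =
      four_block_mat (mat 2 2 V) ?P (0\<^sub>m ?n 2) (mat ?n ?n W)"
  proof (rule eq_matI, goal_cases)
    case (1 i j)
    show ?case
    proof (cases "j < 2")
      case True
      then show ?thesis using 1 by (auto simp: slice_def glue_def coef_def less_2_cases_iff)
    next
      case False
      then obtain k where "j = k + 2" using le_iff_add[of 2 j] by auto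
      then show ?thesis using 1 by (simp add: slice_def glue_def coef_def)
    qed
  qed simp_all
  moreover have "det (four_block_mat (mat 2 2 V) ?P (0\<^sub>m ?n 2) (mat ?n ?n W)) =
      det (mat 2 2 V) * det (mat ?n ?n W)"
    by (rule det_four_block_mat_lower_left_zero) auto
  moreover have "det (mat 2 2 V) = pval V (GenB 0 1)"
    by (subst laplace_expansion_column[of _ 2 0])
      (simp_all add: numeral_2_eq_2 cofactor_def mat_delete_def det_single char2_simps(3)[OF c2]
        char2_simps(2)[OF c2] mult.commute)
  ultimately show ?thesis by simp
qed

text \<open>For fixed \<tau> this lets invariance on whole tuples be used for \<open>W\<close> with
  \<open>V\<close> fixed and for \<open>V\<close> with \<open>W\<close> fixed.\<close>

lemma gval_slice_cong:
  fixes V :: "nat \<times> nat \<Rightarrow> 'k::field"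
  assumes c2: "(2::'k) = 0"
    and V: "\<And>g. g \<in> pgens \<Longrightarrow> pval V g = pval V' g"
    and W: "\<And>g. g \<in> gens (2 * \<nu> + 1) \<Longrightarrow> gval \<nu> W g = gval \<nu> W' g"
    and g: "g \<in> gens (2 * Suc \<nu> + 1)"
  shows "gval (Suc \<nu>) (slice V \<tau> W) g = gval (Suc \<nu>) (slice V' \<tau> W') g"
proof (cases g)
  case (GenQ i)
  have "pval V (GenQ 0) = pval V' (GenQ 0)" "pval V (GenQ 1) = pval V' (GenQ 1)"
    "pval V (GenB 0 1) = pval V' (GenB 0 1)" by (rule V; simp add: pgens_def)+
  moreover have "gval \<nu> W (GenQ (i - 2)) = gval \<nu> W' (GenQ (i - 2))" if "\<not> i < 2"
    by (rule W) (use that g GenQ in \<open>auto simp: gens_eq\<close>)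
  ultimately show ?thesis
    unfolding GenQ gval.simps(1)[of "Suc \<nu>"] hquad_slice by simp
next
  case (GenB i j)
  have "pval V (GenB 0 1) = pval V' (GenB 0 1)" by (rule V; simp add: pgens_def)+
  moreover have "gval \<nu> W (GenB (i - 2) (j - 2)) = gval \<nu> W' (GenB (i - 2) (j - 2))" if "\<not> (i < 2 \<or> j < 2)"
    by (rule W) (use that g GenB in \<open>auto simp: gens_eq\<close>)
  ultimately show ?thesis
    unfolding GenB gval.simps(2)[of "Suc \<nu>"] hpolar_slice[OF c2] by simp
next
  case GenD
  have "pval V (GenB 0 1) = pval V' (GenB 0 1)" by (rule V; simp add: pgens_def)+
  moreover have "gval \<nu> W GenD = gval \<nu> W' GenD" by (rule W) (simp add: gens_eq)
  ultimately show ?thesis unfolding GenD GenD_slice[OF c2] by simp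
qed

text \<open>Orthogonal projection to the plane of the first two vectors, carried out on the values
  of Q and B: these determine the coefficients, and \<open>W\<close> realises what remains. D agrees
  as well because Q and B determine it.\<close>

lemma slice_exists:
  fixes M :: "nat \<times> nat \<Rightarrow> 'k::alg_closed_field"
  assumes c2: "(2::'k) = 0" and b: "gval (Suc \<nu>) M (GenB 0 1) \<noteq> 0"
  shows "\<exists>V \<tau> W. \<forall>g\<in>gens (2 * Suc \<nu> + 1). gval (Suc \<nu>) (slice V \<tau> W) g = gval (Suc \<nu>) M g"
proof -
  let ?g = "gval (Suc \<nu>) M"
  define b where "b = ?g (GenB 0 1)"
  have b0: "b \<noteq> 0" using assms(2) by (simp add: b_def)
  obtain c d where cd: "c * d = ?g (GenQ 1)" "d + ?g (GenQ 0) * c = b"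
    using plane_realize[OF b0] by blast
  define V where "V = pmk 1 (?g (GenQ 0)) c d"
  \<comment> \<open>The indices cross over: pairing the i-th vector with v_1 gives b times the
    coefficient of v_0, as v_1 is orthogonal to itself and to w_i.\<close>
  define \<tau> where "\<tau> = (\<lambda>(k, i). ?g (GenB (if k = (0::nat) then 1 else 0) i) / b)"
  \<comment> \<open>The value at \<open>GenD\<close> is a default; only Q and B of \<open>W\<close>
    are prescribed.\<close>
  define \<sigma> where "\<sigma> g = (case g of
      GenQ i \<Rightarrow> ?g (GenQ (i + 2)) - ((coef \<tau> 0 (i + 2))\<^sup>2 * ?g (GenQ 0) + (coef \<tau> 1 (i + 2))\<^sup>2 * ?g (GenQ 1) +
        coef \<tau> 0 (i + 2) * coef \<tau> 1 (i + 2) * b)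
    | GenB i j \<Rightarrow> ?g (GenB (i + 2) (j + 2)) -
        (coef \<tau> 0 (i + 2) * coef \<tau> 1 (j + 2) + coef \<tau> 1 (i + 2) * coef \<tau> 0 (j + 2)) * b
    | GenD \<Rightarrow> 0)" for g
  obtain W where W: "\<And>g. g \<in> qbgens (2 * \<nu> + 1) \<Longrightarrow> gval \<nu> W g = \<sigma> g"
    using realize_gval[OF c2] by blast
  have V: "pval V (GenQ 0) = ?g (GenQ 0)" "pval V (GenQ 1) = ?g (GenQ 1)" "pval V (GenB 0 1) = b"
    using cd by (simp_all add: V_def del: gval.simps)
  have *: "gval (Suc \<nu>) (slice V \<tau> W) g = ?g g" if g: "g \<in> qbgens (2 * Suc \<nu> + 1)" for g
  proof (cases g)
    case (GenQ i)
    show ?thesis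
    proof (cases "i < 2")
      case True
      then show ?thesis
        unfolding GenQ gval.simps(1)[of "Suc \<nu>" "slice V \<tau> W"] hquad_slice V
        by (auto simp: coef_def less_2_cases_iff simp del: gval.simps)
    next
      case False
      then have "GenQ (i - 2) \<in> qbgens (2 * \<nu> + 1)" "i - 2 + 2 = i" using g GenQ by auto
      then show ?thesis
        unfolding GenQ gval.simps(1)[of "Suc \<nu>" "slice V \<tau> W"] hquad_slice V
        using False by (simp add: W \<sigma>_def del: gval.simps)
    qed
  next
    case (GenB i j)
    then have ij: "i < j" "j < 2 * Suc \<nu> + 1" using g by auto
    show ?thesis
    proof (cases "i < 2")
      case True
      then have iff: "?thesis \<longleftrightarrow> (coef \<tau> 0 i * coef \<tau> 1 j + coef \<tau> 1 i * coef \<tau> 0 j) * b = ?g (GenB i j)"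
        unfolding GenB gval.simps(2)[of "Suc \<nu>" "slice V \<tau> W"] hpolar_slice[OF c2] V by simp
      have "(coef \<tau> 0 i * coef \<tau> 1 j + coef \<tau> 1 i * coef \<tau> 0 j) * b = ?g (GenB i j)"
      proof (cases "j < 2")
        case True
        then have "i = 0" "j = 1" using ij by auto
        then show ?thesis by (simp add: coef_def b_def del: gval.simps)
      next
        case False
        then show ?thesis using \<open>i < 2\<close> b0
          by (auto simp: coef_def less_2_cases_iff \<tau>_def simp del: gval.simps)
      qed
      then show ?thesis by (rule iff[THEN iffD2])
    next
      case False
      then have "GenB (i - 2) (j - 2) \<in> qbgens (2 * \<nu> + 1)" "i - 2 + 2 = i" "j - 2 + 2 = j" "\<not> j < 2"
        using ij by auto
      then show ?thesis
        unfolding GenB gval.simps(2)[of "Suc \<nu>" "slice V \<tau> W"] hpolar_slice[OF c2] V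
        using False by (simp add: W \<sigma>_def del: gval.simps)
    qed
  qed (use g in simp)
  moreover have "gval (Suc \<nu>) (slice V \<tau> W) GenD = ?g GenD"
    by (rule gval_GenD_cong[OF c2 *])
  ultimately show ?thesis by (auto simp: gens_eq simp del: gval.simps)
qed

text \<open>The slice formulas solved for the parameters. With b = B_01 of the tuple
  \<open>M\<close>, the invariants of \<open>V\<close> are among those of \<open>M\<close>, each b
  \<tau> is a value of B, and b^2 Q(w), b B(w, w') and b D(w) are polynomials in the invariants of
  \<open>M\<close>.\<close>

lemma slice_clear_denominators:
  fixes f :: "((nat \<times> nat \<Rightarrow> 'k) \<times> (nat \<times> nat \<Rightarrow> 'k) \<times> (nat \<times> nat \<Rightarrow> 'k)) \<Rightarrow> 'k::field"
  assumes c2: "(2::'k) = 0"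
    and f: "f \<in> falg ((\<lambda>g (V, \<tau>, W). pval V g) ` pgens \<union>
      (\<lambda>x (V, \<tau>, W). \<tau> x) ` ({..<2} \<times> {2..<2 * Suc \<nu> + 1}) \<union>
      (\<lambda>g (V, \<tau>, W). gval \<nu> W g) ` gens (2 * \<nu> + 1))"
  shows "\<exists>N. \<exists>f'\<in>falg ((\<lambda>g M. gval (Suc \<nu>) M g) ` gens (2 * Suc \<nu> + 1)). \<forall>p M.
    (case p of (V, \<tau>, W) \<Rightarrow> \<forall>g\<in>gens (2 * Suc \<nu> + 1). gval (Suc \<nu>) (slice V \<tau> W) g = gval (Suc \<nu>) M g) \<longrightarrow>
    gval (Suc \<nu>) M (GenB 0 1) ^ N * f p = f' M"
proof (rule falg_clear_denominators[OF f])
  let ?n = "2 * Suc \<nu> + 1"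
  let ?A = "falg ((\<lambda>g M. gval (Suc \<nu>) M g) ` gens ?n) :: ((nat \<times> nat \<Rightarrow> 'k) \<Rightarrow> 'k) set"
  let ?b = "\<lambda>M. gval (Suc \<nu>) M (GenB 0 1)"
  define R where "R p M \<longleftrightarrow> (case p of (V, \<tau>, W) \<Rightarrow>
      \<forall>g\<in>gens ?n. gval (Suc \<nu>) (slice V \<tau> W) g = gval (Suc \<nu>) M g)"
    for p and M :: "nat \<times> nat \<Rightarrow> 'k"
  have A: "(\<lambda>M. gval (Suc \<nu>) M g) \<in> ?A" if "g \<in> gens ?n" for g
    using that by (intro falg.gen) auto
  have A_Q: "(\<lambda>M. gval (Suc \<nu>) M (GenQ i)) \<in> ?A" if "i < ?n" for i
    using that by (intro A) (simp add: gens_eq)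
  have A_B: "(\<lambda>M. gval (Suc \<nu>) M (GenB i j)) \<in> ?A" if "i < j" "j < ?n" for i j
    using that by (intro A) (simp add: gens_eq)
  show "?b \<in> ?A" by (rule A_B) auto
  have RQ: "gval (Suc \<nu>) M (GenQ i) = (coef \<tau> 0 i)\<^sup>2 * pval V (GenQ 0) + (coef \<tau> 1 i)\<^sup>2 * pval V (GenQ 1) +
      coef \<tau> 0 i * coef \<tau> 1 i * pval V (GenB 0 1) + (if i < 2 then 0 else gval \<nu> W (GenQ (i - 2)))"
    if "R (V, \<tau>, W) M" "i < ?n" for V \<tau> W M i
  proof -
    have "gval (Suc \<nu>) (slice V \<tau> W) (GenQ i) = gval (Suc \<nu>) M (GenQ i)"
      using that by (simp add: R_def gens_eq del: gval.simps)
    then show ?thesis unfolding gval.simps(1)[of "Suc \<nu>" "slice V \<tau> W"] hquad_slice by (rule sym)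
  qed
  have RB: "gval (Suc \<nu>) M (GenB i j) = (coef \<tau> 0 i * coef \<tau> 1 j + coef \<tau> 1 i * coef \<tau> 0 j) * pval V (GenB 0 1) +
    (if i < 2 \<or> j < 2 then 0 else gval \<nu> W (GenB (i - 2) (j - 2)))"
    if "R (V, \<tau>, W) M" "i < j" "j < ?n" for V \<tau> W M i j
  proof -
    have "gval (Suc \<nu>) (slice V \<tau> W) (GenB i j) = gval (Suc \<nu>) M (GenB i j)"
      using that by (simp add: R_def gens_eq del: gval.simps)
    from this hpolar_slice[OF c2, of \<nu> V \<tau> W i j] show ?thesis
      unfolding gval.simps(2)[of "Suc \<nu>" "slice V \<tau> W"] by (rule trans[OF sym])
  qed
  have RV: "pval V (GenQ 0) = gval (Suc \<nu>) M (GenQ 0)" "pval V (GenQ 1) = gval (Suc \<nu>) M (GenQ 1)"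
    "pval V (GenB 0 1) = ?b M" if "R (V, \<tau>, W) M" for V \<tau> W M
    using RQ[OF that, of 0] RQ[OF that, of 1] RB[OF that, of 0 1]
    by (simp_all add: coef_def del: gval.simps pval.simps)
  have R\<tau>: "?b M * \<tau> (0, i) = gval (Suc \<nu>) M (GenB 1 i)" "?b M * \<tau> (1, i) = gval (Suc \<nu>) M (GenB 0 i)"
    if "R (V, \<tau>, W) M" "2 \<le> i" "i < ?n" for V \<tau> W M i
  proof -
    have c: "coef \<tau> k i = \<tau> (k, i)" "coef \<tau> 0 0 = 1" "coef \<tau> 1 1 = 1" "coef \<tau> 0 1 = 0" "coef \<tau> 1 0 = 0" for k
      using that by (simp_all add: coef_def)
    have "gval (Suc \<nu>) M (GenB 1 i) = \<tau> (0, i) * pval V (GenB 0 1)"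
      using RB[OF that(1), of 1 i] that(2,3) by (simp only: c) simp
    moreover have "gval (Suc \<nu>) M (GenB 0 i) = \<tau> (1, i) * pval V (GenB 0 1)"
      using RB[OF that(1), of 0 i] that(2,3) by (simp only: c) simp
    ultimately show "?b M * \<tau> (0, i) = gval (Suc \<nu>) M (GenB 1 i)"
        "?b M * \<tau> (1, i) = gval (Suc \<nu>) M (GenB 0 i)"
      by (simp_all only: RV(3)[OF that(1)] mult.commute)
  qed
  fix g :: "((nat \<times> nat \<Rightarrow> 'k) \<times> (nat \<times> nat \<Rightarrow> 'k) \<times> (nat \<times> nat \<Rightarrow> 'k)) \<Rightarrow> 'k"
  assume "g \<in> (\<lambda>g (V, \<tau>, W). pval V g) ` pgens \<union>
      (\<lambda>x (V, \<tau>, W). \<tau> x) ` ({..<2} \<times> {2..<2 * Suc \<nu> + 1}) \<union>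
      (\<lambda>g (V, \<tau>, W). gval \<nu> W g) ` gens (2 * \<nu> + 1)"
  then consider (V) h where "h \<in> pgens" "g = (\<lambda>(V, \<tau>, W). pval V h)"
    | (\<tau>) x where "x \<in> {..<2} \<times> {2..<?n}" "g = (\<lambda>(V, \<tau>, W). \<tau> x)"
    | (W) h where "h \<in> gens (2 * \<nu> + 1)" "g = (\<lambda>(V, \<tau>, W). gval \<nu> W h)"
    by blast
  then have "\<exists>N. \<exists>g'\<in>?A. \<forall>V \<tau> W M. R (V, \<tau>, W) M \<longrightarrow> ?b M ^ N * g (V, \<tau>, W) = g' M"
  proof cases
    case V
    then show ?thesis using RV
      by (intro exI[of _ 0] bexI[of _ "\<lambda>M. gval (Suc \<nu>) M h"] A)
        (auto simp: pgens_def gens_eq simp del: pval.simps gval.simps)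
  next
    case \<tau>
    then obtain k i where ki: "k < 2" "2 \<le> i" "i < ?n" "g = (\<lambda>(V, \<tau>, W). \<tau> (k, i))" by auto
    then have "\<forall>V \<tau> W M. R (V, \<tau>, W) M \<longrightarrow> ?b M ^ 1 * g (V, \<tau>, W) = gval (Suc \<nu>) M (GenB (1 - k) i)"
      using R\<tau> by (auto simp: less_2_cases_iff simp del: gval.simps)
    moreover have "(\<lambda>M. gval (Suc \<nu>) M (GenB (1 - k) i)) \<in> ?A" using ki by (intro A_B) auto
    ultimately show ?thesis
      by (intro exI[of _ 1] bexI[of _ "\<lambda>M. gval (Suc \<nu>) M (GenB (1 - k) i)"] allI impI) blast+
  next
    case W
    show ?thesis
    proof (cases h)
      case (GenQ i)
      then have Q: "i < 2 * \<nu> + 1" "g = (\<lambda>(V, \<tau>, W). gval \<nu> W (GenQ i))"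
        using W by (auto simp: gens_eq)
      \<comment> \<open>This is b^2 Q(w_i), with every product b \<tau> replaced by a value of
        B.\<close>
      define g' where "g' M = ?b M ^ 2 * gval (Suc \<nu>) M (GenQ (i + 2)) -
        ((gval (Suc \<nu>) M (GenB 1 (i + 2)))\<^sup>2 * gval (Suc \<nu>) M (GenQ 0) +
        (gval (Suc \<nu>) M (GenB 0 (i + 2)))\<^sup>2 * gval (Suc \<nu>) M (GenQ 1) +
         gval (Suc \<nu>) M (GenB 1 (i + 2)) * gval (Suc \<nu>) M (GenB 0 (i + 2)) * ?b M)" for M :: "nat \<times> nat \<Rightarrow> 'k"
      have "g' \<in> ?A" unfolding g'_def[abs_def]
        by (intro falg_diff falg.add falg.mult falg_power A_Q A_B) (use Q(1) in auto)
      moreover have "?b M ^ 2 * g (V, \<tau>, W) = g' M" if R: "R (V, \<tau>, W) M" for V \<tau> W M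
      proof -
        have i: "2 \<le> i + 2" "i + 2 < ?n" using Q(1) by auto
        have "gval (Suc \<nu>) M (GenQ (i + 2)) = \<tau> (0, i + 2) ^ 2 * gval (Suc \<nu>) M (GenQ 0) +
            \<tau> (1, i + 2) ^ 2 * gval (Suc \<nu>) M (GenQ 1) + \<tau> (0, i + 2) * \<tau> (1, i + 2) * ?b M + gval \<nu> W (GenQ i)"
          using RQ[OF R i(2)] RV[OF R] by (simp add: coef_def del: gval.simps pval.simps)
        then show ?thesis
          unfolding g'_def R\<tau>[OF R i, symmetric] Q(2) prod.case
          by (simp add: algebra_simps power2_eq_square del: gval.simps)
      qed
      ultimately show ?thesis
        by (intro exI[of _ 2] bexI[of _ g'] allI impI) blast+
    next
      case (GenB i j)
      then have B: "i < j" "j < 2 * \<nu> + 1" "g = (\<lambda>(V, \<tau>, W). gval \<nu> W (GenB i j))"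
        using W by (auto simp: gens_eq)
      \<comment> \<open>One factor b is enough here: the subtracted term contains two coefficients
        \<tau> but already carries one b.\<close>
      define g' where "g' M = ?b M * gval (Suc \<nu>) M (GenB (i + 2) (j + 2)) -
        (gval (Suc \<nu>) M (GenB 1 (i + 2)) * gval (Suc \<nu>) M (GenB 0 (j + 2)) +
         gval (Suc \<nu>) M (GenB 0 (i + 2)) * gval (Suc \<nu>) M (GenB 1 (j + 2)))" for M :: "nat \<times> nat \<Rightarrow> 'k"
      have "g' \<in> ?A" unfolding g'_def[abs_def]
        by (intro falg_diff falg.add falg.mult falg_power A_B)
          (use B(1,2) in auto)
      moreover have "?b M ^ 1 * g (V, \<tau>, W) = g' M" if R: "R (V, \<tau>, W) M" for V \<tau> W M
      proof -
        have i: "2 \<le> i + 2" "i + 2 < ?n" and j: "2 \<le> j + 2" "j + 2 < ?n" using B(1,2) by auto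
        have "gval (Suc \<nu>) M (GenB (i + 2) (j + 2)) =
            (\<tau> (0, i + 2) * \<tau> (1, j + 2) + \<tau> (1, i + 2) * \<tau> (0, j + 2)) * ?b M + gval \<nu> W (GenB i j)"
          using RB[OF R _ j(2), of "i + 2"] RV(3)[OF R] B(1) by (simp add: coef_def del: gval.simps pval.simps)
        then show ?thesis
          unfolding g'_def R\<tau>[OF R i, symmetric] R\<tau>[OF R j, symmetric] B(3) prod.case
          by (simp add: algebra_simps power2_eq_square del: gval.simps)
      qed
      ultimately show ?thesis
        by (intro exI[of _ 1] bexI[of _ g'] allI impI) blast+
    next
      case GenD
      then have D: "g = (\<lambda>(V, \<tau>, W). gval \<nu> W GenD)" using W by simp
      have "?b M ^ 1 * g (V, \<tau>, W) = gval (Suc \<nu>) M GenD" if R: "R (V, \<tau>, W) M" for V \<tau> W M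
      proof -
        have "gval (Suc \<nu>) M GenD = gval (Suc \<nu>) (slice V \<tau> W) GenD"
          using R by (simp add: R_def gens_eq del: gval.simps)
        then show ?thesis unfolding GenD_slice[OF c2] RV(3)[OF R] D by simp
      qed
      moreover have "(\<lambda>M. gval (Suc \<nu>) M GenD) \<in> ?A" by (rule A) (simp add: gens_eq)
      ultimately show ?thesis
        by (intro exI[of _ 1] bexI[of _ "\<lambda>M. gval (Suc \<nu>) M GenD"] allI impI) blast+
    qed
  qed
  then show "\<exists>N. \<exists>g'\<in>?A. \<forall>p M. (case p of (V, \<tau>, W) \<Rightarrow>
      \<forall>g\<in>gens ?n. gval (Suc \<nu>) (slice V \<tau> W) g = gval (Suc \<nu>) M g) \<longrightarrow> ?b M ^ N * g p = g' M"
    unfolding R_def[symmetric] split_paired_all split_paired_All .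
qed

section \<open>Generation of the invariant functions\<close>

lemma GenD_identity: "gval \<nu> (\<lambda>(c, i). if c = i then 1 else 0) GenD = (1::'a::comm_ring_1)"
proof -
  have "mat n n (\<lambda>(c, i). if c = i then 1 else 0) = (1\<^sub>m n :: 'a mat)" for n by (rule eq_matI) auto
  then show ?thesis by simp
qed

lemma slice_pfun:
  assumes "f \<in> pfun ({..<2 * Suc \<nu> + 1} \<times> {..<2 * Suc \<nu> + 1})"
  shows "(\<lambda>(V, \<tau>, W). pval V (GenB 0 1) * f (slice V \<tau> W)) \<in> falg (
    (\<lambda>x (V, \<tau>, W). V x) ` ({..<2} \<times> {..<2}) \<union>
    (\<lambda>x (V, \<tau>, W). \<tau> x) ` ({..<2} \<times> {2..<2 * Suc \<nu> + 1}) \<union>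
    (\<lambda>x (V, \<tau>, W). W x) ` ({..<2 * \<nu> + 1} \<times> {..<2 * \<nu> + 1}))" (is "_ \<in> ?A")
proof -
  have V: "(\<lambda>p. fst p (c, i)) \<in> ?A" if "c < 2" "i < 2" for c i
    using that by (intro falg.gen UnI1, intro image_eqI[of _ _ "(c, i)"]) auto
  have \<tau>: "(\<lambda>p. fst (snd p) (k, i)) \<in> ?A" if "k < 2" "2 \<le> i" "i < 2 * Suc \<nu> + 1" for k i
    using that by (intro falg.gen UnI1 UnI2, intro image_eqI[of _ _ "(k, i)"]) auto
  have W: "(\<lambda>p. snd (snd p) (c, i)) \<in> ?A" if "c < 2 * \<nu> + 1" "i < 2 * \<nu> + 1" for c i
    using that by (intro falg.gen UnI2, intro image_eqI[of _ _ "(c, i)"]) auto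
  have coef: "(\<lambda>p. coef (fst (snd p)) k i) \<in> ?A" if "k < 2" "i < 2 * Suc \<nu> + 1" for k i
  proof (cases "i < 2")
    case True
    then show ?thesis by (simp add: coef_def falg.const)
  next
    case False
    then show ?thesis using \<tau>[of k i] that by (simp add: coef_def)
  qed
  have "(\<lambda>p. slice (fst p) (fst (snd p)) (snd (snd p)) x) \<in> ?A"
    if xC: "x \<in> {..<2 * Suc \<nu> + 1} \<times> {..<2 * Suc \<nu> + 1}" for x
  proof -
    obtain c i where x: "x = (c, i)" "c < 2 * Suc \<nu> + 1" "i < 2 * Suc \<nu> + 1" using xC by auto
    show ?thesis
    proof (cases "c < 2")
      case True
      have "(\<lambda>p. coef (fst (snd p)) 0 i * fst p (c, 0) + coef (fst (snd p)) 1 i * fst p (c, 1)) \<in> ?A"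
        by (intro falg.add falg.mult coef V) (use x True in auto)
      then show ?thesis using True by (simp add: x slice_def glue_def)
    next
      case False
      show ?thesis
      proof (cases "i < 2")
        case True
        then show ?thesis using False by (simp add: x slice_def glue_def falg.const)
      next
        case i: False
        have "(\<lambda>p. snd (snd p) (c - 2, i - 2)) \<in> ?A" by (rule W) (use x False i in auto)
        then show ?thesis using False i by (simp add: x slice_def glue_def)
      qed
    qed
  qed
  then have "(\<lambda>p. f (slice (fst p) (fst (snd p)) (snd (snd p)))) \<in> ?A"
    by (rule pfun_pullback[OF assms])
  moreover have "(\<lambda>p. pval (fst p) (GenB 0 1)) \<in> ?A"
    unfolding pval.simps by (intro falg.add falg.mult V) auto
  ultimately have "(\<lambda>p. pval (fst p) (GenB 0 1) *
      f (slice (fst p) (fst (snd p)) (snd (snd p)))) \<in> ?A" by (intro falg.mult)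
  then show ?thesis by (simp add: case_prod_unfold)
qed

lemma gram_invariant_generated:
  fixes f :: "(nat \<times> nat \<Rightarrow> 'k::alg_closed_field) \<Rightarrow> 'k"
  assumes c2: "(2::'k) = 0"
    and "f \<in> pfun ({..<2 * \<nu> + 1} \<times> {..<2 * \<nu> + 1})" "gram_invariant \<nu> f"
  shows "f \<in> falg ((\<lambda>g M. gval \<nu> M g) ` gens (2 * \<nu> + 1))"
  using assms(2,3)
proof (induction \<nu> arbitrary: f)
  case 0
  \<comment> \<open>With one vector on a line, D is the coordinate itself and generates all
    polynomial functions.\<close>
  have "(\<lambda>M. gval 0 M GenD :: 'k) \<in> falg ((\<lambda>g M. gval 0 M g) ` gens 1)"
    by (intro falg.gen) (simp add: gens_eq)
  moreover have "gval 0 M GenD = M (0, 0)" for M :: "nat \<times> nat \<Rightarrow> 'k"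
    by (simp add: det_single)
  ultimately have "(\<lambda>M. M (0, 0) :: 'k) \<in> falg ((\<lambda>g M. gval 0 M g) ` gens 1)" by (simp only:)
  then show ?case
    using falg_pullback[OF 0(1)[unfolded pfun_def], of "\<lambda>M. M"] by auto
next
  case (Suc \<nu>)
  let ?n' = "2 * \<nu> + 1" and ?n = "2 * Suc \<nu> + 1"
  let ?W = "{..<?n'} \<times> {..<?n'}" and ?C = "{..<?n} \<times> {..<?n}"
  note inf = infinite_alg_closed[where 'k = 'k]
  have inv: "f M = f M'" if "\<And>g. g \<in> gens ?n \<Longrightarrow> gval (Suc \<nu>) M g = gval (Suc \<nu>) M' g"
    "gval (Suc \<nu>) M GenD \<noteq> 0" for M M'
    using Suc.prems(2) that unfolding gram_invariant_def by blast
  \<comment> \<open>The factor B_01 makes \<open>F\<close> vanish on degenerate pairs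
    \<open>V\<close>, where slice tuples have D = 0 and the invariance of \<open>f\<close> says
    nothing.\<close>
  define F where "F = (\<lambda>(V, \<tau>, W). pval V (GenB 0 1) * f (slice V \<tau> W))"
  let ?GV = "(\<lambda>x \<sigma>. \<sigma> x) ` ({..<2} \<times> {..<2}) :: ((nat \<times> nat \<Rightarrow> 'k) \<Rightarrow> 'k) set"
  let ?GW = "(\<lambda>x \<sigma>. \<sigma> x) ` ?W :: ((nat \<times> nat \<Rightarrow> 'k) \<Rightarrow> 'k) set"
  let ?T = "{..<2} \<times> {2..<?n}"
  let ?G1 = "(\<lambda>x (V, \<tau>). V x) ` ({..<2} \<times> {..<2}) \<union> (\<lambda>x (V, \<tau>). \<tau> x) ` ?T ::
    ((nat \<times> nat \<Rightarrow> 'k) \<times> (nat \<times> nat \<Rightarrow> 'k) \<Rightarrow> 'k) set"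
  let ?G2 = "(\<lambda>x (\<tau>, W). \<tau> x) ` ?T \<union> (\<lambda>g (\<tau>, W). gval \<nu> W g) ` gens ?n' ::
    ((nat \<times> nat \<Rightarrow> 'k) \<times> (nat \<times> nat \<Rightarrow> 'k) \<Rightarrow> 'k) set"
  let ?H1 = "(\<lambda>g W. gval \<nu> W g) ` gens ?n' :: ((nat \<times> nat \<Rightarrow> 'k) \<Rightarrow> 'k) set"
  let ?H2 = "(\<lambda>g V. pval V g) ` pgens :: ((nat \<times> nat \<Rightarrow> 'k) \<Rightarrow> 'k) set"
  have F: "F \<in> falg ((\<lambda>x (V, \<tau>, W). V x) ` ({..<2} \<times> {..<2}) \<union>
    (\<lambda>x (V, \<tau>, W). \<tau> x) ` ?T \<union> (\<lambda>x (V, \<tau>, W). W x) ` ?W)"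
    unfolding F_def by (rule slice_pfun[OF Suc.prems(1)])
  \<comment> \<open>The induction hypothesis, applied to \<open>W\<close> while (V, \<tau>) acts as
    a parameter.\<close>
  have F1: "F \<in> falg ((\<lambda>a p. a (fst p, fst (snd p))) ` ?G1 \<union> (\<lambda>b p. b (snd (snd p))) ` ?H1)"
  proof (rule falg_slices[OF F, where \<xi> = "\<lambda>p. (fst p, fst (snd p))" and \<eta> = "\<lambda>p. snd (snd p)"
        and \<pi> = "\<lambda>x W. (fst x, snd x, W)" and S = "{s. gram_invariant \<nu> s}" and H = ?GW])
    fix x :: "(nat \<times> nat \<Rightarrow> 'k) \<times> (nat \<times> nat \<Rightarrow> 'k)"
    obtain V \<tau> where x: "x = (V, \<tau>)" by force
    have "pval V (GenB 0 1) * f (slice V \<tau> W) = pval V (GenB 0 1) * f (slice V \<tau> W')"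
      if W: "\<And>g. g \<in> gens ?n' \<Longrightarrow> gval \<nu> W g = gval \<nu> W' g" "gval \<nu> W GenD \<noteq> 0" for W W'
    proof (cases "pval V (GenB 0 1) = 0")
      case False
      then have "gval (Suc \<nu>) (slice V \<tau> W) GenD \<noteq> 0" unfolding GenD_slice[OF c2] using W(2) by simp
      moreover have "gval (Suc \<nu>) (slice V \<tau> W) g = gval (Suc \<nu>) (slice V \<tau> W') g" if "g \<in> gens ?n" for g
        by (rule gval_slice_cong[OF c2 _ W(1) that]) simp_all
      ultimately have "f (slice V \<tau> W) = f (slice V \<tau> W')" by (intro inv)
      then show ?thesis by simp
    qed (simp only: mult_zero_left)
    then show "(\<lambda>W. F (fst x, snd x, W)) \<in> {s. gram_invariant \<nu> s}"
      unfolding F_def x gram_invariant_def by simp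
  next
    fix s :: "(nat \<times> nat \<Rightarrow> 'k) \<Rightarrow> 'k" assume "s \<in> falg ?GW" "s \<in> {s. gram_invariant \<nu> s}"
    then show "s \<in> falg ?H1" by (intro Suc.IH) (simp_all add: pfun_def)
  next
    fix g :: "(nat \<times> nat \<Rightarrow> 'k) \<times> (nat \<times> nat \<Rightarrow> 'k) \<times> (nat \<times> nat \<Rightarrow> 'k) \<Rightarrow> 'k"
    assume "g \<in> (\<lambda>x (V, \<tau>, W). V x) ` ({..<2} \<times> {..<2}) \<union>
      (\<lambda>x (V, \<tau>, W). \<tau> x) ` ?T \<union> (\<lambda>x (V, \<tau>, W). W x) ` ?W"
    then show "(\<exists>a\<in>?G1. \<forall>p. g p = a (fst p, fst (snd p))) \<or> (\<exists>b\<in>?GW. \<forall>p. g p = b (snd (snd p)))"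
    proof (elim UnE imageE)
      fix y assume "g = (\<lambda>(V, \<tau>, W). V y)" "y \<in> {..<2} \<times> {..<2}"
      then show ?thesis by (intro disjI1 bexI[of _ "\<lambda>(V, \<tau>). V y"]) auto
    next
      fix y assume "g = (\<lambda>(V, \<tau>, W). \<tau> y)" "y \<in> ?T"
      then show ?thesis by (intro disjI1 bexI[of _ "\<lambda>(V, \<tau>). \<tau> y"]) auto
    next
      fix y assume "g = (\<lambda>(V, \<tau>, W). W y)" "y \<in> ?W"
      then show ?thesis by (intro disjI2 bexI[of _ "\<lambda>W. W y"]) auto
    qed
  next
    show "(\<lambda>y. c * s y) \<in> {s. gram_invariant \<nu> s}" if "s \<in> {s. gram_invariant \<nu> s}"
      for c and s :: "(nat \<times> nat \<Rightarrow> 'k) \<Rightarrow> 'k"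
      unfolding mem_Collect_eq gram_invariant_def
    proof (intro allI impI)
      fix M M' :: "nat \<times> nat \<Rightarrow> 'k"
      assume "\<forall>g\<in>gens ?n'. gval \<nu> M g = gval \<nu> M' g" "gval \<nu> M GenD \<noteq> 0"
      then have "s M = s M'" using that unfolding mem_Collect_eq gram_invariant_def by blast
      then show "c * s M = c * s M'" by simp
    qed
    show "(\<lambda>y. s y + s' y) \<in> {s. gram_invariant \<nu> s}"
      if "s \<in> {s. gram_invariant \<nu> s}" "s' \<in> {s. gram_invariant \<nu> s}"
      for s s' :: "(nat \<times> nat \<Rightarrow> 'k) \<Rightarrow> 'k"
      unfolding mem_Collect_eq gram_invariant_def
    proof (intro allI impI)
      fix M M' :: "nat \<times> nat \<Rightarrow> 'k"
      assume "\<forall>g\<in>gens ?n'. gval \<nu> M g = gval \<nu> M' g" "gval \<nu> M GenD \<noteq> 0"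
      then have "s M = s M'" "s' M = s' M'" using that unfolding mem_Collect_eq gram_invariant_def by blast+
      then show "s M + s' M = s M' + s' M'" by simp
    qed
  qed auto
  define S where "S = {\<psi> :: (nat \<times> nat \<Rightarrow> 'k) \<Rightarrow> 'k. \<forall>V V'. (\<forall>g\<in>pgens. pval V g = pval V' g) \<longrightarrow>
      pval V (GenB 0 1) \<noteq> 0 \<longrightarrow> \<psi> V = \<psi> V'}"
  have F2: "F \<in> falg ((\<lambda>a p. a (snd p)) ` ?G2 \<union> (\<lambda>b p. b (fst p)) ` ?H2)"
  proof (rule falg_slices[OF F1, where \<xi> = snd and \<eta> = fst
        and \<pi> = "\<lambda>x V. (V, x)" and S = S and H = ?GV])
    fix x :: "(nat \<times> nat \<Rightarrow> 'k) \<times> (nat \<times> nat \<Rightarrow> 'k)"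
    obtain \<tau> W where x: "x = (\<tau>, W)" by force
    have "f (slice V \<tau> W) = f (slice V' \<tau> W)"
      if V: "\<And>g. g \<in> pgens \<Longrightarrow> pval V g = pval V' g" and b: "pval V (GenB 0 1) \<noteq> 0" for V V'
    proof -
      \<comment> \<open>Invariance in \<open>V\<close> is known at first only where D of
        \<open>W\<close> is nonzero; the difference is polynomial in \<open>W\<close>, so it
        vanishes everywhere.\<close>
      define h where "h W = F (V, \<tau>, W) - F (V', \<tau>, W)" for W
      have b': "pval V' (GenB 0 1) = pval V (GenB 0 1)" by (rule V[symmetric]) (simp add: pgens_def)
      have "(\<lambda>W. F (V, \<tau>, W)) \<in> pfun ?W" for V
        unfolding pfun_def
        by (rule falg_pullback[OF F]) (auto intro: falg.const falg.gen)
      then have h: "h \<in> pfun ?W" unfolding h_def[abs_def] pfun_def by (intro falg_diff)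
      have "gval \<nu> W GenD * h W = 0" for W
      proof (cases "gval \<nu> W GenD = 0")
        case False
        then have "gval (Suc \<nu>) (slice V \<tau> W) GenD \<noteq> 0" unfolding GenD_slice[OF c2] using b by simp
        moreover have "gval (Suc \<nu>) (slice V \<tau> W) g = gval (Suc \<nu>) (slice V' \<tau> W) g" if "g \<in> gens ?n" for g
          by (rule gval_slice_cong[OF c2 V _ that]) simp_all
        ultimately have "f (slice V \<tau> W) = f (slice V' \<tau> W)" by (intro inv)
        then show ?thesis by (simp only: h_def F_def prod.case b' diff_self mult_zero_right)
      qed (simp only: mult_zero_left)
      moreover have "(\<lambda>W. gval \<nu> W GenD) \<in> pfun ?W" by (rule gval_pfun) (simp add: gens_eq)
      ultimately have "h W = 0"
        using pfun_no_zero_divisors[OF inf h, of "\<lambda>W. gval \<nu> W GenD"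
            "\<lambda>(c, i). if c = i then 1 else 0" W] GenD_identity[of \<nu>] by (metis one_neq_zero)
      then have "pval V (GenB 0 1) * (f (slice V \<tau> W) - f (slice V' \<tau> W)) = 0"
        by (simp only: h_def F_def prod.case b' right_diff_distrib)
      then show ?thesis using b by (simp del: pval.simps)
    qed
    moreover have "pval V (GenB 0 1) = pval V' (GenB 0 1)"
      if "\<And>g. g \<in> pgens \<Longrightarrow> pval V g = pval V' g" for V V' :: "nat \<times> nat \<Rightarrow> 'k"
      by (rule that) (simp add: pgens_def)
    ultimately show "(\<lambda>V. F (V, x)) \<in> S"
      unfolding S_def F_def x mem_Collect_eq prod.case by (metis (no_types, lifting))
  next
    fix \<psi> :: "(nat \<times> nat \<Rightarrow> 'k) \<Rightarrow> 'k" assume \<psi>: "\<psi> \<in> falg ?GV" "\<psi> \<in> S"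
    have "\<psi> V = \<psi> V'" if "\<And>g. g \<in> pgens \<Longrightarrow> pval V g = pval V' g" "pval V (GenB 0 1) \<noteq> 0" for V V'
      using \<psi>(2) that unfolding S_def mem_Collect_eq by blast
    then show "\<psi> \<in> falg ?H2"
      by (rule plane_invariants[OF c2 inf \<psi>(1)[folded pfun_def]])
  next
    fix g :: "(nat \<times> nat \<Rightarrow> 'k) \<times> (nat \<times> nat \<Rightarrow> 'k) \<times> (nat \<times> nat \<Rightarrow> 'k) \<Rightarrow> 'k"
    assume "g \<in> (\<lambda>a p. a (fst p, fst (snd p))) ` ?G1 \<union> (\<lambda>b p. b (snd (snd p))) ` ?H1"
    then show "(\<exists>a\<in>?G2. \<forall>p. g p = a (snd p)) \<or> (\<exists>b\<in>?GV. \<forall>p. g p = b (fst p))"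
    proof (elim UnE imageE)
      fix a y assume "g = (\<lambda>p. a (fst p, fst (snd p)))" "a = (\<lambda>(V, \<tau>). V y)" "y \<in> {..<2} \<times> {..<2}"
      then show ?thesis by (intro disjI2 bexI[of _ "\<lambda>V. V y"]) auto
    next
      fix a y assume "g = (\<lambda>p. a (fst p, fst (snd p)))" "a = (\<lambda>(V, \<tau>). \<tau> y)" "y \<in> ?T"
      then show ?thesis by (intro disjI1 bexI[of _ "\<lambda>(\<tau>, W). \<tau> y"]) auto
    next
      fix b h assume "g = (\<lambda>p. b (snd (snd p)))" "b = (\<lambda>W. gval \<nu> W h)" "h \<in> gens ?n'"
      then show ?thesis by (intro disjI1 bexI[of _ "\<lambda>(\<tau>, W). gval \<nu> W h"]) auto
    qed
  next
    show "(\<lambda>y. c * s y) \<in> S" if "s \<in> S" for c s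
      unfolding S_def mem_Collect_eq
    proof (intro allI impI)
      fix V V' :: "nat \<times> nat \<Rightarrow> 'k"
      assume "\<forall>g\<in>pgens. pval V g = pval V' g" "pval V (GenB 0 1) \<noteq> 0"
      then have "s V = s V'" using that unfolding S_def mem_Collect_eq by blast
      then show "c * s V = c * s V'" by simp
    qed
    show "(\<lambda>y. s y + s' y) \<in> S" if "s \<in> S" "s' \<in> S" for s s'
      unfolding S_def mem_Collect_eq
    proof (intro allI impI)
      fix V V' :: "nat \<times> nat \<Rightarrow> 'k"
      assume "\<forall>g\<in>pgens. pval V g = pval V' g" "pval V (GenB 0 1) \<noteq> 0"
      then have "s V = s V'" "s' V = s' V'" using that unfolding S_def mem_Collect_eq by blast+
      then show "s V + s' V = s V' + s' V'" by simp
    qed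
  qed auto
  have "F \<in> falg ((\<lambda>g (V, \<tau>, W). pval V g) ` pgens \<union> (\<lambda>x (V, \<tau>, W). \<tau> x) ` ?T \<union>
      (\<lambda>g (V, \<tau>, W). gval \<nu> W g) ` gens ?n')"
  proof (rule falg_pullback[OF F2, of "\<lambda>p. p"])
    fix g :: "(nat \<times> nat \<Rightarrow> 'k) \<times> (nat \<times> nat \<Rightarrow> 'k) \<times> (nat \<times> nat \<Rightarrow> 'k) \<Rightarrow> 'k"
    assume "g \<in> (\<lambda>a p. a (snd p)) ` ?G2 \<union> (\<lambda>b p. b (fst p)) ` ?H2"
    then consider y where "y \<in> ?T" "g = (\<lambda>(V, \<tau>, W). \<tau> y)"
      | h where "h \<in> gens ?n'" "g = (\<lambda>(V, \<tau>, W). gval \<nu> W h)"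
      | h where "h \<in> pgens" "g = (\<lambda>(V, \<tau>, W). pval V h)"
      by (elim UnE imageE) (auto simp: case_prod_unfold)
    then show "(\<lambda>p. g p) \<in> falg ((\<lambda>g (V, \<tau>, W). pval V g) ` pgens \<union> (\<lambda>x (V, \<tau>, W). \<tau> x) ` ?T \<union>
      (\<lambda>g (V, \<tau>, W). gval \<nu> W g) ` gens ?n')"
      by cases (blast intro: falg.gen)+
  qed
  from slice_clear_denominators[OF c2 this]
  obtain N F' where F': "F' \<in> falg ((\<lambda>g M. gval (Suc \<nu>) M g) ` gens ?n)"
    and NF: "\<And>V \<tau> W M. (\<And>g. g \<in> gens ?n \<Longrightarrow> gval (Suc \<nu>) (slice V \<tau> W) g = gval (Suc \<nu>) M g) \<Longrightarrow>
      gval (Suc \<nu>) M (GenB 0 1) ^ N * F (V, \<tau>, W) = F' M"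
    unfolding split_paired_All prod.case by blast
  obtain P where P: "P \<in> pfun (gens ?n)" "F' = (\<lambda>M. P (gval (Suc \<nu>) M))"
    using falg_factor[OF F'] by blast
  \<comment> \<open>The exponent is one more than \<open>N\<close> because \<open>F\<close> carries
    its own factor B_01.\<close>
  define h where "h M = gval (Suc \<nu>) M (GenB 0 1) ^ Suc N * f M - P (gval (Suc \<nu>) M)" for M
  have bgen: "GenB 0 1 \<in> gens ?n" by (simp add: gens_eq)
  have Dgen: "GenD \<in> gens ?n" by (simp add: gens_eq)
  have h: "h \<in> pfun ?C"
    using Suc.prems(1) bgen unfolding h_def[abs_def] pfun_def[of ?C]
    by (intro falg_diff falg.mult falg_power pfun_pullback[OF P(1)] gval_pfun[unfolded pfun_def])
  \<comment> \<open>A slice with the invariants of \<open>M\<close> exists where B_01 \<noteq> 0,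
    and \<open>f\<close> takes the same value on it where D \<noteq> 0; both factors are cancelled
    afterwards.\<close>
  have "gval (Suc \<nu>) M (GenB 0 1) * (gval (Suc \<nu>) M GenD * h M) = 0" for M
  proof (cases "gval (Suc \<nu>) M (GenB 0 1) = 0 \<or> gval (Suc \<nu>) M GenD = 0")
    case False
    then obtain V \<tau> W where s: "\<And>g. g \<in> gens ?n \<Longrightarrow> gval (Suc \<nu>) (slice V \<tau> W) g = gval (Suc \<nu>) M g"
      using slice_exists[OF c2] by blast
    have "pval V (GenB 0 1) = gval (Suc \<nu>) (slice V \<tau> W) (GenB 0 1)"
      unfolding gval.simps(2)[of "Suc \<nu>" "slice V \<tau> W"] hpolar_slice[OF c2]
      by (simp add: coef_def)
    then have "pval V (GenB 0 1) = gval (Suc \<nu>) M (GenB 0 1)" by (simp only: s[OF bgen])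
    moreover have "f (slice V \<tau> W) = f M"
      by (rule inv[OF s]) (use False s[OF Dgen] in auto)
    ultimately have "h M = 0"
      using NF[OF s] P(2) by (simp add: h_def F_def mult_ac del: gval.simps pval.simps)
    then show ?thesis by (simp only: mult_zero_right)
  qed (auto simp del: gval.simps)
  moreover have "(\<lambda>M. gval (Suc \<nu>) M GenD * h M) \<in> pfun ?C"
    using h unfolding pfun_def by (intro falg.mult gval_pfun[unfolded pfun_def] Dgen)
  moreover obtain M1 :: "nat \<times> nat \<Rightarrow> 'k" where "gval (Suc \<nu>) M1 (GenB 0 1) = 1"
  proof -
    obtain M1 :: "nat \<times> nat \<Rightarrow> 'k" where "\<forall>g\<in>qbgens ?n. gval (Suc \<nu>) M1 g = 1"
      using realize_gval[OF c2, of "Suc \<nu>" "\<lambda>_. 1"] by blast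
    moreover have "GenB 0 1 \<in> qbgens ?n" by simp
    ultimately show thesis using that by blast
  qed
  ultimately have "gval (Suc \<nu>) M GenD * h M = 0" for M
    using pfun_no_zero_divisors[OF inf, of "\<lambda>M. gval (Suc \<nu>) M GenD * h M" ?C
        "\<lambda>M. gval (Suc \<nu>) M (GenB 0 1)" M1 M] gval_pfun[OF bgen] by (metis one_neq_zero)
  then have "h M = 0" for M
    using pfun_no_zero_divisors[OF inf h gval_pfun[OF Dgen], of "\<lambda>(c, i). if c = i then 1 else 0" M]
      GenD_identity[of "Suc \<nu>"] by (metis one_neq_zero)
  then have "gval (Suc \<nu>) M (GenB 0 1) ^ Suc N * f M = P (gval (Suc \<nu>) M)" for M
    unfolding h_def by (metis right_minus_eq)
  from polar_strip[OF c2 _ Suc.prems(1) P(1) this]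
  obtain P' where P': "P' \<in> pfun (gens ?n)" "\<And>M. f M = P' (gval (Suc \<nu>) M)" by auto
  have "(\<lambda>M. P' (gval (Suc \<nu>) M)) \<in> falg ((\<lambda>g M. gval (Suc \<nu>) M g) ` gens ?n)"
    by (rule pfun_pullback[OF P'(1)]) (auto intro: falg.gen)
  then show ?case unfolding P'(2)[symmetric] .
qed

section \<open>From hyperbolic to standard coordinates\<close>

text \<open>The place of the c-th hyperbolic coordinate in the order x, y, z. Indices from 2 \<nu>
  on stay fixed, so that it is a permutation of all indices.\<close>

definition hord :: "nat \<Rightarrow> nat \<Rightarrow> nat" where
  "hord \<nu> c = (if c < 2 * \<nu> then if even c then c div 2 else \<nu> + c div 2 else c)"

lemma hord_simps [simp]:
  "t < \<nu> \<Longrightarrow> hord \<nu> (2 * t) = t" "t < \<nu> \<Longrightarrow> hord \<nu> (Suc (2 * t)) = \<nu> + t" "hord \<nu> (2 * \<nu>) = 2 * \<nu>"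
  by (simp_all add: hord_def)

lemma hord_permutes: "hord \<nu> permutes {0..<2 * \<nu> + 1}"
proof (rule bij_imp_permutes)
  have inj: "inj_on (hord \<nu>) {0..<2 * \<nu> + 1}"
  proof (rule inj_onI)
    fix c d assume "c \<in> {0..<2 * \<nu> + 1}" "d \<in> {0..<2 * \<nu> + 1}" "hord \<nu> c = hord \<nu> d"
    then show "c = d" unfolding hord_def atLeastLessThan_iff by (auto split: if_splits; presburger)
  qed
  moreover have "hord \<nu> ` {0..<2 * \<nu> + 1} \<subseteq> {0..<2 * \<nu> + 1}"
    by (auto simp: hord_def)
  ultimately show "bij_betw (hord \<nu>) {0..<2 * \<nu> + 1} {0..<2 * \<nu> + 1}"
    by (simp add: bij_betw_def endo_inj_surj)
  show "hord \<nu> c = c" if "c \<notin> {0..<2 * \<nu> + 1}" for c using that by (simp add: hord_def)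
qed

definition hcoord :: "nat \<Rightarrow> (nat \<times> nat \<Rightarrow> 'a) \<Rightarrow> nat \<times> nat \<Rightarrow> 'a" where
  "hcoord \<nu> N = (\<lambda>(c, i). N (hord \<nu> c, i))"

lemma qform_eq_hquad: "qform \<nu> v = hquad \<nu> (\<lambda>c. v $ hord \<nu> c)"
  by (simp add: qform_def hquad_def)

lemma polar_eq_hpolar:
  assumes "v \<in> carrier_vec (2 * \<nu> + 1)" "w \<in> carrier_vec (2 * \<nu> + 1)"
  shows "polar \<nu> v w = hpolar \<nu> (\<lambda>c. v $ hord \<nu> c) (\<lambda>c. w $ hord \<nu> c)"
proof -
  have "hquad \<nu> (\<lambda>c. (v + w) $ hord \<nu> c) = hquad \<nu> (\<lambda>c. v $ hord \<nu> c + w $ hord \<nu> c)"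
    unfolding qform_eq_hquad[symmetric]
    using assms by (simp add: qform_def hquad_def)
  then show ?thesis by (simp add: polar_def qform_eq_hquad hquad_add)
qed

lemma gen_invariant_in:
  assumes "g \<in> gens (2 * \<nu> + 1)"
  shows "(gen_invariant \<nu> g :: (nat \<times> nat, 'a::comm_ring_1) mpoly) \<in> vector_polys (2 * \<nu> + 1) (2 * \<nu> + 1)"
proof -
  let ?n = "2 * \<nu> + 1"
  let ?P = "polys_in ({..<?n} \<times> {..<?n}) :: (nat \<times> nat, 'a) mpoly set"
  have v: "(mvar (c, i) :: (nat \<times> nat, 'a) mpoly) \<in> ?P" if "c < ?n" "i < ?n" for c i
    using that by (intro polys_in_var) auto
  have q: "qform \<nu> w \<in> ?P" if "\<And>c. c < ?n \<Longrightarrow> w $ c \<in> ?P"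
    for w :: "(nat \<times> nat, 'a) mpoly vec"
    unfolding qform_def
    by (intro polys_in_add polys_in_sum polys_in_mult polys_in_power that) auto
  have gen: "qform \<nu> (generic_vec ?n i) \<in> ?P" if "i < ?n" for i
    by (rule q) (use that in \<open>simp add: generic_vec_def v[simplified]\<close>)
  have "gen_invariant \<nu> g \<in> ?P"
  proof (cases g)
    case (GenQ i)
    then show ?thesis using assms gen by (simp add: gens_eq)
  next
    case (GenB i j)
    have "qform \<nu> (generic_vec ?n i + generic_vec ?n j) \<in> ?P"
      by (rule q) (use assms GenB in \<open>simp add: generic_vec_def gens_eq v[simplified] polys_in_add\<close>)
    then show ?thesis using assms GenB gen[of i] gen[of j]
      by (simp add: gens_eq polar_def polys_in_diff)
  next
    case GenD
    have "det (mat_of_cols ?n (map (generic_vec ?n) [0..<?n])) \<in> ?P"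
      by (rule polys_in_det[of _ ?n])
        (auto simp: mat_of_cols_def generic_vec_def v[simplified] simp del: upt_Suc)
    then show ?thesis by (simp add: GenD)
  qed
  then show ?thesis by (simp add: vector_polys_def)
qed

text \<open>Reordering the coordinates affects only D, through the sign of
  \<open>hord \<nu>\<close>, which is 1 in characteristic 2.\<close>

lemma peval_gen_invariant:
  fixes N :: "nat \<times> nat \<Rightarrow> 'k::field"
  assumes c2: "(2::'k) = 0" and g: "g \<in> gens (2 * \<nu> + 1)"
  shows "peval N (gen_invariant \<nu> g) = gval \<nu> (hcoord \<nu> N) g"
proof -
  let ?n = "2 * \<nu> + 1"
  interpret comm_ring_hom "peval N" by (rule comm_ring_hom_peval)
  have lt: "hord \<nu> c < ?n" if "c < ?n" for c
    using permutes_in_image[OF hord_permutes, of \<nu> c] that by simp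
  have hv: "peval N (hpolar \<nu> v w) = hpolar \<nu> (\<lambda>c. peval N (v c)) (\<lambda>c. peval N (w c))"
    "peval N (hquad \<nu> v) = hquad \<nu> (\<lambda>c. peval N (v c))" for v w
    by (simp_all add: hpolar_def hquad_def hom_add hom_mult hom_sum hom_power hom_numeral)
  have cong: "hpolar \<nu> v w = hpolar \<nu> v' w'" "hquad \<nu> v = hquad \<nu> v'"
    if "\<And>c. c < ?n \<Longrightarrow> v c = v' c" "\<And>c. c < ?n \<Longrightarrow> w c = w' c" for v w v' w' :: "nat \<Rightarrow> 'k"
    using that by (simp_all add: hpolar_def hquad_def)
  have e: "peval N (generic_vec ?n i $ hord \<nu> c) = hcoord \<nu> N (c, i)" if "c < ?n" for c i
    using lt[OF that] by (simp add: generic_vec_def peval_simps hcoord_def)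
  show ?thesis
  proof (cases g)
    case (GenQ i)
    show ?thesis
      unfolding GenQ gen_invariant.simps gval.simps qform_eq_hquad hv by (rule cong) (rule e, assumption)+
  next
    case (GenB i j)
    have "generic_vec ?n i \<in> carrier_vec ?n" for i by (simp add: generic_vec_def)
    then show ?thesis
      unfolding GenB gen_invariant.simps gval.simps by (subst polar_eq_hpolar) (auto simp only: hv intro!: cong e)
  next
    case GenD
    have "map_mat (peval N) (mat_of_cols ?n (map (generic_vec ?n) [0..<?n])) = mat ?n ?n N"
      by (rule eq_matI) (auto simp: mat_of_cols_def generic_vec_def peval_simps simp del: upt_Suc)
    then have "peval N (gen_invariant \<nu> g) = det (mat ?n ?n N)"
      unfolding GenD gen_invariant.simps hom_det[symmetric] by simp
    moreover have "mat ?n ?n (hcoord \<nu> N) = mat ?n ?n (\<lambda>(c, i). mat ?n ?n N $$ (hord \<nu> c, i))"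
      by (rule eq_matI) (auto simp: hcoord_def lt[simplified])
    then have "gval \<nu> (hcoord \<nu> N) GenD = signof (hord \<nu>) * det (mat ?n ?n N)"
      unfolding gval.simps using det_permute_rows[OF _ hord_permutes, of "mat ?n ?n N"] by simp
    moreover have "signof (hord \<nu>) = (1::'k)"
      by (cases "hord \<nu>" rule: sign_cases) (simp_all add: char2_simps(2)[OF c2])
    ultimately show ?thesis by (simp add: GenD)
  qed
qed

lemma hcoord_surj: "\<exists>N. hcoord \<nu> N = M"
proof (rule exI)
  show "hcoord \<nu> (\<lambda>(c, i). M (inv_into UNIV (hord \<nu>) c, i)) = M"
    using permutes_inverses(2)[OF hord_permutes] by (auto simp: hcoord_def)
qed

lemma gen_invariant_realize:
  fixes M :: "nat \<times> nat \<Rightarrow> 'k::field"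
  assumes c2: "(2::'k) = 0"
  shows "\<exists>N. \<forall>g\<in>gens (2 * \<nu> + 1). peval N (gen_invariant \<nu> g) = gval \<nu> M g"
  using hcoord_surj peval_gen_invariant[OF c2] by metis

section \<open>The action of the orthogonal group\<close>

definition mat_act :: "nat \<Rightarrow> 'a::comm_ring_1 mat \<Rightarrow> (nat \<times> nat \<Rightarrow> 'a) \<Rightarrow> nat \<times> nat \<Rightarrow> 'a" where
  "mat_act n g N = (\<lambda>(c, i). \<Sum>d<n. g $$ (c, d) * N (d, i))"

lemma peval_act:
  fixes f :: "(nat \<times> nat, 'a::comm_ring_1) mpoly"
  assumes "f \<in> vector_polys n m" "g \<in> carrier_mat n n"
  shows "peval N (act n g f) = peval (mat_act n g N) f"
  unfolding act_def peval_msubst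
proof (rule peval_cong[OF assms(1)[unfolded vector_polys_def]])
  interpret comm_ring_hom "peval N" by (rule comm_ring_hom_peval)
  fix x assume "x \<in> {..<n} \<times> {..<m}"
  then obtain c i where x: "x = (c, i)" "c < n" by auto
  have "peval N ((map_mat mconst g *\<^sub>v generic_vec n i) $ c) = (\<Sum>d<n. g $$ (c, d) * N (d, i))"
    using assms(2) x by (simp add: scalar_prod_def generic_vec_def hom_sum hom_mult peval_simps
        atLeast0LessThan)
  then show "peval N (case x of (c, i) \<Rightarrow> (map_mat mconst g *\<^sub>v generic_vec n i) $ c) = mat_act n g N x"
    by (simp add: x mat_act_def)
qed

lemma invariants_iff:
  fixes f :: "(nat \<times> nat, 'k::field) mpoly"
  assumes inf: "infinite (UNIV :: 'k set)"
  shows "f \<in> invariants \<nu> m \<longleftrightarrow> f \<in> vector_polys (2 * \<nu> + 1) m \<and>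
    (\<forall>g\<in>orthogonal_group \<nu>. \<forall>N. peval (mat_act (2 * \<nu> + 1) g N) f = peval N f)"
proof -
  have "act (2 * \<nu> + 1) g f = f \<longleftrightarrow> (\<forall>N. peval (mat_act (2 * \<nu> + 1) g N) f = peval N f)"
    if "f \<in> vector_polys (2 * \<nu> + 1) m" "g \<in> orthogonal_group \<nu>" for g
  proof -
    have "g \<in> carrier_mat (2 * \<nu> + 1) (2 * \<nu> + 1)" using that(2) by (simp add: orthogonal_group_def)
    note e = peval_act[OF that(1) this, symmetric]
    show ?thesis unfolding e using peval_inject[OF inf, of "act (2 * \<nu> + 1) g f" f] by metis
  qed
  then show ?thesis by (auto simp: invariants_def)
qed

lemma qform_column: "qform \<nu> (vec n (\<lambda>c. N (c, i))) = gval \<nu> (hcoord \<nu> N) (GenQ i)"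
  if "n = 2 * \<nu> + 1"
  using that by (simp add: qform_def hquad_def hcoord_def)

lemma mat_act_column:
  "g \<in> carrier_mat n n \<Longrightarrow> vec n (\<lambda>c. mat_act n g N (c, i)) = g *\<^sub>v vec n (\<lambda>c. N (c, i))"
  by (rule eq_vecI) (auto simp: mat_act_def scalar_prod_def atLeast0LessThan)

text \<open>Q is preserved by definition of the group, B by applying this to sums of two vectors,
  and D because Q and B determine it.\<close>

lemma mat_act_gval:
  fixes N :: "nat \<times> nat \<Rightarrow> 'k::field"
  assumes c2: "(2::'k) = 0" and g: "g \<in> orthogonal_group \<nu>" and h: "h \<in> gens (2 * \<nu> + 1)"
  shows "gval \<nu> (hcoord \<nu> (mat_act (2 * \<nu> + 1) g N)) h = gval \<nu> (hcoord \<nu> N) h"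
proof -
  let ?n = "2 * \<nu> + 1"
  have gc: "g \<in> carrier_mat ?n ?n" using g by (simp add: orthogonal_group_def)
  have Q: "gval \<nu> (hcoord \<nu> (mat_act ?n g N)) (GenQ i) = gval \<nu> (hcoord \<nu> N) (GenQ i)" for N :: "nat \<times> nat \<Rightarrow> 'k" and i
    unfolding qform_column[OF refl, symmetric] mat_act_column[OF gc]
    using g by (simp add: orthogonal_group_def)
  have B: "gval \<nu> (hcoord \<nu> (mat_act ?n g N)) (GenB i j) = gval \<nu> (hcoord \<nu> N) (GenB i j)" for i j
  proof -
    \<comment> \<open>All vectors of this tuple are the sum of the i-th and the j-th one; index 0
      below picks one of them.\<close>
    define N' where "N' = (\<lambda>(c, k :: nat). N (c, i) + N (c, j))"
    have "hquad \<nu> (\<lambda>c. hcoord \<nu> (mat_act ?n g N') (c, 0)) = hquad \<nu> (\<lambda>c. hcoord \<nu> N' (c, 0))"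
      using Q[of N' 0] by simp
    moreover have "hcoord \<nu> (mat_act ?n g N') (c, 0) =
        hcoord \<nu> (mat_act ?n g N) (c, i) + hcoord \<nu> (mat_act ?n g N) (c, j)" for c
      by (simp add: hcoord_def mat_act_def N'_def distrib_left sum.distrib)
    moreover have "hcoord \<nu> N' (c, 0) = hcoord \<nu> N (c, i) + hcoord \<nu> N (c, j)" for c
      by (simp add: hcoord_def N'_def)
    ultimately show ?thesis using Q[of N i] Q[of N j] by (simp add: hquad_add)
  qed
  have QB: "gval \<nu> (hcoord \<nu> (mat_act ?n g N)) h = gval \<nu> (hcoord \<nu> N) h" if "h \<in> qbgens ?n" for h
    using that Q B by (cases h) simp_all
  then show ?thesis using h gval_GenD_cong[OF c2 QB] by (auto simp: gens_eq simp del: gval.simps)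
qed

text \<open>Added vector by vector, a linear combination has a value that involves only Q, B and the
  coefficients. Hence a linear map between tuples with equal Q and B preserves the form on their
  span.\<close>

lemma hquad_combination_cong:
  fixes M M' :: "nat \<times> nat \<Rightarrow> 'a::comm_ring_1"
  assumes "\<And>g. g \<in> qbgens n \<Longrightarrow> gval \<nu> M g = gval \<nu> M' g" "m \<le> n"
  shows "hquad \<nu> (\<lambda>c. \<Sum>i<m. M (c, i) * u i) = hquad \<nu> (\<lambda>c. \<Sum>i<m. M' (c, i) * u i)"
  using assms(2)
proof (induction m)
  case (Suc m)
  have lin: "hpolar \<nu> (\<lambda>c. \<Sum>i<k. M (c, i) * u i) w = (\<Sum>i<k. hpolar \<nu> (\<lambda>c. M (c, i)) w * u i)"
    for M :: "nat \<times> nat \<Rightarrow> 'a" and w k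
    by (simp add: hpolar_def sum_distrib_left sum_distrib_right sum.distrib algebra_simps)
      (intro arg_cong2[of _ _ _ _ "(+)"] sum.swap)
  have sc: "hpolar \<nu> v (\<lambda>c. w c * a) = hpolar \<nu> v w * a" "hquad \<nu> (\<lambda>c. w c * a) = hquad \<nu> w * a\<^sup>2"
    for v w :: "nat \<Rightarrow> 'a" and a
    by (simp_all add: hpolar_def hquad_def sum_distrib_left sum_distrib_right algebra_simps power2_eq_square)
  have Q: "hquad \<nu> (\<lambda>c. M (c, m)) = hquad \<nu> (\<lambda>c. M' (c, m))"
    using assms(1)[of "GenQ m"] Suc.prems by simp
  have B: "hpolar \<nu> (\<lambda>c. M (c, i)) (\<lambda>c. M (c, m)) = hpolar \<nu> (\<lambda>c. M' (c, i)) (\<lambda>c. M' (c, m))" if "i < m" for i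
    using assms(1)[of "GenB i m"] Suc.prems that by simp
  show ?case
    using Suc.IH Suc.prems by (simp add: hquad_add lin sc Q B)
qed simp

text \<open>Both tuples are bases, so g must be A' A^-1. Writing v = A u and g v = A' u reduces the
  isometry property to equal values on combinations with the same coefficients.\<close>

lemma orthogonal_transitive:
  fixes N N' :: "nat \<times> nat \<Rightarrow> 'k::field"
  assumes eq: "\<And>h. h \<in> qbgens (2 * \<nu> + 1) \<Longrightarrow> gval \<nu> (hcoord \<nu> N) h = gval \<nu> (hcoord \<nu> N') h"
    and det: "det (mat (2 * \<nu> + 1) (2 * \<nu> + 1) N) \<noteq> 0" "det (mat (2 * \<nu> + 1) (2 * \<nu> + 1) N') \<noteq> 0"
  shows "\<exists>g\<in>orthogonal_group \<nu>. \<forall>c<2 * \<nu> + 1. \<forall>i<2 * \<nu> + 1. mat_act (2 * \<nu> + 1) g N (c, i) = N' (c, i)"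
proof -
  let ?n = "2 * \<nu> + 1"
  define A where "A = mat ?n ?n N"
  define A' where "A' = mat ?n ?n N'"
  have AC: "A \<in> carrier_mat ?n ?n" "A' \<in> carrier_mat ?n ?n" by (simp_all add: A_def A'_def)
  have inv: "\<exists>B\<in>carrier_mat ?n ?n. X * B = 1\<^sub>m ?n \<and> B * X = 1\<^sub>m ?n"
    if "X \<in> carrier_mat ?n ?n" "det X \<noteq> 0" for X :: "'k mat"
    using det_non_zero_imp_unit[OF that, of "()"] by (auto simp: Units_def ring_mat_def)
  obtain B where B: "B \<in> carrier_mat ?n ?n" "A * B = 1\<^sub>m ?n" "B * A = 1\<^sub>m ?n"
    using inv[OF AC(1)] det(1) by (auto simp: A_def)
  obtain B' where B': "B' \<in> carrier_mat ?n ?n" "A' * B' = 1\<^sub>m ?n" "B' * A' = 1\<^sub>m ?n"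
    using inv[OF AC(2)] det(2) by (auto simp: A'_def)
  define g where "g = A' * B"
  have gC: "g \<in> carrier_mat ?n ?n" using AC B by (simp add: g_def)
  have gA: "g * A = A'" unfolding g_def using AC B by (simp add: assoc_mult_mat[of _ ?n ?n _ ?n _ ?n])
  have "g * (A * B') = 1\<^sub>m ?n"
    using gA AC B' gC by (simp flip: assoc_mult_mat[of _ ?n ?n _ ?n _ ?n])
  moreover have "(A * B') * g = 1\<^sub>m ?n"
    by (rule mat_mult_left_right_inverse[OF gC _ calculation]) (use AC B' in simp)
  ultimately have "invertible_mat g"
    unfolding invertible_mat_def inverts_mat_def using gC AC B' by auto
  moreover have "qform \<nu> (g *\<^sub>v v) = qform \<nu> v" if v: "v \<in> carrier_vec ?n" for v
  proof -
    define u where "u = B *\<^sub>v v"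
    have uC: "u \<in> carrier_vec ?n" using B v by (simp add: u_def)
    have vu: "v = A *\<^sub>v u" unfolding u_def using AC B v
      by (simp flip: assoc_mult_mat_vec[of _ ?n ?n _ ?n])
    have gv: "g *\<^sub>v v = A' *\<^sub>v u" unfolding vu using gC AC uC gA
      by (simp flip: assoc_mult_mat_vec[of _ ?n ?n _ ?n])
    have e: "qform \<nu> (mat ?n ?n X *\<^sub>v u) = hquad \<nu> (\<lambda>c. \<Sum>i<?n. hcoord \<nu> X (c, i) * u $ i)" for X
      using uC by (simp add: qform_def hquad_def hcoord_def scalar_prod_def atLeast0LessThan
          del: sum.lessThan_Suc)
    show ?thesis
      unfolding gv unfolding vu A_def A'_def e by (rule hquad_combination_cong[OF eq[symmetric] order_refl])
  qed
  ultimately have "g \<in> orthogonal_group \<nu>" using gC by (simp add: orthogonal_group_def)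
  moreover have "mat_act ?n g N (c, i) = N' (c, i)" if "c < ?n" "i < ?n" for c i
  proof -
    have "(g * A) $$ (c, i) = mat_act ?n g N (c, i)"
      using that gC by (simp add: A_def mat_act_def scalar_prod_def atLeast0LessThan del: sum.lessThan_Suc)
    then show ?thesis using that by (simp add: gA A'_def)
  qed
  ultimately show ?thesis by blast
qed

lemma invariants_eq_hull:
  assumes c2: "(2::'k::alg_closed_field) = 0"
  shows "(invariants \<nu> (2 * \<nu> + 1) :: (nat \<times> nat, 'k) mpoly set) =
    is_subalgebra hull (gen_invariant \<nu> ` gens (2 * \<nu> + 1))"
proof -
  let ?n = "2 * \<nu> + 1"
  let ?I = "invariants \<nu> ?n :: (nat \<times> nat, 'k) mpoly set"
  let ?A = "is_subalgebra hull (gen_invariant \<nu> ` gens ?n) :: (nat \<times> nat, 'k) mpoly set"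
  note inf = infinite_alg_closed[where 'k = 'k]
  note iff = invariants_iff[OF inf]
  have "is_subalgebra ?I"
    unfolding is_subalgebra_def
  proof (intro conjI ballI allI)
    show "mconst c \<in> ?I" for c by (simp add: iff peval_simps vector_polys_def polys_in_const)
    fix f g assume "f \<in> ?I" "g \<in> ?I"
    then show "f + g \<in> ?I" "f * g \<in> ?I"
      by (simp_all add: iff peval_simps vector_polys_def polys_in_add polys_in_mult)
  qed
  moreover have "gen_invariant \<nu> ` gens ?n \<subseteq> ?I"
    using gen_invariant_in peval_gen_invariant[OF c2] mat_act_gval[OF c2] by (auto simp: iff simp del: gval.simps)
  ultimately have "?A \<subseteq> ?I" by (simp add: hull_minimal)
  moreover have "?I \<subseteq> ?A"
  proof
    fix f assume f: "f \<in> ?I"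
    then have fP: "f \<in> polys_in ({..<?n} \<times> {..<?n})" by (simp add: iff vector_polys_def)
    have inv: "peval N f = peval N' f"
      if eq: "\<And>h. h \<in> gens ?n \<Longrightarrow> gval \<nu> (hcoord \<nu> N) h = gval \<nu> (hcoord \<nu> N') h"
        and nz: "gval \<nu> (hcoord \<nu> N) GenD \<noteq> 0" for N N'
    proof -
      have D: "GenD \<in> gens ?n" by (simp add: gens_eq)
      have d: "det (mat ?n ?n N) = gval \<nu> (hcoord \<nu> N) GenD" for N :: "nat \<times> nat \<Rightarrow> 'k"
      proof -
        interpret comm_ring_hom "peval N" by (rule comm_ring_hom_peval)
        have "map_mat (peval N) (mat_of_cols ?n (map (generic_vec ?n) [0..<?n])) = mat ?n ?n N"
          by (rule eq_matI) (auto simp: mat_of_cols_def generic_vec_def peval_simps simp del: upt_Suc)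
        then show ?thesis
          unfolding peval_gen_invariant[OF c2 D, symmetric] gen_invariant.simps hom_det[symmetric] by simp
      qed
      have "det (mat ?n ?n N) \<noteq> 0" "det (mat ?n ?n N') \<noteq> 0"
        using nz eq[OF D] unfolding d by simp_all
      moreover have "gval \<nu> (hcoord \<nu> N) h = gval \<nu> (hcoord \<nu> N') h" if "h \<in> qbgens ?n" for h
        by (rule eq) (use that in \<open>simp add: gens_eq\<close>)
      ultimately obtain g where "g \<in> orthogonal_group \<nu>"
        and gN: "\<forall>c<?n. \<forall>i<?n. mat_act ?n g N (c, i) = N' (c, i)"
        using orthogonal_transitive[of \<nu> N N'] by blast
      then have "peval N f = peval (mat_act ?n g N) f" using f by (simp add: iff)
      also have "\<dots> = peval N' f" by (rule peval_cong[OF fP]) (use gN in auto)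
      finally show ?thesis .
    qed
    \<comment> \<open>\<open>f\<close> read in hyperbolic coordinates; the inverse permutation
      undoes \<open>hcoord\<close>.\<close>
    define h where "h M = peval (\<lambda>(c, i). M (inv_into UNIV (hord \<nu>) c, i)) f" for M
    have hN: "h (hcoord \<nu> N) = peval N f" for N
      using permutes_inverses(1)[OF hord_permutes] by (simp add: h_def hcoord_def)
    have "(inv_into UNIV (hord \<nu>)) c < ?n" if "c < ?n" for c
      using permutes_in_image[OF permutes_inv[OF hord_permutes], of \<nu> c] that by simp
    then have "h \<in> pfun ({..<?n} \<times> {..<?n})"
      unfolding h_def[abs_def] pfun_def
      by (intro pfun_pullback[OF peval_pfun[OF fP]]) (auto intro!: falg.gen simp del: One_nat_def)
    moreover have "gram_invariant \<nu> h"
      unfolding gram_invariant_def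
    proof (intro allI impI)
      fix M M' :: "nat \<times> nat \<Rightarrow> 'k"
      obtain N N' where N: "hcoord \<nu> N = M" "hcoord \<nu> N' = M'" using hcoord_surj by metis
      assume "\<forall>g\<in>gens ?n. gval \<nu> M g = gval \<nu> M' g" "gval \<nu> M GenD \<noteq> 0"
      then show "h M = h M'" using inv[of N N'] unfolding N[symmetric] hN by blast
    qed
    ultimately have "h \<in> falg ((\<lambda>g M. gval \<nu> M g) ` gens ?n)"
      by (rule gram_invariant_generated[OF c2])
    then have "(\<lambda>N. h (hcoord \<nu> N)) \<in> falg ((\<lambda>g N. peval N (gen_invariant \<nu> g)) ` gens ?n)"
    proof (rule falg_pullback)
      fix g :: "(nat \<times> nat \<Rightarrow> 'k) \<Rightarrow> 'k" assume "g \<in> (\<lambda>g M. gval \<nu> M g) ` gens ?n"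
      then obtain s where s: "s \<in> gens ?n" "g = (\<lambda>M. gval \<nu> M s)" by auto
      then have "(\<lambda>N. g (hcoord \<nu> N)) = (\<lambda>N. peval N (gen_invariant \<nu> s))"
        using peval_gen_invariant[OF c2 s(1)] by auto
      then show "(\<lambda>N. g (hcoord \<nu> N)) \<in> falg ((\<lambda>g N. peval N (gen_invariant \<nu> g)) ` gens ?n)"
        using s(1) by (auto intro: falg.gen)
    qed
    then obtain p where p: "p \<in> ?A" "\<And>N. peval N p = peval N f"
      using falg_peval_hull unfolding hN by blast
    have "p = f" by (rule peval_inject[OF inf p(2)])
    with p(1) show "f \<in> ?A" by simp
  qed
  ultimately show ?thesis by blast
qed

section \<open>The relations\<close>

text \<open>Division with remainder by \<open>G_rel n\<close>, which is monic of degree 2 in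
  \<open>GenD\<close>, with coefficients in the polynomials in Q and B.\<close>

lemma reduce_mod_G_rel:
  fixes p :: "(gen, 'a::comm_ring_1) mpoly"
  assumes "p \<in> polys_in (gens n)"
  shows "\<exists>p0\<in>polys_in (qbgens n). \<exists>p1\<in>polys_in (qbgens n). \<exists>s\<in>polys_in (gens n).
    p = p0 + p1 * mvar GenD + s * G_rel n"
proof -
  let ?Q = "polys_in (qbgens n) :: (gen, 'a) mpoly set" and ?P = "polys_in (gens n) :: (gen, 'a) mpoly set"
  have QP: "?Q \<subseteq> ?P" by (rule polys_in_mono) (auto simp: gens_eq)
  have D: "mvar GenD \<in> ?P" by (rule polys_in_var) (simp add: gens_eq)
  have H: "hdisc n \<in> ?Q" by (rule hdisc_in)
  have G: "G_rel n \<in> ?P" unfolding G_rel_eq using D H QP by (auto intro: polys_in_diff polys_in_power)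
  show ?thesis using assms
  proof (induction rule: polys_in_induct)
    case (const c)
    show ?case
      by (rule bexI[of _ "mconst c"], rule bexI[of _ 0], rule bexI[of _ 0])
        (simp_all add: polys_in_const polys_in_0)
  next
    case (var x)
    then consider "x = GenD" | "x \<in> qbgens n" by (auto simp: gens_eq)
    then show ?case
    proof cases
      case 1
      then show ?thesis
        by (intro bexI[of _ 0 ?Q] bexI[of _ 1 ?Q] bexI[of _ 0 ?P]) (simp_all add: polys_in_1 polys_in_0)
    next
      case 2
      then show ?thesis
        by (intro bexI[of _ "mvar x" ?Q] bexI[of _ 0 ?Q] bexI[of _ 0 ?P])
          (simp_all add: polys_in_var polys_in_0)
    qed
  next
    case (add p q)
    then obtain p0 p1 s q0 q1 t where *: "p0 \<in> ?Q" "p1 \<in> ?Q" "s \<in> ?P" "q0 \<in> ?Q" "q1 \<in> ?Q" "t \<in> ?P"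
      and e: "p = p0 + p1 * mvar GenD + s * G_rel n" "q = q0 + q1 * mvar GenD + t * G_rel n" by blast
    have "p + q = (p0 + q0) + (p1 + q1) * mvar GenD + (s + t) * G_rel n"
      by (simp add: e algebra_simps)
    with * show ?case by (blast intro: polys_in_add)
  next
    case (mult p q)
    then obtain p0 p1 s q0 q1 t where *: "p0 \<in> ?Q" "p1 \<in> ?Q" "s \<in> ?P" "q0 \<in> ?Q" "q1 \<in> ?Q" "t \<in> ?P"
      and e: "p = p0 + p1 * mvar GenD + s * G_rel n" "q = q0 + q1 * mvar GenD + t * G_rel n" by blast
    \<comment> \<open>The term p1 * q1 comes from writing D^2 as \<open>G_rel n\<close> plus the
      half determinant, the other two from the quotients of p and q.\<close>
    let ?s = "p1 * q1 + s * q + (p0 + p1 * mvar GenD) * t"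
    have "p * q = (p0 + p1 * mvar GenD) * (q0 + q1 * mvar GenD) +
        (s * q + (p0 + p1 * mvar GenD) * t) * G_rel n"
      unfolding e by (simp add: algebra_simps)
    also have "(p0 + p1 * mvar GenD) * (q0 + q1 * mvar GenD) =
        (p0 * q0 + p1 * q1 * hdisc n) + (p0 * q1 + p1 * q0) * mvar GenD + p1 * q1 * G_rel n"
      unfolding G_rel_eq by (simp add: algebra_simps power2_eq_square)
    finally have "p * q = (p0 * q0 + p1 * q1 * hdisc n) + (p0 * q1 + p1 * q0) * mvar GenD + ?s * G_rel n"
      by (simp add: algebra_simps)
    moreover have "p0 * q0 + p1 * q1 * hdisc n \<in> ?Q" "p0 * q1 + p1 * q0 \<in> ?Q"
      using * H by (simp_all add: polys_in_add polys_in_mult)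
    moreover have "?s \<in> ?P"
    proof -
      have "p0 \<in> ?P" "p1 \<in> ?P" "q0 \<in> ?P" "q1 \<in> ?P" using * QP by auto
      then show ?thesis using * D G unfolding e by (intro polys_in_add polys_in_mult)
    qed
    ultimately show ?case by blast
  qed
qed

text \<open>Modulo \<open>G_rel\<close> a relation becomes p0 + p1 D, which still vanishes at all
  tuples; independence with empty \<open>E\<close> gives p0 = p1 = 0.\<close>

lemma relation_ideal_eq_hull:
  assumes c2: "(2::'k::alg_closed_field) = 0"
  shows "(relation_ideal \<nu> :: (gen, 'k) mpoly set) =
    is_ideal_of (polys_in (gens (2 * \<nu> + 1))) hull {G_rel (2 * \<nu> + 1)}"
proof -
  let ?n = "2 * \<nu> + 1"
  let ?P = "polys_in (gens ?n) :: (gen, 'k) mpoly set"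
  let ?I = "relation_ideal \<nu> :: (gen, 'k) mpoly set"
  note inf = infinite_alg_closed[where 'k = 'k]
  have iff: "p \<in> ?I \<longleftrightarrow> p \<in> ?P \<and> (\<forall>M. peval (gval \<nu> M) p = 0)" for p
  proof -
    have "msubst (gen_invariant \<nu>) p = 0 \<longleftrightarrow> (\<forall>M. peval (gval \<nu> M) p = 0)" if p: "p \<in> ?P"
    proof
      assume 0: "msubst (gen_invariant \<nu>) p = 0"
      show "\<forall>M. peval (gval \<nu> M) p = 0"
      proof
        fix M :: "nat \<times> nat \<Rightarrow> 'k"
        obtain N where N: "\<And>g. g \<in> gens ?n \<Longrightarrow> peval N (gen_invariant \<nu> g) = gval \<nu> M g"
          using gen_invariant_realize[OF c2, of \<nu> M] by blast
        have "peval (gval \<nu> M) p = peval (\<lambda>g. peval N (gen_invariant \<nu> g)) p"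
          by (rule peval_cong[OF p N[symmetric]])
        also have "\<dots> = peval N (msubst (gen_invariant \<nu>) p)" by (simp only: peval_msubst)
        finally show "peval (gval \<nu> M) p = 0" by (simp add: 0 peval_simps)
      qed
    next
      assume 0: "\<forall>M. peval (gval \<nu> M) p = 0"
      show "msubst (gen_invariant \<nu>) p = 0"
      proof (rule peval_zero_imp_zero[OF inf])
        fix N :: "nat \<times> nat \<Rightarrow> 'k"
        have "peval N (msubst (gen_invariant \<nu>) p) = peval (gval \<nu> (hcoord \<nu> N)) p"
          unfolding peval_msubst by (rule peval_cong[OF p peval_gen_invariant[OF c2]])
        then show "peval N (msubst (gen_invariant \<nu>) p) = 0" by (simp only: 0)
      qed
    qed
    then show ?thesis by (auto simp: relation_ideal_def)
  qed
  have GI: "G_rel ?n \<in> ?I"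
  proof -
    have "G_rel ?n \<in> ?P"
      unfolding G_rel_eq using hdisc_in polys_in_mono[of "qbgens ?n" "gens ?n"]
      by (auto intro!: polys_in_diff polys_in_power polys_in_var simp: gens_eq)
    moreover have "peval (gval \<nu> M) (G_rel ?n) = 0" for M :: "nat \<times> nat \<Rightarrow> 'k"
    proof -
      interpret comm_ring_hom "peval (gval \<nu> M)" by (rule comm_ring_hom_peval)
      show ?thesis
        unfolding G_rel_eq by (simp only: hom_minus hom_power hdisc_gval[OF c2] peval_simps diff_self)
    qed
    ultimately show ?thesis by (simp add: iff)
  qed
  have "is_ideal_of ?P ?I"
    unfolding is_ideal_of_def
    by (auto simp: iff peval_simps polys_in_0 polys_in_add polys_in_mult)
  with GI have "is_ideal_of ?P hull {G_rel ?n} \<subseteq> ?I" by (intro hull_minimal) simp_all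
  moreover have "?I \<subseteq> is_ideal_of ?P hull {G_rel ?n}"
  proof
    fix p assume p: "p \<in> ?I"
    then obtain p0 p1 s where *: "p0 \<in> polys_in (qbgens ?n)" "p1 \<in> polys_in (qbgens ?n)" "s \<in> ?P"
      and e: "p = p0 + p1 * mvar GenD + s * G_rel ?n"
      using reduce_mod_G_rel[of p ?n] by (auto simp: iff)
    have "peval \<sigma> p0 = 0 \<and> peval \<sigma> p1 = 0" for \<sigma>
    proof (rule one_GenD_independent[OF c2 peval_pfun[OF *(1)] peval_pfun[OF *(2)], of "{}"])
      fix M :: "nat \<times> nat \<Rightarrow> 'k"
      have "peval (gval \<nu> M) p = 0" "peval (gval \<nu> M) (G_rel ?n) = 0" using p GI by (simp_all add: iff)
      then show "peval (gval \<nu> M) p0 + peval (gval \<nu> M) p1 * gval \<nu> M GenD = 0"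
        unfolding e by (simp add: peval_simps del: gval.simps)
    qed auto
    then have "p0 = 0" "p1 = 0" using peval_zero_imp_zero[OF inf] by blast+
    then have "p = s * G_rel ?n" by (simp add: e)
    with *(3) show "p \<in> is_ideal_of ?P hull {G_rel ?n}"
      by (auto simp: hull_def is_ideal_of_def)
  qed
  ultimately show ?thesis by blast
qed

theorem theorem4p10:
  fixes \<nu> n :: nat
  assumes "CHAR('k::alg_closed_field) = 2"
    and "n = 2 * \<nu> + 1"
  shows "(invariants \<nu> n :: (nat \<times> nat, 'k) mpoly set) =
           is_subalgebra hull (gen_invariant \<nu> ` gens n)
       \<and> (relation_ideal \<nu> :: (gen, 'k) mpoly set) =
           is_ideal_of (polys_in (gens n)) hull {G_rel n}"
proof -
  have "(2::'k) = 0" using of_nat_CHAR[where 'a = 'k] assms(1) by simp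
  then show ?thesis using invariants_eq_hull relation_ideal_eq_hull assms(2) by blast
qed

end
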